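(* Let $N\ge1$. For all $u\in W^{1,2}(\mathbb{R}^N)$ with $\|xu\|_2<\infty$, $$\delta_2(u)\ \ge\ N\left(\int_{\mathbb{R}^N}|u|^2dx\right)d_1(u,E)^2+d_1(u,E)^4$$ and $$\delta_2(u)\ \ge\ \frac N2\left(\int_{\mathbb{R}^N}|u|^2dx\right)d_2(u,E)^2+\frac14 d_2(u,E)^4.$$ These inequalities are sharp, and in each of them equality is attained by nontrivial functions.
   Context: All functions are real-valued, $\|\cdot\|_2$ is the $L^2(\mathbb{R}^N)$ norm. $$\delta_2(u):=\left(\int_{\mathbb{R}^N}|\nabla u|^2dx\right)\left(\int_{\mathbb{R}^N}|x|^2|u|^2dx\right)-\frac{N^2}{4}\left(\int_{\mathbb{R}^N}|u|^2dx\right)^2.$$ $E=\{ce^{-\alpha|x|^2}: c\in\mathbb{R},\ \alpha>0\}$, $$d_1(u,E):=\inf_{c\in\mathbb{R},\alpha>0}\left\|u-ce^{-\alpha|x|^2}\right\|_2,\qquad d_2(u,E):=\inf_{c\in\mathbb{R},\alpha>0}\left\{\left\|u-ce^{-\alpha|x|^2}\right\|_2:\ \|u\|_2=\left\|ce^{-\alpha|x|^2}\right\|_2\right\}.$$ "Sharp" means that in neither inequality can one of the constants on the right be replaced by a larger one while keeping the other; "nontrivial" means that equality holds for some $u$ for which the two sides are not both zero. *)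

theory Defs
  imports "HOL-Analysis.Analysis"
begin

text \<open>
  Euclidean space of dimension \<open>N \<ge> 1\<close> is a type \<open>'a\<close> of class \<open>euclidean_space\<close> with
  \<open>N = DIM('a)\<close>. Elements of \<open>L\<^sup>2\<close> and \<open>W\<^sup>1\<^sup>,\<^sup>2\<close> are represented by Lebesgue measurable functions
  rather than by classes of such functions modulo null sets; everything below depends only on
  the class.
\<close>

primrec Ck :: "nat \<Rightarrow> ('a::euclidean_space \<Rightarrow> real) \<Rightarrow> bool" where
  "Ck 0 f \<longleftrightarrow> continuous_on UNIV f"
| "Ck (Suc k) f \<longleftrightarrow>
     f differentiable_on UNIV \<and> (\<forall>i\<in>Basis. Ck k (\<lambda>x. frechet_derivative f (at x) i))"

definition test_fun :: "('a::euclidean_space \<Rightarrow> real) \<Rightarrow> bool" where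
  "test_fun \<phi> \<longleftrightarrow> (\<forall>k. Ck k \<phi>) \<and> compact (closure {x. \<phi> x \<noteq> 0})"

definition locally_integrable ::
  "('a::euclidean_space \<Rightarrow> 'b::euclidean_space) \<Rightarrow> bool" where
  "locally_integrable f \<longleftrightarrow> (\<forall>K. compact K \<longrightarrow> f absolutely_integrable_on K)"

definition is_weak_gradient ::
  "('a::euclidean_space \<Rightarrow> real) \<Rightarrow> ('a \<Rightarrow> 'a) \<Rightarrow> bool" where
  "is_weak_gradient u g \<longleftrightarrow>
     locally_integrable u \<and> locally_integrable g \<and>
     (\<forall>\<phi>. test_fun \<phi> \<longrightarrow>
       (\<forall>i\<in>Basis. (\<integral>x. u x * frechet_derivative \<phi> (at x) i \<partial>lebesgue)
                  = - (\<integral>x. (g x \<bullet> i) * \<phi> x \<partial>lebesgue)))"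

text \<open>A weak gradient is unique up to a null set, so the choice made by \<open>SOME\<close> is immaterial.\<close>

definition weak_gradient :: "('a::euclidean_space \<Rightarrow> real) \<Rightarrow> 'a \<Rightarrow> 'a" where
  "weak_gradient u = (SOME g. is_weak_gradient u g)"

definition square_integrable ::
  "('a::euclidean_space \<Rightarrow> 'b::euclidean_space) \<Rightarrow> bool" where
  "square_integrable f \<longleftrightarrow>
     f \<in> borel_measurable lebesgue \<and> integrable lebesgue (\<lambda>x. (norm (f x))\<^sup>2)"

definition L2norm :: "('a::euclidean_space \<Rightarrow> 'b::euclidean_space) \<Rightarrow> real" where
  "L2norm f = sqrt (\<integral>x. (norm (f x))\<^sup>2 \<partial>lebesgue)"

definition W12 :: "('a::euclidean_space \<Rightarrow> real) set" where
  "W12 = {u. square_integrable u \<and> (\<exists>g. is_weak_gradient u g \<and> square_integrable g)}"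

definition W12_weighted :: "('a::euclidean_space \<Rightarrow> real) set" where
  "W12_weighted = {u \<in> W12. square_integrable (\<lambda>x. u x *\<^sub>R x)}"

definition delta2 :: "('a::euclidean_space \<Rightarrow> real) \<Rightarrow> real" where
  "delta2 u =
     (\<integral>x. (norm (weak_gradient u x))\<^sup>2 \<partial>lebesgue)
       * (\<integral>x. (norm x)\<^sup>2 * (u x)\<^sup>2 \<partial>lebesgue)
     - (real DIM('a))\<^sup>2 / 4 * (\<integral>x. (u x)\<^sup>2 \<partial>lebesgue)\<^sup>2"

definition gaussian :: "real \<Rightarrow> real \<Rightarrow> 'a::euclidean_space \<Rightarrow> real" where
  "gaussian c \<alpha> x = c * exp (- \<alpha> * (norm x)\<^sup>2)"

definition d1 :: "('a::euclidean_space \<Rightarrow> real) \<Rightarrow> real" where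
  "d1 u = Inf {L2norm (\<lambda>x. u x - gaussian c \<alpha> x) | c \<alpha>. \<alpha> > 0}"

definition d2 :: "('a::euclidean_space \<Rightarrow> real) \<Rightarrow> real" where
  "d2 u = Inf {L2norm (\<lambda>x. u x - gaussian c \<alpha> x) | c \<alpha>.
                 \<alpha> > 0 \<and> L2norm u = L2norm (gaussian c \<alpha> :: 'a \<Rightarrow> real)}"

definition stability_rhs ::
  "(('a::euclidean_space \<Rightarrow> real) \<Rightarrow> real) \<Rightarrow> real \<Rightarrow> real \<Rightarrow> ('a \<Rightarrow> real) \<Rightarrow> real" where
  "stability_rhs d a b u = a * (\<integral>x. (u x)\<^sup>2 \<partial>lebesgue) * (d u)\<^sup>2 + b * (d u) ^ 4"

definition stability_ineq ::
  "(('a::euclidean_space \<Rightarrow> real) \<Rightarrow> real) \<Rightarrow> real \<Rightarrow> real \<Rightarrow> bool" where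
  "stability_ineq d a b \<longleftrightarrow> (\<forall>u\<in>W12_weighted. delta2 u \<ge> stability_rhs d a b u)"

definition sharp_constants ::
  "(('a::euclidean_space \<Rightarrow> real) \<Rightarrow> real) \<Rightarrow> real \<Rightarrow> real \<Rightarrow> bool" where
  "sharp_constants d a b \<longleftrightarrow>
     (\<forall>a'>a. \<not> stability_ineq d a' b) \<and> (\<forall>b'>b. \<not> stability_ineq d a b')"

definition attained_nontrivially ::
  "(('a::euclidean_space \<Rightarrow> real) \<Rightarrow> real) \<Rightarrow> real \<Rightarrow> real \<Rightarrow> bool" where
  "attained_nontrivially d a b \<longleftrightarrow>
     (\<exists>u\<in>W12_weighted. delta2 u = stability_rhs d a b u
        \<and> \<not> (delta2 u = 0 \<and> stability_rhs d a b u = 0))"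

end

theory Submission
  imports Defs
begin

text \<open>
  Write \<open>X = \<integral>|\<nabla>u|\<^sup>2\<close>, \<open>Y = \<integral>|x|\<^sup>2u\<^sup>2\<close>, \<open>Z = \<integral>u\<^sup>2\<close> and \<open>G(x) = exp (- l |x|\<^sup>2 / 2)\<close>. Both inequalities follow from
  the spectral gap of the harmonic oscillator,
  \<open>X + l\<^sup>2 Y \<ge> N l Z + 2 l (Z - \<langle>u, G\<rangle>\<^sup>2 / \<langle>G, G\<rangle>)\<close> for all \<open>l > 0\<close>: the bracket is the squared
  distance from \<open>u\<close> to the line spanned by \<open>G\<close>, hence at least \<open>d\<^sub>1\<^sup>2\<close>, and also at least \<open>d\<^sub>2\<^sup>2 / 2\<close>,
  and optimizing over \<open>l\<close> is a discriminant condition. The function \<open>x\<^sub>1 exp (- |x|\<^sup>2 / 2)\<close>, an eigenfunction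
  for the second eigenvalue, gives equality in both, and equality implies sharpness.

  For the gap, let \<open>\<phi>(t) = \<integral>\<integral> K\<^sub>t(x,y) u(x) u(y)\<close> with the Mehler kernel \<open>K\<^sub>t\<close>, parametrized so that
  \<open>t = 1\<close> is the projection onto \<open>G\<close> and \<open>t \<rightarrow> 0\<close> the identity. Integrating by parts in
  both variables gives \<open>- l (1 + t)\<^sup>2 \<phi>'(t) = \<integral>\<integral> K\<^sub>t(x,y) Du(x) \<bullet> Du(y)\<close> with \<open>Du = \<nabla>u + l x u\<close>. The right-hand side
  is at most \<open>\<integral>|Du|\<^sup>2 = X + l\<^sup>2 Y - N l Z\<close>, and integrating from 0 to 1 gives the claim.
\<close>

section \<open>Smooth functions and bump functions\<close>

text \<open>Let u_k be the component of u in the k-th eigenspace of the harmonic oscillator and r =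
  (1 - t) / (1 + t). Then \<phi>(t) is the sum of r^k |u_k|^2. The operator D lowers k by one and
  Du_k has squared norm 2 l k |u_k|^2, so the double integral with Du is the sum of 2 l k r^(k-1)
  |u_k|^2; replacing r by 1 there is the whole gap argument. The factor 2 l is the reciprocal of the
  integral of 1 / (l (1 + t)^2) over (0, 1). The kernel realizes these sums as integrals, so that
  completeness of the Hermite functions never enters. The obstacle is regularity: u has only a weak
  gradient, tested against smooth functions of compact support. For fixed t > 0 the kernel is smooth
  with Gaussian decay, so all derivatives are moved onto it once testing has been extended to that
  class. The bound by the integral of |Du|^2 is a Schur test whose weight is the ground state G. The
  cross term of |Du|^2, the integral of u x . grad u, is not found by testing with u itself: its
  value - N Z / 2 appears as the limit t -> 0 of the same integrals.\<close>

abbreviation "partial i f x \<equiv> frechet_derivative f (at x) i"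

lemmas lint_cong = Bochner_Integration.integral_cong
  and lint_bound = Bochner_Integration.integrable_bound

lemma Ck_SucI:
  assumes "\<And>x. (f has_derivative D x) (at x)"
    and "\<And>i. i \<in> Basis \<Longrightarrow> Ck k (\<lambda>x. D x i)"
  shows "Ck (Suc k) f"
proof -
  have "frechet_derivative f (at x) = D x" for x using frechet_derivative_at[OF assms(1)] by simp
  moreover have "f differentiable_on UNIV"
    using assms(1) by (auto simp: differentiable_on_def differentiable_def)
  ultimately show ?thesis using assms(2) by simp
qed

lemma Ck_Suc_has_derivative:
  "Ck (Suc k) f \<Longrightarrow> (f has_derivative frechet_derivative f (at x)) (at x)"
  by (simp add: differentiable_on_def frechet_derivative_works)

lemma Ck_Suc_imp_Ck: "Ck (Suc k) f \<Longrightarrow> Ck k f"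
proof (induction k arbitrary: f)
  case 0
  then show ?case by (simp add: differentiable_imp_continuous_on)
next
  case (Suc k)
  then have "\<forall>i\<in>Basis. Ck k (\<lambda>x. partial i f x)" by (metis Ck.simps(2))
  moreover have "f differentiable_on UNIV" using Suc.prems by simp
  ultimately show ?case by simp
qed

lemma Ck_const: "Ck k (\<lambda>x. c)"
proof (induction k arbitrary: c)
  case (Suc k)
  show ?case by (rule Ck_SucI[where D="\<lambda>x h. 0"]) (auto intro: Suc)
qed simp

lemma Ck_inner: "Ck k (\<lambda>x. x \<bullet> v)"
proof (cases k)
  case (Suc n)
  show ?thesis unfolding Suc by (rule Ck_SucI[where D="\<lambda>x h. h \<bullet> v"])
       (auto intro!: derivative_eq_intros Ck_const)
qed (simp add: continuous_intros)

lemma Ck_add: "Ck k f \<Longrightarrow> Ck k g \<Longrightarrow> Ck k (\<lambda>x. f x + g x)"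
proof (induction k arbitrary: f g)
  case 0
  then show ?case by (auto intro: continuous_on_add)
next
  case (Suc k)
  note d = Suc.prems[THEN Ck_Suc_has_derivative]
  show ?case by (rule Ck_SucI[OF has_derivative_add[OF d]]) (use Suc in auto)
qed

lemma Ck_mult: "Ck k f \<Longrightarrow> Ck k g \<Longrightarrow> Ck k (\<lambda>x. f x * g x)"
proof (induction k arbitrary: f g)
  case 0
  then show ?case by (auto intro: continuous_on_mult)
next
  case (Suc k)
  note d = Suc.prems[THEN Ck_Suc_has_derivative]
  have k: "Ck k f" "Ck k g" using Suc.prems Ck_Suc_imp_Ck by blast+
  show ?case
  proof (rule Ck_SucI[OF has_derivative_mult[OF d]])
    fix i :: 'a assume i: "i \<in> Basis"
    show "Ck k (\<lambda>x. f x * partial i g x + partial i f x * g x)"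
      using Suc k i by (intro Ck_add Suc.IH) auto
  qed
qed

text \<open>A set of real functions closed under differentiation stands in for smoothness of the
  outer function: the chain rule yields a product whose outer factor is again a member of
  \<open>S\<close> composed with \<open>f\<close>, so the induction on \<open>k\<close> closes. It
  serves \<open>exp\<close> with a singleton and the flat functions with the range of
  \<open>flat_exp\<close>.\<close>

lemma Ck_compose:
  fixes f :: "'a::euclidean_space \<Rightarrow> real"
  assumes S: "\<And>h. h \<in> S \<Longrightarrow> \<exists>h'\<in>S. \<forall>t. (h has_real_derivative h' t) (at t)"
  shows "h \<in> S \<Longrightarrow> Ck k f \<Longrightarrow> Ck k (\<lambda>x. h (f x))"
proof (induction k arbitrary: h)
  case 0
  then obtain h' where "\<forall>t. (h has_real_derivative h' t) (at t)" using S by blast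
  then have "continuous_on UNIV h" by (auto intro: DERIV_continuous_on has_field_derivative_subset)
  then show ?case using 0 by (auto intro: continuous_on_compose2)
next
  case (Suc k)
  then obtain h' where h': "h' \<in> S" "\<And>t. (h has_real_derivative h' t) (at t)" using S by blast
  have d: "((\<lambda>x. h (f x)) has_derivative (\<lambda>v. frechet_derivative f (at x) v * h' (f x))) (at x)"
    for x using has_derivative_compose[OF Ck_Suc_has_derivative[OF Suc.prems(2)]
          h'(2)[unfolded has_field_derivative_def]] by (simp add: mult.commute)
  show ?case
  proof (rule Ck_SucI[OF d])
    fix i :: 'a assume "i \<in> Basis"
    then show "Ck k (\<lambda>x. partial i f x * h' (f x))"
      using Suc h'(1) Ck_Suc_imp_Ck by (intro Ck_mult) auto
  qed
qed

definition smooth :: "('a::euclidean_space \<Rightarrow> real) \<Rightarrow> bool" where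
  "smooth f \<longleftrightarrow> (\<forall>k. Ck k f)"

named_theorems smooth_intros

lemma smooth_const [smooth_intros]: "smooth (\<lambda>x. c)" by (simp add: smooth_def Ck_const)

lemma smooth_inner [smooth_intros]: "smooth (\<lambda>x. x \<bullet> v)" by (simp add: smooth_def Ck_inner)

lemma smooth_add [smooth_intros]: "smooth f \<Longrightarrow> smooth g \<Longrightarrow> smooth (\<lambda>x. f x + g x)"
  by (simp add: smooth_def Ck_add)

lemma smooth_mult [smooth_intros]: "smooth f \<Longrightarrow> smooth g \<Longrightarrow> smooth (\<lambda>x. f x * g x)"
  by (simp add: smooth_def Ck_mult)

lemma smooth_minus [smooth_intros]: "smooth f \<Longrightarrow> smooth (\<lambda>x. - f x)"
  using smooth_mult[OF smooth_const[of "-1"]] by simp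

lemma smooth_diff [smooth_intros]: "smooth f \<Longrightarrow> smooth g \<Longrightarrow> smooth (\<lambda>x. f x - g x)"
  using smooth_add[OF _ smooth_minus] by simp

lemma smooth_sum [smooth_intros]:
  "finite A \<Longrightarrow> (\<And>i. i \<in> A \<Longrightarrow> smooth (f i)) \<Longrightarrow> smooth (\<lambda>x. \<Sum>i\<in>A. f i x)"
  by (induction A rule: finite_induct) (auto intro: smooth_intros)

lemma smooth_prod [smooth_intros]:
  "finite A \<Longrightarrow> (\<And>i. i \<in> A \<Longrightarrow> smooth (f i)) \<Longrightarrow> smooth (\<lambda>x. \<Prod>i\<in>A. f i x)"
  by (induction A rule: finite_induct) (auto intro: smooth_intros)

lemma smooth_norm_sq [smooth_intros]: "smooth (\<lambda>x. (norm x)^2)"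
proof -
  have "(norm x)^2 = (\<Sum>i\<in>Basis. (x \<bullet> i) * (x \<bullet> i))" for x :: 'a
    by (simp only: power2_norm_eq_inner flip: euclidean_inner)
  then show ?thesis by (auto intro!: smooth_intros)
qed

lemma smooth_exp [smooth_intros]: "smooth f \<Longrightarrow> smooth (\<lambda>x. exp (f x))"
  unfolding smooth_def using Ck_compose[of "{exp}" exp] by (auto intro: DERIV_exp)

lemma smooth_has_derivative:
  "smooth f \<Longrightarrow> (f has_derivative frechet_derivative f (at x)) (at x)"
  using Ck_Suc_has_derivative unfolding smooth_def by blast

lemma smooth_derivative:
  "smooth f \<Longrightarrow> i \<in> Basis \<Longrightarrow> smooth (\<lambda>x. partial i f x)" unfolding smooth_def by (metis Ck.simps(2))

lemma smooth_continuous: "smooth f \<Longrightarrow> continuous_on S f"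
  unfolding smooth_def by (meson Ck.simps(1) continuous_on_subset subset_UNIV)

lemma smooth_borel_measurable: "smooth f \<Longrightarrow> f \<in> borel_measurable borel"
  by (simp add: borel_measurable_continuous_onI smooth_continuous)

lemma test_fun_iff_smooth: "test_fun \<phi> \<longleftrightarrow> smooth \<phi> \<and> compact (closure {x. \<phi> x \<noteq> 0})"
  by (simp add: test_fun_def smooth_def)

section \<open>Flat functions and smooth bumps that approximate boxes\<close>

text \<open>The polynomial is a parameter because differentiating exp (- 1 / t) produces polynomials
  in 1 / t; with it the family is closed under differentiation. The classical flat function is
  \<open>flat_exp 1\<close>.\<close>

definition flat_exp :: "real poly \<Rightarrow> real \<Rightarrow> real" where
  "flat_exp p t = (if t > 0 then poly p (1 / t) * exp (- (1 / t)) else 0)"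

lemma poly_times_exp_minus_at_top:
  "((\<lambda>x. poly p x * exp (- x)) \<longlongrightarrow> 0) (at_top :: real filter)"
proof -
  have "((\<lambda>x. \<Sum>i\<le>degree p. coeff p i * (x ^ i / exp x)) \<longlongrightarrow> 0) (at_top :: real filter)"
    by (intro tendsto_null_sum tendsto_mult_right_zero tendsto_power_div_exp_0)
  then show ?thesis
    by (simp add: poly_altdef exp_minus divide_inverse sum_distrib_right mult.assoc)
qed

text \<open>For t > 0 the derivative of p(1/t) exp (- 1/t) is (1/t^2) (p - p')(1/t) exp (- 1/t), and
  the two \<open>pCons 0\<close> are the factor 1/t^2. Only t = 0 needs a limit, from the
  right.\<close>

lemma flat_exp_has_derivative:
  "(flat_exp p has_real_derivative flat_exp (pCons 0 (pCons 0 (p - pderiv p))) t) (at t)"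
proof -
  consider "t > 0" | "t < 0" | "t = 0" by linarith
  then show ?thesis
  proof cases
    case 1
    have "((\<lambda>t. poly p (1 / t) * exp (- (1 / t))) has_real_derivative
        flat_exp (pCons 0 (pCons 0 (p - pderiv p))) t) (at t)"
    proof -
      have "((\<lambda>t. poly p (1 / t) * exp (- (1 / t))) has_real_derivative
          poly (pderiv p) (1 / t) * (- (1 / t^2)) * exp (- (1 / t))
            + poly p (1 / t) * (exp (- (1 / t)) * (1 / t^2))) (at t)" using 1
        apply (auto intro!: derivative_eq_intros DERIV_chain2[OF poly_DERIV]  simp: power2_eq_square)
        done
      then show ?thesis using 1 by (simp add: flat_exp_def power2_eq_square algebra_simps)
    qed
    moreover have "eventually (\<lambda>s. s > 0) (nhds t)"
      using 1 by (rule eventually_nhds_in_open[OF open_greaterThan, of t 0, simplified])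
    then have "eventually (\<lambda>s. poly p (1 / s) * exp (- (1 / s)) = flat_exp p s) (nhds t)"
      by eventually_elim (simp add: flat_exp_def)
    ultimately show ?thesis by (rule DERIV_cong_ev[OF refl _ refl, THEN iffD1, rotated])
  next
    case 2
    have "((\<lambda>t. 0) has_real_derivative flat_exp (pCons 0 (pCons 0 (p - pderiv p))) t) (at t)"
      using 2 by (simp add: flat_exp_def)
    moreover have "eventually (\<lambda>s. s < 0) (nhds t)"
      using 2 by (rule eventually_nhds_in_open[OF open_lessThan, of t 0, simplified])
    then have "eventually (\<lambda>s. 0 = flat_exp p s) (nhds t)"
      by eventually_elim (simp add: flat_exp_def)
    ultimately show ?thesis by (rule DERIV_cong_ev[OF refl _ refl, THEN iffD1, rotated])
  next
    case 3
    have R: "((\<lambda>h. flat_exp p h / h) \<longlongrightarrow> 0) (at_right 0)"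
    proof -
      \<comment> \<open>The extra \<open>pCons 0\<close> is the factor 1 / h of the difference
        quotient, so the quotient is again a polynomial times a decaying exponential in 1 /
        h.\<close>
      have "((\<lambda>h. poly (pCons 0 p) (inverse h) * exp (- inverse h)) \<longlongrightarrow> 0) (at_right 0)"
        using filterlim_compose[OF poly_times_exp_minus_at_top filterlim_inverse_at_top_right] .
      then show ?thesis by (rule Lim_transform_eventually)
           (auto intro!: always_eventually simp: eventually_at_filter flat_exp_def divide_inverse)
    qed
    have L: "((\<lambda>h. flat_exp p h / h) \<longlongrightarrow> 0) (at_left 0)"
      by (rule Lim_transform_eventually[OF tendsto_const])
         (auto simp: eventually_at_filter flat_exp_def)
    have "((\<lambda>h. flat_exp p h / h) \<longlongrightarrow> 0) (at 0)" using L R by (simp add: filterlim_at_split)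
    then show ?thesis using 3 by (simp add: DERIV_def flat_exp_def)
  qed
qed

lemma smooth_flat_exp: "smooth f \<Longrightarrow> smooth (\<lambda>x. flat_exp p (f x))" unfolding smooth_def
  using Ck_compose[of "range flat_exp" "flat_exp p"] flat_exp_has_derivative by blast

lemma flat_exp_1: "flat_exp 1 t = (if t > 0 then exp (- (1 / t)) else 0)"
  by (simp add: flat_exp_def)

text \<open>The factor \<open>Suc n\<close> sends the arguments to infinity inside the box, where
  the flat functions tend to 1. The indicator of an open box is thus a pointwise limit of test
  functions with values in [0, 1], with no mollifier involved.\<close>

definition box_bump :: "'a::euclidean_space \<Rightarrow> 'a \<Rightarrow> nat \<Rightarrow> 'a \<Rightarrow> real" where
  "box_bump a b n x =
     (\<Prod>i\<in>Basis. flat_exp 1 (real (Suc n) * (x \<bullet> i - a \<bullet> i)) * flat_exp 1 (real (Suc n) * (b \<bullet> i - x \<bullet> i)))"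

lemma box_bump_eq_0_iff: "box_bump a b n x = 0 \<longleftrightarrow> x \<notin> box a b"
  by (auto simp: box_bump_def flat_exp_1 box_def zero_less_mult_iff)

lemma box_bump_nonneg: "0 \<le> box_bump a b n x"
  unfolding box_bump_def by (intro prod_nonneg) (auto simp: flat_exp_1)

lemma box_bump_le_1: "box_bump a b n x \<le> 1" unfolding box_bump_def
  by (intro prod_le_1) (auto simp: flat_exp_1 intro!: mult_le_one)

lemma test_fun_box_bump: "test_fun (box_bump a b n)"
proof -
  have "smooth (box_bump a b n)" unfolding box_bump_def[abs_def]
    by (auto intro!: smooth_intros smooth_flat_exp)
  moreover have "compact (closure {x. box_bump a b n x \<noteq> 0})"
    using bounded_subset[OF bounded_box, of _ a b]
    by (auto simp: compact_closure box_bump_eq_0_iff)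
  ultimately show ?thesis by (simp add: test_fun_iff_smooth)
qed

lemma box_bump_tendsto: "(\<lambda>n. box_bump a b n x) \<longlonglongrightarrow> indicator (box a b) x"
proof (cases "x \<in> box a b")
  case True
  have e: "(\<lambda>n. flat_exp 1 (real (Suc n) * c)) \<longlonglongrightarrow> 1" if "c > 0" for c
  proof -
    have "(\<lambda>n. exp (- (inverse (real (Suc n)) * (1 / c)))) \<longlonglongrightarrow> exp (- (0 * (1 / c)))"
      by (intro tendsto_intros LIMSEQ_inverse_real_of_nat)
    then show ?thesis
      using that by (simp add: flat_exp_1 zero_less_mult_iff divide_inverse mult_ac)
  qed
  have "(\<lambda>n. box_bump a b n x) \<longlonglongrightarrow> (\<Prod>i\<in>(Basis::'a set). 1 * 1)" unfolding box_bump_def using True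
    by (intro tendsto_prod tendsto_mult e) (auto simp: box_def)
  then show ?thesis using True by simp
next
  case False
  then show ?thesis using box_bump_eq_0_iff[of a b _ x] by simp
qed

section \<open>Weak gradients\<close>

text \<open>Open boxes are stable under intersection and generate the Borel sets, so vanishing
  integrals spread from boxes to all Borel sets; the vanishing total integral handles complements.
  The sets where f is positive or negative then settle the claim.\<close>

lemma AE_zero_if_box_integrals_zero:
  fixes f :: "'a::euclidean_space \<Rightarrow> real"
  assumes f: "integrable lborel f"
    and total: "(LBINT x. f x) = 0"
    and box: "\<And>a b. (LBINT x. f x * indicator (box a b) x) = 0"
  shows "AE x in lborel. f x = 0"
proof -
  have [measurable]: "f \<in> borel_measurable borel" using borel_measurable_integrable[OF f] by simp
  have int: "integrable lborel (\<lambda>x. f x * indicator A x)" if "A \<in> sets borel" for A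
    using integrable_mult_indicator[OF _ f, of A] that by (simp add: mult.commute)
  have stable: "Int_stable (range (\<lambda>(a, b). box a b :: 'a set))"
    by (auto simp: Int_stable_def box_Int_box)
  have sets: "(LBINT x. f x * indicator A x) = 0" if "A \<in> sets borel" for A
  proof -
    have "A \<in> sigma_sets UNIV (range (\<lambda>(a, b). box a b))" using that unfolding borel_eq_box by simp
    with stable subset_UNIV[of "range (\<lambda>(a, b). box a b :: 'a set)", folded Pow_UNIV]
    show ?thesis
    proof (induction rule: sigma_sets_induct_disjoint)
      case (basic A)
      then show ?case using box by auto
    next
      case empty
      then show ?case by simp
    next
      case (compl A)
      then have A: "A \<in> sets borel" unfolding borel_eq_box by simp
      have "(LBINT x. f x * indicator (UNIV - A) x)
          = (LBINT x. f x - f x * indicator A x)" by (rule lint_cong) (auto simp: indicator_def)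
      then show ?case using compl total f int[OF A] by simp
    next
      case (union A)
      then have A: "A n \<in> sets borel" for n unfolding borel_eq_box by auto
      have "(\<lambda>n. \<integral>x. f x * indicator (\<Union>i<n. A i) x \<partial>lborel)
          \<longlonglongrightarrow> (LBINT x. f x * indicator (\<Union>i. A i) x)"
      proof (rule integral_dominated_convergence[where w="\<lambda>x. \<bar>f x\<bar>"])
        show "AE x in lborel. (\<lambda>n. f x * indicator (\<Union>i<n. A i) x)
            \<longlonglongrightarrow> f x * indicator (\<Union>i. A i) x" by (intro AE_I2 tendsto_mult_left LIMSEQ_indicator_UN)
      qed (use f A in \<open>auto simp: indicator_def\<close>)
      moreover have "(LBINT x. f x * indicator (\<Union>i<n. A i) x) = 0" for n
      proof -
        have "indicator (\<Union>i<n. A i) x = (\<Sum>i<n. indicator (A i) x :: real)" for x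
          using union.hyps by (intro indicator_UN_disjoint) (auto simp: disjoint_family_on_def)
        then have "(LBINT x. f x * indicator (\<Union>i<n. A i) x)
            = (LBINT x. (\<Sum>i<n. f x * indicator (A i) x))" by (simp only: sum_distrib_left)
        also have "\<dots> = (\<Sum>i<n. \<integral>x. f x * indicator (A i) x \<partial>lborel)"
          by (rule Bochner_Integration.integral_sum) (rule int[OF A])
        finally show ?thesis using union.IH by simp
      qed
      ultimately show ?case by (simp add: LIMSEQ_const_iff)
    qed
  qed
  have sgn: "AE x in lborel. c * f x \<le> 0" for c
  proof -
    define A where "A = {x. c * f x > 0}"
    have A: "A \<in> sets borel" unfolding A_def by measurable
    have "(LBINT x. c * (f x * indicator A x)) = 0" using sets[OF A] by simp
    then have "AE x in lborel. c * (f x * indicator A x) = 0"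
      by (subst (asm) integral_nonneg_eq_0_iff_AE)
         (use int[OF A] in \<open>auto simp: A_def indicator_def\<close>)
    then show ?thesis by eventually_elim (auto simp: A_def indicator_def not_less split: if_splits)
  qed
  show ?thesis using sgn[of 1] sgn[of "-1"] by eventually_elim simp
qed

lemma locally_integrable_mult_integrable:
  assumes f: "locally_integrable f" and h: "continuous_on UNIV h" and K: "compact (closure {x. h x \<noteq> (0::real)})"
  shows "integrable lebesgue (\<lambda>x. h x *\<^sub>R f x)"
proof -
  let ?K = "closure {x. h x \<noteq> 0}"
  have *: "integrable lebesgue (\<lambda>x. indicator ?K x *\<^sub>R f x)"
    using f K by (simp add: locally_integrable_def set_integrable_def)
  have "compact (h ` ?K)"
    using K h by (meson compact_continuous_image continuous_on_subset subset_UNIV)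
  then obtain M where M: "\<And>x. x \<in> ?K \<Longrightarrow> \<bar>h x\<bar> \<le> M"
    using compact_imp_bounded[of "h ` ?K"] by (auto simp: bounded_iff)
  have hm: "h \<in> borel_measurable lebesgue"
    using borel_measurable_continuous_onI[OF h] by (simp add: measurable_completion)
  have eq: "h x *\<^sub>R f x = h x *\<^sub>R (indicator ?K x *\<^sub>R f x)" for x
    using closure_subset[of "{x. h x \<noteq> 0}"] by (auto simp: indicator_def)
  have int: "integrable lebesgue (\<lambda>x. h x *\<^sub>R (indicator ?K x *\<^sub>R f x))"
  proof (rule lint_bound[OF integrable_scaleR_right[OF *, of M]])
    show "(\<lambda>x. h x *\<^sub>R indicat_real ?K x *\<^sub>R f x) \<in> borel_measurable lebesgue"
      using hm borel_measurable_integrable[OF *] by measurable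
    show "AE x in lebesgue. norm (h x *\<^sub>R indicat_real ?K x *\<^sub>R f x) \<le> norm (M *\<^sub>R indicat_real ?K x *\<^sub>R f x)"
      using M by (intro AE_I2) (fastforce simp: indicator_def intro!: mult_right_mono)
  qed
  show ?thesis by (rule Bochner_Integration.integrable_cong[OF refl eq, THEN iffD2, OF int])
qed

text \<open>Dominated convergence along \<open>box_bump\<close> turns test functions into indicators
  of boxes, which reduces the claim to the measure-theoretic one above.\<close>

lemma AE_zero_if_test_integrals_zero:
  fixes f :: "'a::euclidean_space \<Rightarrow> real"
  assumes f: "locally_integrable f"
    and test: "\<And>\<phi>. test_fun \<phi> \<Longrightarrow> (LINT x|lebesgue. f x * \<phi> x) = 0"
  shows "AE x in lebesgue. f x = 0"
proof -
  have box: "(LINT x|lebesgue. f x * indicator (box a b) x) = 0"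
    and box_int: "integrable lebesgue (\<lambda>x. f x * indicator (box a b) x)" for a b
  proof -
    have "integrable lebesgue (\<lambda>x. indicator (cbox a b) x *\<^sub>R f x)"
      using f by (simp add: locally_integrable_def set_integrable_def)
    then have c: "integrable lebesgue (\<lambda>x. \<bar>f x * indicator (cbox a b) x\<bar>)"
      by (simp add: mult.commute)
    have m: "(\<lambda>x. f x * box_bump a b n x) \<in> borel_measurable lebesgue" for n
      using locally_integrable_mult_integrable[OF f, of "box_bump a b n"] test_fun_box_bump[of a b n]
      by (auto simp: test_fun_iff_smooth smooth_continuous mult.commute)
    have t: "AE x in lebesgue. (\<lambda>n. f x * box_bump a b n x) \<longlonglongrightarrow> f x * indicator (box a b) x"
      by (intro AE_I2 tendsto_mult_left box_bump_tendsto)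
    have l: "(\<lambda>x. f x * indicator (box a b) x) \<in> borel_measurable lebesgue"
      by (rule borel_measurable_LIMSEQ_real[where u="\<lambda>n x. f x * box_bump a b n x", OF _ m])
         (intro tendsto_mult_left box_bump_tendsto)
    have d: "AE x in lebesgue. norm (f x * box_bump a b n x) \<le> \<bar>f x * indicator (cbox a b) x\<bar>" for n
    proof (intro AE_I2)
      fix x
      have "\<bar>box_bump a b n x\<bar> \<le> indicator (cbox a b) x"
        using box_bump_eq_0_iff[of a b n x] box_bump_nonneg[of a b n x] box_bump_le_1[of a b n x]
          box_subset_cbox[of a b] by (auto simp: indicator_def)
      then show "norm (f x * box_bump a b n x) \<le> \<bar>f x * indicator (cbox a b) x\<bar>"
        by (simp add: abs_mult mult_left_mono)
    qed
    have "integrable lebesgue (\<lambda>x. f x * indicator (box a b) x)"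
      by (rule integrable_dominated_convergence[OF l m c t d])
    moreover have "(\<lambda>n. \<integral>x. f x * box_bump a b n x \<partial>lebesgue) \<longlonglongrightarrow> (LINT x|lebesgue. f x * indicator (box a b) x)"
      by (rule integral_dominated_convergence[OF l m c t d])
    moreover have "(LINT x|lebesgue. f x * box_bump a b n x) = 0" for n
      by (rule test[OF test_fun_box_bump])
    ultimately show "(LINT x|lebesgue. f x * indicator (box a b) x) = 0"
      "integrable lebesgue (\<lambda>x. f x * indicator (box a b) x)" by (auto simp: LIMSEQ_const_iff)
  qed
  \<comment> \<open>\<open>f\<close> is only locally integrable, so it is cut to an exhausting
    sequence of boxes and replaced there by a Borel function. The box integrals of the truncation
    still vanish because two boxes meet in a box.\<close>
  have "AE x in lebesgue. f x * indicator (box (- real n *\<^sub>R One) (real n *\<^sub>R One)) x = 0" for n :: nat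
  proof -
    let ?B = "box (- real n *\<^sub>R One) (real n *\<^sub>R One) :: 'a set"
    let ?f = "\<lambda>x. f x * indicator ?B x"
    have "?f \<in> borel_measurable lebesgue" using box_int by blast
    then obtain h where [measurable]: "h \<in> borel_measurable lborel" and h: "AE x in lborel. ?f x = h x"
      using completion_ex_borel_measurable_real by blast
    have h': "AE x in lebesgue. ?f x = h x" using h by (rule AE_completion)
    have "integrable lebesgue h" using integrable_cong_AE[THEN iffD1, OF _ _ h' box_int]
      by (simp add: measurable_completion borel_measurable_integrable[OF box_int])
    then have hi: "integrable lborel h" by (simp add: integrable_completion)
    have "AE x in lborel. h x = 0"
    proof (rule AE_zero_if_box_integrals_zero[OF hi])
      have "(LBINT x. h x) = (LINT x|lebesgue. h x)" by (simp add: integral_completion)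
      also have "\<dots> = (LINT x|lebesgue. ?f x)" using h' by (intro integral_cong_AE)
          (auto simp: measurable_completion borel_measurable_integrable[OF box_int])
      finally show "(LBINT x. h x) = 0" using box by simp
      fix a b :: 'a
      have "(LBINT x. h x * indicator (box a b) x) = (LINT x|lebesgue. h x * indicator (box a b) x)"
        by (simp add: integral_completion)
      also have "\<dots> = (LINT x|lebesgue. ?f x * indicator (box a b) x)"
        using h' by (intro integral_cong_AE borel_measurable_times borel_measurable_integrable[OF box_int])
          (auto simp: measurable_completion)
      also have "\<dots> = 0"
        unfolding mult.assoc indicator_inter_arith[symmetric] box_Int_box by (rule box)
      finally show "(LBINT x. h x * indicator (box a b) x) = 0" .
    qed
    then have "AE x in lebesgue. h x = 0" by (rule AE_completion)
    with h' show ?thesis by eventually_elim simp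
  qed
  then have "AE x in lebesgue. \<forall>n::nat. f x * indicator (box (- real n *\<^sub>R One) (real n *\<^sub>R One)) x = 0"
    unfolding AE_all_countable by blast
  then show ?thesis
  proof eventually_elim
    case (elim x)
    have "x \<in> (\<Union>i::nat. box (- (real i *\<^sub>R One)) (real i *\<^sub>R One))"
      unfolding UN_box_eq_UNIV by simp
    then show ?case using elim by (auto simp: indicator_def split: if_splits)
  qed
qed

lemma weak_gradient_unique:
  assumes g: "is_weak_gradient u g" and h: "is_weak_gradient u h"
  shows "AE x in lebesgue. g x = h x"
proof -
  have "AE x in lebesgue. g x \<bullet> i - h x \<bullet> i = 0" if i: "i \<in> Basis" for i
  proof (rule AE_zero_if_test_integrals_zero)
    have *: "locally_integrable (\<lambda>x. f x \<bullet> i)" if "locally_integrable f" for f :: "'a \<Rightarrow> 'a"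
      unfolding locally_integrable_def
    proof (intro allI impI)
      fix K :: "'a set" assume "compact K"
      then have "integrable lebesgue (\<lambda>x. (indicator K x *\<^sub>R f x) \<bullet> i)"
        using that by (intro integrable_inner_left) (simp add: locally_integrable_def set_integrable_def)
      then show "(\<lambda>x. f x \<bullet> i) absolutely_integrable_on K" by (simp add: set_integrable_def)
    qed
    have gi: "locally_integrable (\<lambda>x. g x \<bullet> i)" and hi: "locally_integrable (\<lambda>x. h x \<bullet> i)"
      using g h * by (auto simp: is_weak_gradient_def)
    then show "locally_integrable (\<lambda>x. g x \<bullet> i - h x \<bullet> i)"
      by (auto simp: locally_integrable_def intro!: set_integral_diff)
    fix \<phi> :: "'a \<Rightarrow> real" assume \<phi>: "test_fun \<phi>"
    have "integrable lebesgue (\<lambda>x. (g x \<bullet> i) * \<phi> x)" "integrable lebesgue (\<lambda>x. (h x \<bullet> i) * \<phi> x)"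
      using locally_integrable_mult_integrable[OF gi, of \<phi>] locally_integrable_mult_integrable[OF hi, of \<phi>] \<phi>
      by (auto simp: test_fun_iff_smooth smooth_continuous mult.commute)
    then show "(LINT x|lebesgue. (g x \<bullet> i - h x \<bullet> i) * \<phi> x) = 0"
      using g h \<phi> i by (auto simp: is_weak_gradient_def left_diff_distrib)
  qed
  then have "AE x in lebesgue. \<forall>i\<in>Basis. g x \<bullet> i - h x \<bullet> i = 0"
    by (simp add: AE_ball_countable countable_finite)
  then show ?thesis by eventually_elim (auto intro: euclidean_eqI)
qed

section \<open>Test functions and classical integration by parts\<close>

lemma test_fun_bounded:
  assumes "test_fun f"
  obtains M where "0 < M" "\<And>x. \<bar>f x\<bar> \<le> M"
proof -
  have "compact (f ` closure {x. f x \<noteq> 0})"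
    using assms by (auto simp only: test_fun_iff_smooth smooth_continuous intro: compact_continuous_image)
  then obtain M where M: "0 < M" "\<And>x. x \<in> closure {x. f x \<noteq> 0} \<Longrightarrow> \<bar>f x\<bar> \<le> M"
    using compact_imp_bounded[of "f ` closure {x. f x \<noteq> 0}"] by (auto simp: bounded_pos)
  have "\<bar>f x\<bar> \<le> M" for x using M closure_subset[of "{x. f x \<noteq> 0}"] by (cases "f x = 0") auto
  with M that show ?thesis by blast
qed

lemma support_derivative_subset:
  assumes "smooth f"
  shows "closure {x. partial i f x \<noteq> 0} \<subseteq> closure {x. f x \<noteq> 0}"
proof (rule closure_minimal[OF _ closed_closure], safe)
  fix x assume x: "partial i f x \<noteq> 0"
  show "x \<in> closure {x. f x \<noteq> 0}"
  proof (rule ccontr)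
    assume "x \<notin> closure {x. f x \<noteq> 0}"
    then have "eventually (\<lambda>y. y \<in> - closure {x. f x \<noteq> 0}) (nhds x)"
      by (intro eventually_nhds_in_open) auto
    then have ev: "eventually (\<lambda>y. f y = 0) (nhds x)"
      by eventually_elim (use closure_subset[of "{x. f x \<noteq> 0}"] in auto)
    have "(f has_derivative (\<lambda>h. 0)) (at x)"
      by (rule has_derivative_transform_eventually[OF has_derivative_const[of 0]])
         (use eventually_nhds_x_imp_x[OF ev] eventually_mono[OF ev] in \<open>auto simp: eventually_at_filter\<close>)
    then have "frechet_derivative f (at x) = (\<lambda>h. 0)" using frechet_derivative_at by metis
    with x show False by simp
  qed
qed

lemma test_fun_derivative:
  assumes "test_fun f" "i \<in> Basis"
  shows "test_fun (\<lambda>x. partial i f x)"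
proof -
  have f: "smooth f" "compact (closure {x. f x \<noteq> 0})"
    using assms by (auto simp: test_fun_iff_smooth)
  have "bounded {x. partial i f x \<noteq> 0}"
  proof (rule bounded_subset)
    show "bounded (closure {x. f x \<noteq> 0})" using f(2) by (rule compact_imp_bounded)
    show "{x. partial i f x \<noteq> 0} \<subseteq> closure {x. f x \<noteq> 0}"
      using closure_subset support_derivative_subset[OF f(1)] by (rule order_trans)
  qed
  then show ?thesis using smooth_derivative[OF f(1) assms(2)] by (simp add: test_fun_iff_smooth)
qed

lemma test_fun_mult:
  assumes f: "test_fun f" and g: "smooth g"
  shows "test_fun (\<lambda>x. f x * g x)"
proof -
  have "bounded {x. f x * g x \<noteq> 0}"
    by (rule bounded_subset[of "{x. f x \<noteq> 0}"]) (use f in \<open>auto simp: test_fun_iff_smooth\<close>)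
  then show ?thesis using f g by (simp add: test_fun_iff_smooth smooth_mult)
qed

lemma smooth_frechet_derivative_mult:
  assumes "smooth f" "smooth g"
  shows "partial i (\<lambda>x. f x * g x) x
    = f x * partial i g x + partial i f x * g x"
  using frechet_derivative_at[OF has_derivative_mult[OF assms[THEN smooth_has_derivative]], of x]
  by metis

lemma locally_integrable_continuous:
  assumes "continuous_on UNIV f"
  shows "locally_integrable f" unfolding locally_integrable_def
proof (intro allI impI)
  fix K :: "'a set" assume K: "compact K"
  have [measurable]: "f \<in> borel_measurable borel" "K \<in> sets borel"
    using assms K by (auto intro: borel_measurable_continuous_onI borel_closed compact_imp_closed)
  have "integrable lborel (\<lambda>x. indicator K x *\<^sub>R f x)"
    using assms K by (intro borel_integrable_compact) (auto intro: continuous_on_subset)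
  then show "f absolutely_integrable_on K"
    unfolding set_integrable_def by (subst integrable_completion) auto
qed

lemma test_fun_integrable:
  assumes "test_fun f"
  shows "integrable lborel f"
proof -
  have "integrable lborel (\<lambda>x. indicator (closure {x. f x \<noteq> 0}) x *\<^sub>R f x)"
    using assms borel_integrable_compact[of "closure {x. f x \<noteq> 0}" f]
    by (auto simp: test_fun_iff_smooth smooth_continuous)
  moreover have "indicator (closure {x. f x \<noteq> 0}) x *\<^sub>R f x = f x" for x
    using closure_subset[of "{x. f x \<noteq> 0}"] by (auto simp: indicator_def)
  ultimately show ?thesis by (simp only:)
qed

text \<open>By translation invariance every difference quotient has integral 0, and the quotients
  converge dominatedly to the derivative. The mean value theorem bounds them by \<open>M\<close>,
  and steps of length at most 1 enlarge the support from radius R to at most R + 1.\<close>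

lemma integral_derivative_test_fun:
  fixes f :: "'a::euclidean_space \<Rightarrow> real"
  assumes f: "test_fun f" and i: "i \<in> Basis"
  shows "(LBINT x. partial i f x) = 0"
proof -
  let ?D = "\<lambda>x. partial i f x"
  have sf: "smooth f" "compact (closure {x. f x \<noteq> 0})" using f by (auto simp: test_fun_iff_smooth)
  have D: "test_fun ?D" by (rule test_fun_derivative[OF f i])
  obtain M where M: "0 < M" "\<And>x. \<bar>?D x\<bar> \<le> M" using test_fun_bounded[OF D] by blast
  obtain R where R: "\<And>x. f x \<noteq> 0 \<Longrightarrow> norm x \<le> R"
    using compact_imp_bounded[OF sf(2)] closure_subset[of "{x. f x \<noteq> 0}"]
    unfolding bounded_iff by blast
  define h where "h n = inverse (real (Suc n))" for n
  have h: "0 < h n" "h n \<le> 1" for n by (auto simp: h_def field_simps)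
  let ?q = "\<lambda>n x. (f (h n *\<^sub>R i + x) - f x) / h n"
  have fm: "f \<in> borel_measurable borel" using sf(1) by (rule smooth_borel_measurable)
  have shift: "(LBINT x. f (c + x)) = (LBINT x. f x)"
      "integrable lborel (\<lambda>x. f (c + x))" for c
  proof -
    have "(\<integral>x. f x \<partial>distr lborel borel ((+) c)) = (LBINT x. f (c + x))"
      using fm by (intro integral_distr) auto
    then show "(LBINT x. f (c + x)) = (LBINT x. f x)" by (simp add: lborel_distr_plus)
    show "integrable lborel (\<lambda>x. f (c + x))"
      using integrable_distr[of "(+) c" lborel borel f] test_fun_integrable[OF f]
      by (simp add: lborel_distr_plus)
  qed
  have q0: "(LBINT x. ?q n x) = 0" for n using shift test_fun_integrable[OF f] by simp
  have dir: "((\<lambda>t. f (x + t *\<^sub>R i)) has_real_derivative ?D (x + t *\<^sub>R i)) (at t)" for x t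
  proof -
    have "((\<lambda>t. f (x + t *\<^sub>R i)) has_derivative (\<lambda>s. frechet_derivative f (at (x + t *\<^sub>R i)) (s *\<^sub>R i))) (at t)"
      by (rule has_derivative_compose[of "\<lambda>t. x + t *\<^sub>R i" "\<lambda>t. t *\<^sub>R i" t UNIV f])
         (auto intro!: derivative_eq_intros smooth_has_derivative sf)
    moreover have "frechet_derivative f (at (x + t *\<^sub>R i)) (s *\<^sub>R i) = ?D (x + t *\<^sub>R i) * s" for s
      using has_derivative_linear[OF smooth_has_derivative[OF sf(1)]]
      by (simp add: linear_scale)
    ultimately show ?thesis by (simp add: has_field_derivative_def)
  qed
  have lim: "(\<lambda>n. ?q n x) \<longlonglongrightarrow> ?D x" for x
  proof -
    have "((\<lambda>t. (f (x + t *\<^sub>R i) - f x) / t) \<longlongrightarrow> ?D x) (at 0)"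
      using dir[of x 0] by (simp add: DERIV_def)
    moreover have "filterlim h (at 0) sequentially" using h LIMSEQ_inverse_real_of_nat
      by (auto simp: filterlim_at h_def[abs_def] intro!: always_eventually)
    ultimately have "((\<lambda>n. (f (x + h n *\<^sub>R i) - f x) / h n) \<longlongrightarrow> ?D x) sequentially"
      by (rule filterlim_compose)
    then show ?thesis by (simp add: add.commute)
  qed
  have bd: "\<bar>?q n x\<bar> \<le> M * indicator (cball 0 (R + 1)) x" for n x
  proof (cases "norm x \<le> R + 1")
    case True
    have "\<bar>f (x + h n *\<^sub>R i) - f x\<bar> \<le> M * h n"
    proof -
      obtain t where "f (x + h n *\<^sub>R i) - f (x + 0 *\<^sub>R i) = (h n - 0) * ?D (x + t *\<^sub>R i)"
        using MVT2[of 0 "h n" "\<lambda>t. f (x + t *\<^sub>R i)" "\<lambda>t. ?D (x + t *\<^sub>R i)"] dir h(1)[of n] by blast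
      then show ?thesis
        using M(2)[of "x + t *\<^sub>R i"] h(1)[of n] by (simp add: abs_mult mult.commute)
    qed
    then show ?thesis using True h(1)[of n] by (simp add: pos_divide_le_eq add.commute[of _ x])
  next
    case False
    have "norm x \<le> norm (h n *\<^sub>R i + x) + norm (h n *\<^sub>R i)"
      using norm_triangle_ineq4[of "h n *\<^sub>R i + x" "h n *\<^sub>R i"] by simp
    moreover have "norm (h n *\<^sub>R i) \<le> 1" using h[of n] i by simp
    ultimately have "f (h n *\<^sub>R i + x) = 0" "f x = 0"
      using False R[of x] R[of "h n *\<^sub>R i + x"] by force+
    then show ?thesis using M(1) by simp
  qed
  have "(\<lambda>n. \<integral>x. ?q n x \<partial>lborel) \<longlonglongrightarrow> (LBINT x. ?D x)"
  proof (rule integral_dominated_convergence[where w="\<lambda>x. M * indicator (cball 0 (R + 1)) x"])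
    show "?D \<in> borel_measurable lborel"
      using D by (simp add: test_fun_iff_smooth smooth_borel_measurable)
    show "?q n \<in> borel_measurable lborel" for n using fm by measurable
    show "integrable lborel (\<lambda>x::'a. M * indicator (cball 0 (R + 1)) x)"
      using emeasure_bounded_finite[OF bounded_cball, of "0::'a" "R + 1"]
      by (intro integrable_mult_right integrable_real_indicator) auto
  qed (use lim bd in auto)
  then show ?thesis unfolding q0 by (simp add: LIMSEQ_const_iff)
qed

definition grad :: "('a::euclidean_space \<Rightarrow> real) \<Rightarrow> 'a \<Rightarrow> 'a" where
  "grad u x = (\<Sum>i\<in>Basis. partial i u x *\<^sub>R i)"

lemma smooth_is_weak_gradient:
  assumes u: "smooth u"
  shows "is_weak_gradient u (grad u)"
proof -
  have c: "continuous_on UNIV (grad u)" unfolding grad_def[abs_def]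
    by (intro continuous_intros smooth_continuous smooth_derivative[OF u])
  have "(LINT x|lebesgue. u x * partial i \<phi> x) = - (LINT x|lebesgue. (grad u x \<bullet> i) * \<phi> x)"
    if \<phi>: "test_fun \<phi>" and i: "i \<in> Basis" for \<phi> i
  proof -
    have s: "smooth \<phi>" using \<phi> by (simp add: test_fun_iff_smooth)
    have g: "grad u x \<bullet> i = partial i u x" for x
      unfolding grad_def using i by (simp add: inner_sum_left_Basis)
    have t1: "test_fun (\<lambda>x. partial i \<phi> x * u x)"
      by (intro test_fun_mult test_fun_derivative \<phi> i u)
    have t2: "test_fun (\<lambda>x. \<phi> x * partial i u x)" by (intro test_fun_mult smooth_derivative \<phi> i u)
    have "0 = (LBINT x. partial i (\<lambda>x. \<phi> x * u x) x)"
      using integral_derivative_test_fun[OF test_fun_mult[OF \<phi> u] i] by simp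
    also have "\<dots> = (LBINT x. \<phi> x * partial i u x + partial i \<phi> x * u x)"
      by (simp add: smooth_frechet_derivative_mult[OF s u])
    also have "\<dots> = (LBINT x. \<phi> x * partial i u x) + (LBINT x. partial i \<phi> x * u x)"
      by (intro Bochner_Integration.integral_add test_fun_integrable t1 t2)
    also have "\<dots> = (LINT x|lebesgue. \<phi> x * partial i u x) + (LINT x|lebesgue. partial i \<phi> x * u x)"
      using t1 t2 by (simp add: integral_completion test_fun_iff_smooth smooth_borel_measurable)
    finally show ?thesis unfolding g by (simp add: mult.commute)
  qed
  then show ?thesis unfolding is_weak_gradient_def
    by (simp add: c smooth_continuous[OF u] locally_integrable_continuous)
qed

section \<open>Dilations, and test functions without compact support\<close>

lemma Ck_scaleR: "Ck k f \<Longrightarrow> Ck k (\<lambda>x. f (c *\<^sub>R x))"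
proof (induction k arbitrary: f)
  case 0
  then show ?case by (auto intro!: continuous_on_compose2[of UNIV f] continuous_intros)
next
  case (Suc k)
  have d: "((\<lambda>x. f (c *\<^sub>R x)) has_derivative (\<lambda>v. frechet_derivative f (at (c *\<^sub>R x)) (c *\<^sub>R v))) (at x)" for x
    by (rule has_derivative_compose[of "\<lambda>x. c *\<^sub>R x" "\<lambda>v. c *\<^sub>R v"])
       (auto intro!: derivative_eq_intros Ck_Suc_has_derivative[OF Suc.prems])
  have l: "frechet_derivative f (at x) (c *\<^sub>R v) = c * frechet_derivative f (at x) v" for x v
    using has_derivative_linear[OF Ck_Suc_has_derivative[OF Suc.prems]] by (simp add: linear_scale)
  show ?case by (rule Ck_SucI[OF d]) (use Suc in \<open>auto simp: l intro!: Ck_mult Ck_const\<close>)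
qed

lemma smooth_scaleR: "smooth f \<Longrightarrow> smooth (\<lambda>x. f (c *\<^sub>R x))" by (simp add: smooth_def Ck_scaleR)

lemma smooth_frechet_derivative_scaleR:
  assumes "smooth f"
  shows "frechet_derivative (\<lambda>x. f (c *\<^sub>R x)) (at x) i = c * partial i f (c *\<^sub>R x)"
proof -
  have "((\<lambda>x. f (c *\<^sub>R x)) has_derivative (\<lambda>v. frechet_derivative f (at (c *\<^sub>R x)) (c *\<^sub>R v))) (at x)"
    by (rule has_derivative_compose[of "\<lambda>x. c *\<^sub>R x" "\<lambda>v. c *\<^sub>R v"])
       (auto intro!: derivative_eq_intros smooth_has_derivative assms)
  then show ?thesis
    using has_derivative_linear[OF smooth_has_derivative[OF assms]] frechet_derivative_at linear_scale
    by (metis real_scaleR_def)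
qed

lemma test_fun_scaleR:
  assumes f: "test_fun f" and c: "c \<noteq> 0"
  shows "test_fun (\<lambda>x. f (c *\<^sub>R x))"
proof -
  have "{x. f (c *\<^sub>R x) \<noteq> 0} = (\<lambda>x. inverse c *\<^sub>R x) ` {x. f x \<noteq> 0}"
    using c by (auto simp: image_iff intro!: exI[of _ "c *\<^sub>R _"])
  then have "closure {x. f (c *\<^sub>R x) \<noteq> 0} = (\<lambda>x. inverse c *\<^sub>R x) ` closure {x. f x \<noteq> 0}"
    by (simp add: closure_scaleR)
  then show ?thesis
    using f smooth_scaleR[of f c] by (simp add: test_fun_iff_smooth compact_scaling)
qed

text \<open>The compact support of test functions is removed by the cutoffs \<open>\<psi> (x / n)\<close>.\<close>

lemma weak_gradient_smooth:
  fixes u :: "'a::euclidean_space \<Rightarrow> real"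
  assumes g: "is_weak_gradient u g" and F: "smooth F" and i: "i \<in> Basis"
    and int: "integrable lebesgue (\<lambda>x. u x * F x)"
      "integrable lebesgue (\<lambda>x. u x * partial i F x)"
      "integrable lebesgue (\<lambda>x. (g x \<bullet> i) * F x)"
  shows "(LINT x|lebesgue. u x * partial i F x) = - (LINT x|lebesgue. (g x \<bullet> i) * F x)"
proof -
  \<comment> \<open>It is enough that the cutoff does not vanish at 0: dilation makes it tend to the
    constant \<open>\<psi> 0\<close>, which is a common factor of both sides in the limit and is
    cancelled at the end.\<close>
  define \<psi> :: "'a \<Rightarrow> real" where "\<psi> = box_bump (- One) One 0"
  have \<psi>: "test_fun \<psi>" unfolding \<psi>_def by (rule test_fun_box_bump)
  then have s\<psi>: "smooth \<psi>" by (simp add: test_fun_iff_smooth)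
  have \<psi>1: "\<bar>\<psi> x\<bar> \<le> 1" for x
    using box_bump_nonneg[of "- One" One 0 x] box_bump_le_1[of "- One" One 0 x]
    unfolding \<psi>_def by simp
  have \<psi>0: "\<psi> 0 \<noteq> 0" unfolding \<psi>_def by (simp add: box_bump_eq_0_iff box_def)
  let ?D = "\<lambda>x. partial i \<psi> x"
  obtain M where M: "0 < M" "\<And>x. \<bar>?D x\<bar> \<le> M"
    using test_fun_bounded[OF test_fun_derivative[OF \<psi> i]] by blast
  define h where "h n = inverse (real (Suc n))" for n
  have h: "0 < h n" "h n \<le> 1" for n by (auto simp: h_def field_simps)
  have h0: "h \<longlonglongrightarrow> 0" unfolding h_def[abs_def] by (rule LIMSEQ_inverse_real_of_nat)
  have \<psi>lim: "(\<lambda>n. \<psi> (h n *\<^sub>R x)) \<longlonglongrightarrow> \<psi> 0" for x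
  proof -
    have "(\<lambda>n. h n *\<^sub>R x) \<longlonglongrightarrow> 0" using tendsto_scaleR[OF h0 tendsto_const[of x]] by simp
    moreover have "isCont \<psi> 0"
      using smooth_continuous[OF s\<psi>, of UNIV] by (simp add: continuous_on_eq_continuous_at)
    ultimately show ?thesis using isCont_tendsto_compose by blast
  qed
  have m[measurable]: "(\<lambda>x. \<psi> (h n *\<^sub>R x)) \<in> borel_measurable lebesgue"
      "(\<lambda>x. ?D (h n *\<^sub>R x)) \<in> borel_measurable lebesgue" for n
    using smooth_borel_measurable[OF smooth_scaleR[OF s\<psi>]]
      smooth_borel_measurable[OF smooth_scaleR[OF smooth_derivative[OF s\<psi> i]]]
    by (auto simp: measurable_completion)
  note [measurable] = int[THEN borel_measurable_integrable]
  have i2: "integrable lebesgue (\<lambda>x. ?D (h n *\<^sub>R x) * (u x * F x))" for n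
    by (rule lint_bound[OF integrable_mult_right[OF int(1), of M]])
       (use M in \<open>auto simp: abs_mult intro!: mult_right_mono\<close>)
  have dF: "(LINT x|lebesgue. \<psi> (h n *\<^sub>R x) * (u x * partial i F x))
      + h n * (LINT x|lebesgue. ?D (h n *\<^sub>R x) * (u x * F x))
    = - (LINT x|lebesgue. \<psi> (h n *\<^sub>R x) * ((g x \<bullet> i) * F x))" for n
  proof -
    let ?\<phi> = "\<lambda>x. \<psi> (h n *\<^sub>R x)"
    have s: "smooth ?\<phi>" and t: "test_fun ?\<phi>"
      using smooth_scaleR[OF s\<psi>] test_fun_scaleR[OF \<psi>] h(1)[of n] by auto
    have i1: "integrable lebesgue (\<lambda>x. \<psi> (h n *\<^sub>R x) * (u x * partial i F x))"
      by (rule lint_bound[OF int(2)])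
         (use \<psi>1 in \<open>auto simp: abs_mult mult_left_le_one_le\<close>)
    have e: "u x * partial i (\<lambda>x. ?\<phi> x * F x) x
        = ?\<phi> x * (u x * partial i F x) + h n * (?D (h n *\<^sub>R x) * (u x * F x))" for x
      unfolding smooth_frechet_derivative_mult[OF s F] smooth_frechet_derivative_scaleR[OF s\<psi>]
      by (simp add: algebra_simps)
    have "(LINT x|lebesgue. u x * partial i (\<lambda>x. ?\<phi> x * F x) x)
        = - (LINT x|lebesgue. (g x \<bullet> i) * (?\<phi> x * F x))"
      using g i test_fun_mult[OF t F] unfolding is_weak_gradient_def by blast
    then show ?thesis using i1 i2[of n] unfolding e by (simp add: mult.left_commute)
  qed
  have l1: "(\<lambda>n. \<integral>x. \<psi> (h n *\<^sub>R x) * f x \<partial>lebesgue) \<longlonglongrightarrow> (LINT x|lebesgue. \<psi> 0 * f x)"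
    if f: "integrable lebesgue f" for f
  proof (rule integral_dominated_convergence[where w="\<lambda>x. \<bar>f x\<bar>"])
    note [measurable] = borel_measurable_integrable[OF f]
    show "(\<lambda>x. \<psi> (h n *\<^sub>R x) * f x) \<in> borel_measurable lebesgue" for n by measurable
    show "AE x in lebesgue. (\<lambda>n. \<psi> (h n *\<^sub>R x) * f x) \<longlonglongrightarrow> \<psi> 0 * f x"
      by (intro AE_I2 tendsto_mult_right \<psi>lim)
    show "AE x in lebesgue. norm (\<psi> (h n *\<^sub>R x) * f x) \<le> \<bar>f x\<bar>" for n
      using \<psi>1 by (auto simp: abs_mult mult_left_le_one_le)
  qed (use f in auto)
  \<comment> \<open>The error term, where the derivative falls on the cutoff, carries the dilation
    factor \<open>h n\<close> and a bounded integral.\<close>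
  have l2: "(\<lambda>n. h n * (LINT x|lebesgue. ?D (h n *\<^sub>R x) * (u x * F x))) \<longlonglongrightarrow> 0"
  proof (rule Lim_null_comparison)
    have "norm (LINT x|lebesgue. ?D (h n *\<^sub>R x) * (u x * F x)) \<le> (LINT x|lebesgue. M * \<bar>u x * F x\<bar>)" for n
    proof (rule Bochner_Integration.integral_norm_bound_integral[OF i2])
      show "integrable lebesgue (\<lambda>x. M * \<bar>u x * F x\<bar>)" using int(1) by simp
      show "norm (?D (h n *\<^sub>R x) * (u x * F x)) \<le> M * \<bar>u x * F x\<bar>" for x
        using M by (simp add: abs_mult mult_right_mono)
    qed
    then show "\<forall>\<^sub>F n in sequentially. norm (h n * (LINT x|lebesgue. ?D (h n *\<^sub>R x) * (u x * F x)))
        \<le> h n * (LINT x|lebesgue. M * \<bar>u x * F x\<bar>)"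
      using h(1) by (intro always_eventually allI) (simp add: abs_mult mult_left_mono less_imp_le)
    show "(\<lambda>n. h n * (LINT x|lebesgue. M * \<bar>u x * F x\<bar>)) \<longlonglongrightarrow> 0"
      using tendsto_mult_right[OF h0] by simp
  qed
  have "(LINT x|lebesgue. \<psi> 0 * (u x * partial i F x)) + 0
      = - (LINT x|lebesgue. \<psi> 0 * ((g x \<bullet> i) * F x))"
    using tendsto_add[OF l1[OF int(2)] l2] tendsto_minus[OF l1[OF int(3)]] LIMSEQ_unique
    unfolding dF by blast
  then have "\<psi> 0 * (LINT x|lebesgue. u x * partial i F x)
      = \<psi> 0 * (- (LINT x|lebesgue. (g x \<bullet> i) * F x))" by simp
  with \<psi>0 show ?thesis using mult_left_cancel by blast
qed

section \<open>Functions of Gaussian decay\<close>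

abbreviation "square_int f \<equiv> integrable lborel (\<lambda>x. (f x :: real)^2)"
abbreviation "L2 f \<equiv> integrable lborel (\<lambda>x. (norm (f x))^2)"
abbreviation "L2_sq f \<equiv> LBINT x. (norm (f x))^2"

lemma integrable_exp_minus_norm_sq:
  assumes s: "s > 0"
  shows "integrable lborel (\<lambda>x::'a::euclidean_space. exp (- s * (norm x)^2))"
proof (rule integrableI_bounded)
  have half: "(\<integral>\<^sup>+x. ennreal (exp (- x)) * indicator {0..} x \<partial>lborel) = ennreal 1"
  proof -
    have "((\<lambda>x::real. - exp (- x)) \<longlongrightarrow> - 0) at_top"
      by (intro tendsto_minus filterlim_compose[OF exp_at_bot] filterlim_uminus_at_bot_at_top)
    moreover have "((\<lambda>x. - exp (- x)) has_real_derivative exp (- x)) (at x)" for x :: real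
      by (auto intro!: derivative_eq_intros)
    ultimately show ?thesis
      using nn_integral_FTC_atLeast[of "\<lambda>x. exp (- x)" 0 "\<lambda>x. - exp (- x)" 0] by simp
  qed
  have one: "(\<integral>\<^sup>+x. ennreal (exp (- s * (x::real)^2)) \<partial>lborel) < \<infinity>"
  proof -
    \<comment> \<open>Completing the square at |x| = 1 / (2 s) trades the Gaussian for exp (- |x|),
      whose integral is elementary.\<close>
    have bd: "exp (- s * x^2) \<le> exp (1 / (4 * s)) * exp (- \<bar>x\<bar>)" for x :: real
    proof -
      have "0 \<le> s * (\<bar>x\<bar> - 1 / (2 * s))^2" using s by simp
      also have "\<dots> = s * x^2 - \<bar>x\<bar> + 1 / (4 * s)"
        using s by (simp add: power2_eq_square field_simps flip: abs_mult)
      finally show ?thesis by (simp flip: exp_add)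
    qed
    \<comment> \<open>The negative half line is written with the argument
      \<open>0 + (- 1) * x\<close> so that the affine substitution rule reduces it to
      \<open>half\<close>.\<close>
    have "ennreal (exp (- s * x^2)) \<le> ennreal (exp (1 / (4 * s))) *
        (ennreal (exp (- x)) * indicator {0..} x
          + ennreal (exp (- (0 + (- 1) * x))) * indicator {0..} (0 + (- 1) * x))" for x :: real
    proof -
      have "ennreal (exp (- s * x^2)) \<le> ennreal (exp (1 / (4 * s))) * ennreal (exp (- \<bar>x\<bar>))"
        using bd[of x] by (simp flip: ennreal_mult)
      also have "\<dots> \<le> ennreal (exp (1 / (4 * s))) *
        (ennreal (exp (- x)) * indicator {0..} x
          + ennreal (exp (- (0 + (- 1) * x))) * indicator {0..} (0 + (- 1) * x))"
        by (intro mult_left_mono) (auto simp: indicator_def)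
      finally show ?thesis .
    qed
    then have "(\<integral>\<^sup>+x. ennreal (exp (- s * (x::real)^2)) \<partial>lborel) \<le> (\<integral>\<^sup>+x. ennreal (exp (1 / (4 * s))) *
        (ennreal (exp (- x)) * indicator {0..} x
          + ennreal (exp (- (0 + (- 1) * x))) * indicator {0..} (0 + (- 1) * x)) \<partial>lborel)"
      by (intro nn_integral_mono) auto
    also have "\<dots> = ennreal (exp (1 / (4 * s))) * (ennreal 1 + ennreal 1)"
      using nn_integral_real_affine[of "\<lambda>x. ennreal (exp (- x)) * indicator {0..} x" "-1" 0] half
      by (simp add: nn_integral_cmult nn_integral_add)
    also have "\<dots> < \<infinity>" by (simp add: ennreal_mult_less_top)
    finally show ?thesis .
  qed
  have "exp (- s * (norm x)^2) = (\<Prod>b\<in>Basis. exp (- s * (x \<bullet> b)^2))" for x :: 'a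
  proof -
    have "(norm x)^2 = (\<Sum>b\<in>Basis. (x \<bullet> b)^2)"
      unfolding power2_norm_eq_inner by (subst euclidean_inner) (simp add: power2_eq_square)
    then show ?thesis by (simp only: sum_distrib_left exp_sum[OF finite_Basis])
  qed
  then have "(\<integral>\<^sup>+x. ennreal (norm (exp (- s * (norm (x::'a))^2))) \<partial>lborel)
      = (\<integral>\<^sup>+x. (\<Prod>b\<in>(Basis::'a set). ennreal (exp (- s * (x \<bullet> b)^2))) \<partial>lborel)"
    by (simp add: prod_ennreal prod_nonneg)
  also have "\<dots> = (\<Prod>b\<in>(Basis::'a set). \<integral>\<^sup>+x. ennreal (exp (- s * x^2)) \<partial>lborel)"
    by (rule nn_integral_lborel_prod) auto
  also have "\<dots> < \<infinity>" using one by (simp add: power_less_top_ennreal)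
  finally show "(\<integral>\<^sup>+x. ennreal (norm (exp (- s * (norm (x::'a))^2))) \<partial>lborel) < \<infinity>" .
qed simp

text \<open>Rate and constant are existential so that the class absorbs polynomial factors at the
  price of a smaller rate. Together with smoothness it describes the functions against which weak
  gradients are tested, on the space itself and for kernels on its square.\<close>

definition gaussian_decay :: "('a::euclidean_space \<Rightarrow> real) \<Rightarrow> bool" where
  "gaussian_decay f \<longleftrightarrow> (\<exists>C s. 0 < s \<and> (\<forall>x. \<bar>f x\<bar> \<le> C * exp (- s * (norm x)^2)))"

lemma gaussian_decayI:
  "0 < s \<Longrightarrow> (\<And>x. \<bar>f x\<bar> \<le> C * exp (- s * (norm x)^2)) \<Longrightarrow> gaussian_decay f"
  by (auto simp: gaussian_decay_def)

lemma gaussian_decay_mult_quadratic: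
  assumes f: "gaussian_decay f" and h: "\<And>x. \<bar>h x\<bar> \<le> M * (1 + (norm x)^2)"
  shows "gaussian_decay (\<lambda>x. h x * f x)"
proof -
  obtain C s where s: "0 < s" and f: "\<And>x. \<bar>f x\<bar> \<le> C * exp (- s * (norm x)^2)"
    using assms(1) by (auto simp: gaussian_decay_def)
  have M: "0 \<le> M" using order_trans[OF abs_ge_zero h[of 0]] by simp
  show ?thesis
  proof (rule gaussian_decayI[of "s / 2"])
    fix x :: 'a
    let ?t = "(norm x)^2"
    \<comment> \<open>Half of the rate pays for the quadratic factor, through 1 + y \<le> exp y with
      y = s t / 2.\<close>
    have "1 + ?t \<le> (1 + 2 / s) * (1 + s / 2 * ?t)" using s by (simp add: field_simps)
    also have "\<dots> \<le> (1 + 2 / s) * exp (s / 2 * ?t)"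
      using s by (intro mult_left_mono exp_ge_add_one_self) auto
    finally have e: "1 + ?t \<le> (1 + 2 / s) * exp (s / 2 * ?t)" .
    have "\<bar>h x * f x\<bar> \<le> (M * (1 + ?t)) * (C * exp (- s * ?t))"
      unfolding abs_mult using h f M by (intro mult_mono) auto
    also have "\<dots> \<le> (M * ((1 + 2 / s) * exp (s / 2 * ?t))) * (C * exp (- s * ?t))"
      using e M order_trans[OF abs_ge_zero f[of x]] by (intro mult_right_mono mult_left_mono) auto
    also have "\<dots> = (M * (1 + 2 / s) * C) * (exp (s / 2 * ?t) * exp (- s * ?t))" by simp
    also have "exp (s / 2 * ?t) * exp (- s * ?t) = exp (- (s / 2) * ?t)"
      by (simp flip: exp_add add: field_simps)
    finally show "\<bar>h x * f x\<bar> \<le> (M * (1 + 2 / s) * C) * exp (- (s / 2) * ?t)" .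
  qed (use s in simp)
qed

lemma gaussian_decay_mult_bounded:
  assumes "gaussian_decay f" and h: "\<And>x. \<bar>h x\<bar> \<le> M"
  shows "gaussian_decay (\<lambda>x. h x * f x)"
proof (rule gaussian_decay_mult_quadratic[OF assms(1), where M=M])
  fix x :: 'a
  have "0 \<le> M" using order_trans[OF abs_ge_zero h] by blast
  then show "\<bar>h x\<bar> \<le> M * (1 + (norm x)^2)" by (intro order_trans[OF h]) (simp add: algebra_simps)
qed

lemma gaussian_decay_cmult: "gaussian_decay f \<Longrightarrow> gaussian_decay (\<lambda>x. c * f x)"
  by (rule gaussian_decay_mult_bounded[OF _ order_refl])

lemma gaussian_decay_mult_inner:
  assumes "gaussian_decay f"
  shows "gaussian_decay (\<lambda>x. (x \<bullet> v) * f x)"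
proof (rule gaussian_decay_mult_quadratic[OF assms, where M="norm v"])
  fix x :: 'a
  have "norm x \<le> 1 + (norm x)^2"
    using zero_le_power2[of "norm x - 1/2"] by (simp add: power2_eq_square algebra_simps)
  then have "norm v * norm x \<le> norm v * (1 + (norm x)^2)" by (rule mult_left_mono) simp
  then show "\<bar>x \<bullet> v\<bar> \<le> norm v * (1 + (norm x)^2)"
    using Cauchy_Schwarz_ineq2[of x v] by (simp add: mult.commute)
qed

lemma gaussian_decay_mult_norm_sq: "gaussian_decay f \<Longrightarrow> gaussian_decay (\<lambda>x. (norm x)^2 * f x)"
  by (rule gaussian_decay_mult_quadratic[where M=1]) auto

lemma gaussian_decay_add:
  assumes "gaussian_decay f" "gaussian_decay g"
  shows "gaussian_decay (\<lambda>x. f x + g x)"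
proof -
  obtain C s where s: "0 < s" and f: "\<And>x. \<bar>f x\<bar> \<le> C * exp (- s * (norm x)^2)"
    using assms(1) by (auto simp: gaussian_decay_def)
  obtain D t where t: "0 < t" and g: "\<And>x. \<bar>g x\<bar> \<le> D * exp (- t * (norm x)^2)"
    using assms(2) by (auto simp: gaussian_decay_def)
  have C: "0 \<le> C" "0 \<le> D"
    using order_trans[OF abs_ge_zero f[of 0]] order_trans[OF abs_ge_zero g[of 0]] by auto
  show ?thesis
  proof (rule gaussian_decayI[of "min s t"])
    fix x
    have "\<bar>f x + g x\<bar> \<le> C * exp (- s * (norm x)^2) + D * exp (- t * (norm x)^2)"
      using f[of x] g[of x] by linarith
    also have "\<dots> \<le> C * exp (- min s t * (norm x)^2) + D * exp (- min s t * (norm x)^2)"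
      using C by (intro add_mono mult_left_mono) (auto intro!: mult_right_mono)
    finally show "\<bar>f x + g x\<bar> \<le> (C + D) * exp (- min s t * (norm x)^2)"
      by (simp add: algebra_simps)
  qed (use s t in simp)
qed

lemma gaussian_decay_minus: "gaussian_decay f \<Longrightarrow> gaussian_decay (\<lambda>x. - f x)"
  using gaussian_decay_cmult[of f "-1"] by simp

lemma gaussian_decay_diff:
  "gaussian_decay f \<Longrightarrow> gaussian_decay g \<Longrightarrow> gaussian_decay (\<lambda>x. f x - g x)"
  using gaussian_decay_add[OF _ gaussian_decay_minus] by simp

lemma gaussian_decay_exp: "s > 0 \<Longrightarrow> gaussian_decay (\<lambda>x. exp (- s * (norm x)^2))"
  by (rule gaussian_decayI[of s _ 1]) auto

lemma gaussian_decay_bounded: "gaussian_decay f \<Longrightarrow> \<exists>M\<ge>0. \<forall>x. \<bar>f x\<bar> \<le> M"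
proof -
  assume "gaussian_decay f"
  then obtain C s where s: "0 < s" and f: "\<And>x. \<bar>f x\<bar> \<le> C * exp (- s * (norm x)^2)"
    by (auto simp: gaussian_decay_def)
  have C: "0 \<le> C" using order_trans[OF abs_ge_zero f[of 0]] by auto
  have "\<bar>f x\<bar> \<le> C" for x
    using f[of x] C s by (rule_tac order_trans[OF f]) (auto intro: mult_left_le)
  then show ?thesis using C by blast
qed

lemma gaussian_decay_mult:
  assumes "gaussian_decay f" "gaussian_decay g"
  shows "gaussian_decay (\<lambda>x. f x * g x)"
  using gaussian_decay_bounded[OF assms(1)] gaussian_decay_mult_bounded[OF assms(2)] by blast

lemma gaussian_decay_integrable:
  assumes f: "gaussian_decay f" and [measurable]: "f \<in> borel_measurable borel"
  shows "integrable lborel f"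
proof -
  obtain C s where s: "0 < s" and f: "\<And>x. \<bar>f x\<bar> \<le> C * exp (- s * (norm x)^2)"
    using assms(1) by (auto simp: gaussian_decay_def)
  show ?thesis by (rule lint_bound[OF
          integrable_mult_right[OF integrable_exp_minus_norm_sq[OF s], of C]])
       (use order_trans[OF f abs_ge_self] in auto)
qed

lemma integrable_mult_L2:
  fixes f g :: "'a \<Rightarrow> real"
  assumes [measurable]: "f \<in> borel_measurable M" "g \<in> borel_measurable M"
    and "integrable M (\<lambda>x. (f x)^2)" "integrable M (\<lambda>x. (g x)^2)"
  shows "integrable M (\<lambda>x. f x * g x)"
proof (rule lint_bound)
  show "integrable M (\<lambda>x. (f x)^2 + (g x)^2)" using assms by simp
  have "\<bar>f x * g x\<bar> \<le> (f x)^2 + (g x)^2" for x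
    using sum_squares_bound[of "\<bar>f x\<bar>" "\<bar>g x\<bar>"] mult_nonneg_nonneg[of "\<bar>f x\<bar>" "\<bar>g x\<bar>"]
    unfolding abs_mult power2_abs by linarith
  then show "AE x in M. norm (f x * g x) \<le> norm ((f x)^2 + (g x)^2)" by simp
qed simp

lemma gaussian_decay_L2:
  assumes "gaussian_decay f" "f \<in> borel_measurable borel"
  shows "square_int f"
  using gaussian_decay_integrable[OF gaussian_decay_mult[OF assms(1,1)]] assms(2)
  by (simp add: power2_eq_square)

lemma gaussian_decay_mult_L2_integrable:
  assumes "gaussian_decay F" "F \<in> borel_measurable borel"
    and "f \<in> borel_measurable borel" "integrable lborel (\<lambda>x. (f x :: real)^2)"
  shows "integrable lborel (\<lambda>x. f x * F x)"
  using assms gaussian_decay_L2[OF assms(1,2)] by (intro integrable_mult_L2) auto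

lemma gaussian_decay_section:
  assumes "gaussian_decay (\<lambda>z. H (fst z) (snd z))"
  shows "gaussian_decay (\<lambda>x. H x y)" "gaussian_decay (H x)"
proof -
  obtain C s where s: "0 < s" and H: "\<And>z. \<bar>H (fst z) (snd z)\<bar> \<le> C * exp (- s * (norm z)^2)"
    using assms unfolding gaussian_decay_def by blast
  have C: "0 \<le> C" using order_trans[OF abs_ge_zero H[of 0]] by auto
  have *: "\<bar>H x y\<bar> \<le> C * exp (- s * ((norm x)^2 + (norm y)^2))" for x y
    using H[of "(x, y)"] by (simp add: norm_prod_def)
  show "gaussian_decay (\<lambda>x. H x y)"
    by (rule gaussian_decayI[OF s, where C=C], rule order_trans[OF *])
       (use C s in \<open>auto intro!: mult_left_mono\<close>)
  show "gaussian_decay (H x)" by (rule gaussian_decayI[OF s, where C=C], rule order_trans[OF *])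
       (use C s in \<open>auto intro!: mult_left_mono\<close>)
qed

lemma borel_measurable_fst_snd [measurable]:
  "fst \<in> borel_measurable (borel :: ('a::euclidean_space \<times> 'a) measure)"
  "snd \<in> borel_measurable (borel :: ('a::euclidean_space \<times> 'a) measure)"
  by (auto intro!: borel_measurable_continuous_onI continuous_intros)

text \<open>The norm on the product satisfies |z|^2 = |x|^2 + |y|^2, so a Gaussian bound in z is a
  product of Gaussians in x and y, and each of them pairs with a square integrable function.\<close>

lemma gaussian_decay_pair_integrable:
  fixes f h :: "'a::euclidean_space \<Rightarrow> real"
  assumes H: "gaussian_decay H" and [measurable]: "H \<in> borel_measurable borel"
    and f[measurable]: "f \<in> borel_measurable borel" "square_int f"
    and h[measurable]: "h \<in> borel_measurable borel" "square_int h"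
  shows "integrable lborel (\<lambda>z. H z * (f (fst z) * h (snd z)))"
proof -
  obtain C s where s: "0 < s" and H: "\<And>z. \<bar>H z\<bar> \<le> C * exp (- s * (norm z)^2)"
    using assms(1) by (auto simp: gaussian_decay_def)
  let ?G = "\<lambda>x::'a. exp (- s * (norm x)^2)"
  have 1: "integrable lborel (\<lambda>x. f x * ?G x)" "integrable lborel (\<lambda>x. h x * ?G x)"
    using f h by (intro gaussian_decay_mult_L2_integrable gaussian_decay_exp[OF s]; simp)+
  have "integrable (lborel \<Otimes>\<^sub>M lborel) (\<lambda>(x, y). (f x * ?G x) * (h y * ?G y))"
    by (rule lborel_pair.Fubini_integrable) (use 1 1[THEN integrable_abs] in \<open>auto simp: abs_mult\<close>)
  then have "integrable lborel (\<lambda>z. C * (case z of (x, y) \<Rightarrow> (f x * ?G x) * (h y * ?G y)))"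
    unfolding lborel_prod by (rule integrable_mult_right)
  then show ?thesis
  proof (rule lint_bound)
    show "AE z in lborel. norm (H z * (f (fst z) * h (snd z))) \<le> norm (C * (case z of (x, y) \<Rightarrow> (f x * ?G x) * (h y * ?G y)))"
    proof (intro AE_I2)
      fix z :: "'a \<times> 'a"
      have "\<bar>H z\<bar> \<le> C * (?G (fst z) * ?G (snd z))"
        using H[of z] by (simp add: norm_prod_def algebra_simps flip: exp_add split: prod.splits)
      then have "\<bar>H z\<bar> \<le> \<bar>C * (?G (fst z) * ?G (snd z))\<bar>" by linarith
      from mult_right_mono[OF this, of "\<bar>f (fst z) * h (snd z)\<bar>"]
      show "norm (H z * (f (fst z) * h (snd z))) \<le> norm (C * (case z of (x, y) \<Rightarrow> (f x * ?G x) * (h y * ?G y)))"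
        by (simp add: abs_mult case_prod_beta mult_ac)
    qed
  qed simp
qed

section \<open>Integration by parts against the Mehler kernel\<close>

lemma lborel_integral_swap:
  fixes f :: "'a::euclidean_space \<times> 'a \<Rightarrow> real"
  assumes [measurable]: "f \<in> borel_measurable borel"
  shows "(LBINT z. f (snd z, fst z)) = (LBINT z. f z)"
proof -
  have "f \<in> borel_measurable (lborel \<Otimes>\<^sub>M lborel)" by (simp add: lborel_prod)
  from lborel_pair.integral_product_swap[OF this] show ?thesis
    by (simp add: lborel_prod case_prod_beta')
qed

text \<open>This is the kernel of the harmonic oscillator semigroup up to normalization,
  diagonalized in x + y and x - y. The semigroup corresponds to a = l t and b = l / t; free a and b
  keep t out of the integrations by parts.\<close>

definition mehler :: "real \<Rightarrow> real \<Rightarrow> 'a::euclidean_space \<Rightarrow> 'a \<Rightarrow> real" where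
  "mehler a b x y = exp (- (a * (norm (x + y))^2 + b * (norm (x - y))^2) / 4)"

abbreviation "sum_sq z \<equiv> (norm (fst z + snd z))^2"
abbreviation "diff_sq z \<equiv> (norm (fst z - snd z))^2"
abbreviation "mehler2 a b z \<equiv> mehler a b (fst z) (snd z)"

lemma mehler_commute: "mehler a b x y = mehler a b y x"
  by (simp add: mehler_def add.commute norm_minus_commute)

lemma mehler_pos: "0 < mehler a b x y" by (simp add: mehler_def)

lemma norm_sum_diff_sq: "(norm (x + y))^2 + (norm (x - y))^2 = 2 * ((norm x)^2 + (norm (y::'a::real_inner))^2)"
  by (simp add: power2_norm_eq_inner algebra_simps inner_commute)

lemma mehler_eq:
  "mehler a b x y = exp (- ((a + b) * ((norm x)^2 + (norm y)^2) + 2 * (a - b) * (x \<bullet> y)) / 4)"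
  unfolding mehler_def by (simp add: power2_norm_eq_inner algebra_simps inner_commute)

lemma mehler_le:
  assumes "m \<le> a" "m \<le> b"
  shows "mehler a b x y \<le> exp (- (m / 2) * ((norm x)^2 + (norm y)^2))"
proof -
  have "m * (norm (x + y))^2 + m * (norm (x - y))^2 \<le> a * (norm (x + y))^2 + b * (norm (x - y))^2"
    using assms by (intro add_mono mult_right_mono) auto
  then have "m * ((norm (x + y))^2 + (norm (x - y))^2) \<le> a * (norm (x + y))^2 + b * (norm (x - y))^2"
    by (simp add: distrib_left)
  then have "- (a * (norm (x + y))^2 + b * (norm (x - y))^2) / 4 \<le> - (m / 2) * ((norm x)^2 + (norm y)^2)"
    unfolding norm_sum_diff_sq by (simp add: field_simps)
  then show ?thesis by (simp only: mehler_def exp_le_cancel_iff)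
qed

lemma mehler_has_derivative:
  "((\<lambda>x. mehler a b x y) has_derivative
      (\<lambda>v. - (a * ((x + y) \<bullet> v) + b * ((x - y) \<bullet> v)) / 2 * mehler a b x y)) (at x)"
proof -
  have "((\<lambda>x. - ((a + b) * (x \<bullet> x + y \<bullet> y) + 2 * (a - b) * (x \<bullet> y)) / 4) has_derivative
      (\<lambda>v. - (a * ((x + y) \<bullet> v) + b * ((x - y) \<bullet> v)) / 2)) (at x)"
    by (auto intro!: derivative_eq_intros simp: inner_commute inner_add_right inner_diff_right field_simps)
  from has_derivative_exp[OF this] show ?thesis unfolding mehler_eq power2_norm_eq_inner .
qed

lemma smooth_mehler [smooth_intros]: "smooth (\<lambda>x. mehler a b x y)"
  unfolding mehler_eq divide_inverse by (intro smooth_intros)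

lemma mehler_measurable [measurable]: "(\<lambda>z. mehler2 a b z) \<in> borel_measurable borel"
  unfolding mehler_def by measurable

lemma gaussian_decay_mehler:
  assumes "0 < a" "0 < b"
  shows "gaussian_decay (\<lambda>z. mehler2 a b z)"
proof (rule gaussian_decayI[of "min a b / 2" _ 1])
  fix z :: "'a \<times> 'a"
  show "\<bar>mehler2 a b z\<bar> \<le> 1 * exp (- (min a b / 2) * (norm z)^2)"
    using mehler_le[of "min a b" a b "fst z" "snd z"] mehler_pos[of a b "fst z" "snd z"]
    by (simp add: norm_prod_def)
qed (use assms in simp)

lemma gaussian_decay_mult_sum_inner:
  "gaussian_decay H \<Longrightarrow> gaussian_decay (\<lambda>z. ((fst z + snd z) \<bullet> v) * H z)"
  "gaussian_decay H \<Longrightarrow> gaussian_decay (\<lambda>z. ((fst z - snd z) \<bullet> v) * H z)"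
  for H :: "'a::euclidean_space \<times> 'a \<Rightarrow> real"
  using gaussian_decay_mult_inner[of H "(v, v)"] gaussian_decay_mult_inner[of H "(v, - v)"]
  by (simp_all add: inner_prod_def inner_add_left inner_diff_left)

definition mehler_deriv :: "real \<Rightarrow> real \<Rightarrow> 'a::euclidean_space \<Rightarrow> 'a \<Rightarrow> 'a \<Rightarrow> real" where
  "mehler_deriv a b i x y = - (a * ((x + y) \<bullet> i) + b * ((x - y) \<bullet> i)) / 2 * mehler a b x y"

lemma partial_mehler:
  "partial i (\<lambda>x. mehler a b x y) x = mehler_deriv a b i x y"
  "partial i (\<lambda>y. mehler a b x y) y = mehler_deriv a b i y x"
proof -
  show *: "partial i (\<lambda>x. mehler a b x y) x = mehler_deriv a b i x y" for x y
    using frechet_derivative_at[OF mehler_has_derivative[of a b y x], symmetric]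
    by (simp add: mehler_deriv_def)
  show "partial i (\<lambda>y. mehler a b x y) y = mehler_deriv a b i y x"
    unfolding mehler_commute[of a b x] by (rule *)
qed

lemma mehler_deriv_measurable [measurable]:
  "(\<lambda>z. mehler_deriv a b i (fst z) (snd z)) \<in> borel_measurable borel"
  "(\<lambda>z. mehler_deriv a b i (snd z) (fst z)) \<in> borel_measurable borel"
  unfolding mehler_deriv_def mehler_def by measurable

lemma gaussian_decay_mehler_deriv:
  assumes "0 < a" "0 < b"
  shows "gaussian_decay (\<lambda>z. mehler_deriv a b i (fst z) (snd z))"
    "gaussian_decay (\<lambda>z. mehler_deriv a b i (snd z) (fst z))"
proof -
  have e: "mehler_deriv a b i (fst z) (snd z) = (- a / 2) * (((fst z + snd z) \<bullet> i) * mehler2 a b z)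
      + (- b / 2) * (((fst z - snd z) \<bullet> i) * mehler2 a b z)"
    "mehler_deriv a b i (snd z) (fst z) = (- a / 2) * (((fst z + snd z) \<bullet> i) * mehler2 a b z)
      + (b / 2) * (((fst z - snd z) \<bullet> i) * mehler2 a b z)" for z
    by (simp_all add: mehler_deriv_def mehler_commute[of a b "snd z"] inner_add_left inner_diff_left field_simps)
  show "gaussian_decay (\<lambda>z. mehler_deriv a b i (fst z) (snd z))"
    "gaussian_decay (\<lambda>z. mehler_deriv a b i (snd z) (fst z))"
    unfolding e
    by (intro gaussian_decay_add gaussian_decay_cmult gaussian_decay_mult_sum_inner
        gaussian_decay_mehler[OF assms])+
qed

lemma gaussian_decay_mult_sum_norm:
  assumes "gaussian_decay H"
  shows "gaussian_decay (\<lambda>z. sum_sq z * H z)"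
    "gaussian_decay (\<lambda>z. diff_sq z * H z)"
proof -
  have "\<bar>sum_sq z\<bar> \<le> 2 * (1 + (norm z)^2)" "\<bar>diff_sq z\<bar> \<le> 2 * (1 + (norm z)^2)" for z :: "'a \<times> 'a"
  proof -
    have n: "(norm z)^2 = (norm (fst z))^2 + (norm (snd z))^2" by (simp add: norm_prod_def)
    note * = norm_sum_diff_sq[of "fst z" "snd z"] zero_le_power2[of "norm (fst z + snd z)"]
      zero_le_power2[of "norm (fst z - snd z)"]
    show "\<bar>sum_sq z\<bar> \<le> 2 * (1 + (norm z)^2)" unfolding n abs_power2 by (smt (verit) *)
    show "\<bar>diff_sq z\<bar> \<le> 2 * (1 + (norm z)^2)" unfolding n abs_power2 by (smt (verit) *)
  qed
  from this[THEN gaussian_decay_mult_quadratic[OF assms]]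
  show "gaussian_decay (\<lambda>z. sum_sq z * H z)"
    "gaussian_decay (\<lambda>z. diff_sq z * H z)" by auto
qed

lemma sum_inner_Basis_sq: "(\<Sum>i\<in>Basis. (v \<bullet> i)^2) = (norm (v :: 'a::euclidean_space))^2"
  unfolding power2_norm_eq_inner by (subst (2) euclidean_inner) (simp add: power2_eq_square)

lemma component_L2:
  fixes f :: "'a::euclidean_space \<Rightarrow> 'a"
  assumes [measurable]: "f \<in> borel_measurable borel" and f: "L2 f"
    and i: "i \<in> Basis"
  shows "square_int (\<lambda>x. f x \<bullet> i)"
proof (rule lint_bound[OF f])
  have "\<bar>f x \<bullet> i\<bar>^2 \<le> (norm (f x))^2" for x using Basis_le_norm[OF i] by (intro power_mono) auto
  then show "AE x in lborel. norm ((f x \<bullet> i)^2) \<le> norm ((norm (f x))^2)" by simp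
qed simp

text \<open>Borel representatives are required because double integrals are iterated over
  \<open>lborel\<close>; each member of \<open>W12_weighted\<close> is later replaced by such a
  pair. \<open>by_parts\<close> admits functions of Gaussian decay since the kernel has no compact
  support.\<close>

locale weighted_sobolev =
  fixes u :: "'a::euclidean_space \<Rightarrow> real" and g :: "'a \<Rightarrow> 'a"
  assumes u_measurable [measurable]: "u \<in> borel_measurable borel"
    and g_measurable [measurable]: "g \<in> borel_measurable borel"
    and u_L2: "square_int u"
    and g_L2: "L2 g"
    and xu_L2: "L2 (\<lambda>x. u x *\<^sub>R x)"
    and by_parts: "\<And>F i. i \<in> Basis \<Longrightarrow> smooth F \<Longrightarrow> gaussian_decay F \<Longrightarrow>
      gaussian_decay (\<lambda>x. partial i F x) \<Longrightarrow>
      (LBINT x. u x * partial i F x) = - (LBINT x. (g x \<bullet> i) * F x)"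
begin

text \<open>Fubini with x as the inner variable: for fixed y the kernel is an admissible function of
  x, and \<open>h y\<close> is a constant factor.\<close>

lemma by_parts_fst:
  fixes h :: "'a \<Rightarrow> real" and H H' :: "'a \<Rightarrow> 'a \<Rightarrow> real"
  assumes i: "i \<in> Basis" and [measurable]: "h \<in> borel_measurable borel"
    and h: "square_int h"
    and H: "\<And>y. smooth (\<lambda>x. H x y)" and H': "\<And>x y. partial i (\<lambda>x. H x y) x = H' x y"
    and dec: "gaussian_decay (\<lambda>z. H (fst z) (snd z))" "gaussian_decay (\<lambda>z. H' (fst z) (snd z))"
    and [measurable]: "(\<lambda>z. H (fst z) (snd z)) \<in> borel_measurable borel"
      "(\<lambda>z. H' (fst z) (snd z)) \<in> borel_measurable borel"
  shows "(LBINT z. H' (fst z) (snd z) * (u (fst z) * h (snd z)))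
    = - (LBINT z. H (fst z) (snd z) * ((g (fst z) \<bullet> i) * h (snd z)))"
proof -
  have gi: "square_int (\<lambda>x. g x \<bullet> i)" using component_L2[OF g_measurable g_L2 i] .
  have 1: "integrable (lborel \<Otimes>\<^sub>M lborel) (\<lambda>(x, y). H' x y * (u x * h y))"
    using gaussian_decay_pair_integrable[OF dec(2) _ u_measurable u_L2 _ h]
    by (simp add: lborel_prod case_prod_beta')
  have 2: "integrable (lborel \<Otimes>\<^sub>M lborel) (\<lambda>(x, y). H x y * ((g x \<bullet> i) * h y))"
    using gaussian_decay_pair_integrable[OF dec(1) _ _ gi _ h]
    by (simp add: lborel_prod case_prod_beta')
  have "(LBINT z. H' (fst z) (snd z) * (u (fst z) * h (snd z))) = (LBINT y. (LBINT x. H' x y * (u x * h y)))"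
    using lborel_pair.integral_snd[OF 1] by (simp add: lborel_prod case_prod_beta')
  also have "\<dots> = (LBINT y. - (LBINT x. H x y * ((g x \<bullet> i) * h y)))"
  proof (rule lint_cong[OF refl])
    fix y
    have "(LBINT x. H' x y * (u x * h y)) = h y * (LBINT x. u x * H' x y)"
      by (simp add: mult_ac flip: integral_mult_right_zero)
    also have "(LBINT x. u x * H' x y) = - (LBINT x. (g x \<bullet> i) * H x y)"
      using by_parts[OF i H gaussian_decay_section(1)[OF dec(1)], of y] gaussian_decay_section(1)[OF dec(2)]
      unfolding H' by blast
    also have "h y * (- (LBINT x. (g x \<bullet> i) * H x y)) = - (LBINT x. H x y * ((g x \<bullet> i) * h y))"
      by (simp add: mult_ac flip: integral_mult_right_zero)
    finally show "(LBINT x. H' x y * (u x * h y)) = - (LBINT x. H x y * ((g x \<bullet> i) * h y))" .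
  qed
  also have "\<dots> = - (LBINT z. H (fst z) (snd z) * ((g (fst z) \<bullet> i) * h (snd z)))"
    using lborel_pair.integral_snd[OF 2] by (simp add: lborel_prod case_prod_beta')
  finally show ?thesis .
qed

lemma by_parts_snd:
  fixes h :: "'a \<Rightarrow> real" and H H' :: "'a \<Rightarrow> 'a \<Rightarrow> real"
  assumes i: "i \<in> Basis" and [measurable]: "h \<in> borel_measurable borel"
    and h: "square_int h"
    and H: "\<And>x. smooth (\<lambda>y. H x y)" and H': "\<And>x y. partial i (\<lambda>y. H x y) y = H' x y"
    and dec: "gaussian_decay (\<lambda>z. H (snd z) (fst z))" "gaussian_decay (\<lambda>z. H' (snd z) (fst z))"
    and [measurable]: "(\<lambda>z. H (fst z) (snd z)) \<in> borel_measurable borel"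
      "(\<lambda>z. H' (fst z) (snd z)) \<in> borel_measurable borel"
      "(\<lambda>z. H (snd z) (fst z)) \<in> borel_measurable borel"
      "(\<lambda>z. H' (snd z) (fst z)) \<in> borel_measurable borel"
  shows "(LBINT z. H' (fst z) (snd z) * (h (fst z) * u (snd z)))
    = - (LBINT z. H (fst z) (snd z) * (h (fst z) * (g (snd z) \<bullet> i)))"
  using by_parts_fst[of i h "\<lambda>x y. H y x" "\<lambda>x y. H' y x"] assms
    lborel_integral_swap[of "\<lambda>z. H' (fst z) (snd z) * (h (fst z) * u (snd z))"]
    lborel_integral_swap[of "\<lambda>z. H (fst z) (snd z) * (h (fst z) * (g (snd z) \<bullet> i))"]
  by (simp add: mult_ac)

abbreviation "u2 z \<equiv> u (fst z) * u (snd z)"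

text \<open>One integration by parts in x and one in y remove both gradients; the two signs cancel,
  and the kernel is replaced by the sum over i of its mixed derivatives in x_i and y_i.\<close>

lemma mehler_gradient_form:
  assumes ab: "0 < a" "0 < b"
  shows "(LBINT z. mehler2 a b z * (g (fst z) \<bullet> g (snd z)))
    = (LBINT z. (- (real DIM('a) / 2) * (a - b)
         + (a^2 * sum_sq z - b^2 * diff_sq z) / 4)
        * mehler2 a b z * u2 z)"
proof -
  let ?E = "\<lambda>z::'a \<times> 'a. mehler2 a b z"
  note dE = gaussian_decay_mehler[OF ab, where 'a='a]
  \<comment> \<open>The mixed derivative in x_i and y_i: - (a - b) / 2 comes from the exponent, and
    the product of the two first derivatives is a difference of squares. Summing the first part over
    the basis gives the dimension.\<close>
  define H3 where "H3 i x y = (- (a - b) / 2 + (a^2 * ((x + y) \<bullet> i)^2 - b^2 * ((x - y) \<bullet> i)^2) / 4) * mehler a b x y" for i x y :: 'a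
  have e2: "mehler_deriv a b i y x = - (a * ((x + y) \<bullet> i) - b * ((x - y) \<bullet> i)) / 2 * mehler a b x y" for i x y
    by (simp add: mehler_deriv_def mehler_commute[of a b y] inner_diff_left add.commute algebra_simps)
  have d2: "partial i (\<lambda>x. mehler_deriv a b i y x) x = H3 i x y" if i: "i \<in> Basis" for x y i
  proof -
    have "((\<lambda>x. mehler_deriv a b i y x) has_derivative
      (\<lambda>v. (- (a * ((x + y) \<bullet> i) - b * ((x - y) \<bullet> i)) / 2) *
             (- (a * ((x + y) \<bullet> v) + b * ((x - y) \<bullet> v)) / 2 * mehler a b x y)
           + - (a * (v \<bullet> i) - b * (v \<bullet> i)) / 2 * mehler a b x y)) (at x)" unfolding e2
      by (rule has_derivative_mult[OF _ mehler_has_derivative])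
         (auto intro!: derivative_eq_intros simp: inner_add_left inner_diff_left)
    from frechet_derivative_at[OF this, symmetric] show ?thesis
      using i by (simp add: H3_def power2_eq_square inner_commute algebra_simps add_divide_distrib diff_divide_distrib)
  qed
  have s2: "smooth (\<lambda>x. mehler_deriv a b i y x)" for i y
    unfolding e2 divide_inverse inner_add_left inner_diff_left by (intro smooth_intros)
  have [measurable]: "(\<lambda>z. H3 i (fst z) (snd z)) \<in> borel_measurable borel"
    "(\<lambda>z. mehler a b (snd z) (fst z)) \<in> borel_measurable borel" for i :: 'a
    unfolding H3_def mehler_def by measurable
  note dec2 = gaussian_decay_mehler_deriv[OF ab]
  have dec3: "gaussian_decay (\<lambda>z. H3 i (fst z) (snd z))" for i
  proof -
    have "gaussian_decay (\<lambda>z. (- (a - b) / 2) * ?E z +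
        ((a^2 / 4) * (((fst z + snd z) \<bullet> i) * (((fst z + snd z) \<bullet> i) * ?E z))
          - (b^2 / 4) * (((fst z - snd z) \<bullet> i) * (((fst z - snd z) \<bullet> i) * ?E z))))"
      by (intro gaussian_decay_add gaussian_decay_diff gaussian_decay_cmult gaussian_decay_mult_sum_inner dE)
    then show ?thesis
      by (simp add: H3_def power2_eq_square algebra_simps add_divide_distrib diff_divide_distrib)
  qed
  have comp: "(LBINT z. ?E z * ((g (fst z) \<bullet> i) * (g (snd z) \<bullet> i)))
      = (LBINT z. H3 i (fst z) (snd z) * u2 z)" if i: "i \<in> Basis" for i
  proof -
    have gi: "square_int (\<lambda>x. g x \<bullet> i)" using component_L2[OF g_measurable g_L2 i] .
    \<comment> \<open>Read backwards: the derivative in x is taken off first, with \<open>u\<close>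
      as the other factor, then the one in y, where the other factor is already the component of
      \<open>g\<close>.\<close>
    have "(LBINT z. H3 i (fst z) (snd z) * u2 z)
        = - (LBINT z. mehler_deriv a b i (snd z) (fst z) * ((g (fst z) \<bullet> i) * u (snd z)))"
      by (rule by_parts_fst[OF i u_measurable u_L2 s2 d2[OF i] dec2(2) dec3]) measurable
    also have "(LBINT z. mehler_deriv a b i (snd z) (fst z) * ((g (fst z) \<bullet> i) * u (snd z)))
        = - (LBINT z. ?E z * ((g (fst z) \<bullet> i) * (g (snd z) \<bullet> i)))"
    proof (rule by_parts_snd[OF i _ gi _ partial_mehler(2)])
      show "smooth (\<lambda>y. mehler a b x y)" for x
        unfolding mehler_commute[of a b x] by (rule smooth_mehler)
      show "gaussian_decay (\<lambda>z::'a \<times> 'a. mehler a b (snd z) (fst z))"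
        using dE by (simp add: mehler_commute[of a b "snd _"])
    qed (simp_all add: dec2(1))
    finally show ?thesis by simp
  qed
  have int1: "integrable lborel (\<lambda>z. ?E z * ((g (fst z) \<bullet> i) * (g (snd z) \<bullet> i)))" if i: "i \<in> Basis" for i
    using component_L2[OF g_measurable g_L2 i] by (intro gaussian_decay_pair_integrable dE) auto
  have int3: "integrable lborel (\<lambda>z. H3 i (fst z) (snd z) * u2 z)" for i
    by (intro gaussian_decay_pair_integrable dec3 u_L2) auto
  have eq: "(\<Sum>i\<in>Basis. H3 i x y * (u x * u y)) = (- (real DIM('a) / 2) * (a - b)
         + (a^2 * (norm (x + y))^2 - b^2 * (norm (x - y))^2) / 4) * mehler a b x y * (u x * u y)" for x y
  proof -
    note sum_inner_Basis_sq[of "_ :: 'a"]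
    then have "(\<Sum>i\<in>(Basis::'a set). - (a - b) / 2 + (a^2 * ((x + y) \<bullet> i)^2 - b^2 * ((x - y) \<bullet> i)^2) / 4)
        = - (real DIM('a) / 2) * (a - b) + (a^2 * (norm (x + y))^2 - b^2 * (norm (x - y))^2) / 4"
      by (simp add: sum.distrib sum_subtractf right_diff_distrib flip: sum_divide_distrib sum_distrib_left)
    then show ?thesis unfolding H3_def by (simp flip: sum_distrib_right)
  qed
  have "(LBINT z. ?E z * (g (fst z) \<bullet> g (snd z)))
      = (LBINT z. (\<Sum>i\<in>Basis. ?E z * ((g (fst z) \<bullet> i) * (g (snd z) \<bullet> i))))"
    by (subst euclidean_inner) (simp add: sum_distrib_left)
  also have "\<dots> = (\<Sum>i\<in>Basis. \<integral>z. H3 i (fst z) (snd z) * u2 z \<partial>lborel)"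
    using int1 by (simp add: comp)
  also have "\<dots> = (LBINT z. (\<Sum>i\<in>Basis. H3 i (fst z) (snd z) * u2 z))" using int3 by simp
  finally show ?thesis unfolding eq .
qed

text \<open>Only one derivative can be moved, which leaves the asymmetric weight y_i times the
  derivative in x_i. Averaging with the form obtained by exchanging x and y restores
  symmetry.\<close>

lemma mehler_mixed_form:
  assumes ab: "0 < a" "0 < b"
  shows "(LBINT z. mehler2 a b z * (g (fst z) \<bullet> (u (snd z) *\<^sub>R snd z)))
    = (LBINT z. (a * sum_sq z - b * diff_sq z) / 4
        * mehler2 a b z * u2 z)"
proof -
  let ?E = "\<lambda>z::'a \<times> 'a. mehler2 a b z"
  note dE = gaussian_decay_mehler[OF ab, where 'a='a]
  let ?H = "mehler_deriv a b"
  note dec = gaussian_decay_mehler_deriv[OF ab]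
  have hi: "integrable lborel (\<lambda>x. (u x * (x \<bullet> i))^2)" if "i \<in> Basis" for i
    using component_L2[OF _ xu_L2 that] by simp
  have comp: "(LBINT z. ?E z * ((g (fst z) \<bullet> i) * (u (snd z) * (snd z \<bullet> i))))
      = (LBINT z. (a * ((fst z + snd z) \<bullet> i)^2 - b * ((fst z - snd z) \<bullet> i)^2) / 4 * ?E z * u2 z)"
    if i: "i \<in> Basis" for i
  proof -
    let ?A = "\<integral>z. ?E z * ((g (fst z) \<bullet> i) * (u (snd z) * (snd z \<bullet> i))) \<partial>lborel"
    let ?h = "\<lambda>y. u y * (y \<bullet> i)"
    have int: "integrable lborel (\<lambda>z. ?H i (fst z) (snd z) * (u (fst z) * ?h (snd z)))"
      "integrable lborel (\<lambda>z. ?H i (snd z) (fst z) * (?h (fst z) * u (snd z)))"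
      by (intro gaussian_decay_pair_integrable dec u_L2 hi i; simp)+
    have 1: "(LBINT z. ?H i (fst z) (snd z) * (u (fst z) * ?h (snd z))) = - ?A"
      by (intro by_parts_fst[OF i] hi[OF i] smooth_mehler partial_mehler dE dec) auto
    have 2: "(LBINT z. ?H i (snd z) (fst z) * (?h (fst z) * u (snd z))) = - ?A"
      using lborel_integral_swap[of "\<lambda>z. ?H i (fst z) (snd z) * (u (fst z) * ?h (snd z))"] 1
      by (simp add: mult_ac)
    \<comment> \<open>In y_i (a s + b d) + x_i (a s - b d), with s and d the i-th components of x +
      y and x - y, the coefficients combine to a s^2 - b d^2.\<close>
    have eq: "(- 1 / 2) * (?H i x y * (u x * ?h y) + ?H i y x * (?h x * u y))
        = (a * ((x + y) \<bullet> i)^2 - b * ((x - y) \<bullet> i)^2) / 4 * mehler a b x y * (u x * u y)" for x y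
      by (simp add: mehler_deriv_def mehler_commute[of a b y x] inner_add_left inner_diff_left power2_eq_square field_simps)
    have "?A = (LBINT z. (- 1 / 2) * (?H i (fst z) (snd z) * (u (fst z) * ?h (snd z)) + ?H i (snd z) (fst z) * (?h (fst z) * u (snd z))))"
      unfolding integral_mult_right_zero Bochner_Integration.integral_add[OF int] 1 2 by simp
    then show ?thesis unfolding eq .
  qed
  have int1: "integrable lborel (\<lambda>z. ?E z * ((g (fst z) \<bullet> i) * (u (snd z) * (snd z \<bullet> i))))" if i: "i \<in> Basis" for i
    using component_L2[OF g_measurable g_L2 i] hi[OF i]
    by (intro gaussian_decay_pair_integrable dE) auto
  have int3: "integrable lborel (\<lambda>z. (a * ((fst z + snd z) \<bullet> i)^2 - b * ((fst z - snd z) \<bullet> i)^2) / 4 * ?E z * u2 z)" for i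
  proof (intro gaussian_decay_pair_integrable u_L2)
    have "gaussian_decay (\<lambda>z. (a / 4) * (((fst z + snd z) \<bullet> i) * (((fst z + snd z) \<bullet> i) * ?E z))
          - (b / 4) * (((fst z - snd z) \<bullet> i) * (((fst z - snd z) \<bullet> i) * ?E z)))"
      by (intro gaussian_decay_diff gaussian_decay_cmult gaussian_decay_mult_sum_inner dE)
    then show "gaussian_decay (\<lambda>z. (a * ((fst z + snd z) \<bullet> i)^2 - b * ((fst z - snd z) \<bullet> i)^2) / 4 * ?E z)"
      by (simp add: power2_eq_square left_diff_distrib diff_divide_distrib mult.assoc)
  qed auto
  have eq: "(\<Sum>i\<in>Basis. (a * ((x + y) \<bullet> i)^2 - b * ((x - y) \<bullet> i)^2) / 4 * mehler a b x y * (u x * u y))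
      = (a * (norm (x + y))^2 - b * (norm (x - y))^2) / 4 * mehler a b x y * (u x * u y)" for x y
  proof -
    note sum_inner_Basis_sq[of "_ :: 'a"]
    then have "(\<Sum>i\<in>(Basis::'a set). (a * ((x + y) \<bullet> i)^2 - b * ((x - y) \<bullet> i)^2) / 4)
        = (a * (norm (x + y))^2 - b * (norm (x - y))^2) / 4"
      by (simp add: sum_subtractf flip: sum_divide_distrib sum_distrib_left)
    then show ?thesis by (simp only: flip: sum_distrib_right)
  qed
  have "(LBINT z. ?E z * (g (fst z) \<bullet> (u (snd z) *\<^sub>R snd z)))
      = (LBINT z. (\<Sum>i\<in>Basis. ?E z * ((g (fst z) \<bullet> i) * (u (snd z) * (snd z \<bullet> i)))))"
    by (subst euclidean_inner) (simp add: sum_distrib_left)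
  also have "\<dots> = (\<Sum>i\<in>Basis. \<integral>z. (a * ((fst z + snd z) \<bullet> i)^2 - b * ((fst z - snd z) \<bullet> i)^2) / 4 * ?E z * u2 z \<partial>lborel)"
    using int1 by (simp add: comp)
  also have "\<dots> = (LBINT z. (\<Sum>i\<in>Basis. (a * ((fst z + snd z) \<bullet> i)^2 - b * ((fst z - snd z) \<bullet> i)^2) / 4 * ?E z * u2 z))"
    using int3 by simp
  finally show ?thesis unfolding eq .
qed

end

section \<open>The Mehler kernel as an approximate identity\<close>

lemma lborel_integral_affine:
  fixes f :: "'a::euclidean_space \<Rightarrow> real"
  assumes c: "c \<noteq> 0" and [measurable]: "f \<in> borel_measurable borel"
  shows "(LBINT x. f x) = \<bar>c\<bar> ^ DIM('a) * (LBINT x. f (t + c *\<^sub>R x))"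
proof -
  have "(LBINT x. f x)
      = (\<integral>x. f x \<partial>density (distr lborel borel (\<lambda>x. t + c *\<^sub>R x)) (\<lambda>_. ennreal (\<bar>c\<bar> ^ DIM('a))))"
    using lborel_affine[OF c, of t] by (simp add: ennreal_power)
  also have "\<dots> = \<bar>c\<bar> ^ DIM('a) * (LBINT x. f (t + c *\<^sub>R x))"
    by (subst integral_density) (auto simp: integral_distr)
  finally show ?thesis .
qed

text \<open>The value is \<pi>^(N/2), and the type argument carries the dimension. It is kept as a
  positive symbol, since it enters only through norms of Gaussians and the normalization of the
  kernel.\<close>

definition gauss_const :: "'a::euclidean_space itself \<Rightarrow> real" where
  "gauss_const _ = (LBINT x. exp (- (norm (x::'a))\<^sup>2))"

lemma gauss_const_pos: "0 < gauss_const TYPE('a::euclidean_space)"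
proof -
  have i: "integrable lborel (\<lambda>x::'a. exp (- (norm x)\<^sup>2))"
    using integrable_exp_minus_norm_sq[of 1] by simp
  have "gauss_const TYPE('a) \<noteq> 0"
  proof
    assume "gauss_const TYPE('a) = 0"
    then have "AE x::'a in lborel. exp (- (norm x)\<^sup>2) = 0"
      using integral_nonneg_eq_0_iff_AE[OF i] by (simp add: gauss_const_def)
    then have "AE x::'a in lborel. False" by simp
    then show False
      by (simp add: eventually_False trivial_limit_def[symmetric] ae_filter_eq_bot_iff)
  qed
  moreover have "0 \<le> gauss_const TYPE('a)" by (simp add: gauss_const_def)
  ultimately show ?thesis by simp
qed

lemma integral_gauss_shift:
  assumes s: "s > 0"
  shows "(LBINT y. exp (- s * (norm (y - m))^2)) = gauss_const TYPE('a) / sqrt s ^ DIM('a)"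
    and "integrable lborel (\<lambda>y. exp (- s * (norm (y - m :: 'a::euclidean_space))^2))"
proof -
  have v: "(LBINT y. exp (- s * (norm (y - m))^2)) = \<bar>1 / sqrt s\<bar> ^ DIM('a) * gauss_const TYPE('a)"
    unfolding gauss_const_def using s
    by (subst lborel_integral_affine[of "1 / sqrt s" _ m]) (auto simp: power_divide)
  then show "(LBINT y. exp (- s * (norm (y - m))^2)) = gauss_const TYPE('a) / sqrt s ^ DIM('a)"
    using s by (simp add: power_one_over field_simps)
  \<comment> \<open>The integral of a function that is not integrable is 0 by convention, so a
    nonzero value proves integrability.\<close>
  have "(LBINT y. exp (- s * (norm (y - m))^2)) \<noteq> 0" using v s gauss_const_pos[where 'a='a] by simp
  then show "integrable lborel (\<lambda>y. exp (- s * (norm (y - m))^2))"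
    using not_integrable_integral_eq by blast
qed

text \<open>
  In these parameters, \<open>mehler_kernel l t x y\<close> is \<open>G x / G y\<close> times the Gaussian probability density in \<open>y\<close>
  with center \<open>mehler_contraction t *\<^sub>R x\<close> and exponent \<open>mehler_rate l t\<close>, where \<open>G x = exp (- l |x|^2 / 2)\<close>.
\<close>

definition mehler_rate :: "real \<Rightarrow> real \<Rightarrow> real" where "mehler_rate l t = l * (1 + t)^2 / (4 * t)"

definition mehler_contraction :: "real \<Rightarrow> real" where "mehler_contraction t = (1 - t) / (1 + t)"

definition mehler_kernel :: "real \<Rightarrow> real \<Rightarrow> 'a::euclidean_space \<Rightarrow> 'a \<Rightarrow> real" where
  "mehler_kernel l t x y = sqrt (mehler_rate l t) ^ DIM('a) / gauss_const TYPE('a) * mehler (l * t) (l / t) x y"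

abbreviation "mehler_kernel2 l t z \<equiv> mehler_kernel l t (fst z) (snd z)"

lemma mehler_kernel_commute: "mehler_kernel l t x y = mehler_kernel l t y x"
  by (simp add: mehler_kernel_def mehler_commute)

lemma mehler_kernel_measurable [measurable]: "(\<lambda>z. mehler_kernel2 l t z) \<in> borel_measurable borel"
  unfolding mehler_kernel_def by measurable

lemma mehler_rate_pos: "0 < l \<Longrightarrow> 0 < t \<Longrightarrow> 0 < mehler_rate l t" by (simp add: mehler_rate_def)

lemma mehler_kernel_eq:
  fixes x y :: "'a::euclidean_space"
  assumes l: "0 < l" and t: "0 < t"
  shows "mehler_kernel l t x y = sqrt (mehler_rate l t) ^ DIM('a) / gauss_const TYPE('a)
    * exp (- mehler_rate l t * (norm (y - mehler_contraction t *\<^sub>R x))^2) * (exp (- l * (norm x)^2 / 2) / exp (- l * (norm y)^2 / 2))"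
proof -
  have "- (l * t * (norm (x + y))^2 + l / t * (norm (x - y))^2) / 4
     = - mehler_rate l t * (norm (y - mehler_contraction t *\<^sub>R x))^2 + (- l * (norm x)^2 / 2 - - l * (norm y)^2 / 2)"
  proof -
    \<comment> \<open>Both exponents are linear in these three numbers, so the identity reduces to
      coefficients; \<open>m\<close> supplies those of Z and X, where a power of 1 + t
      cancels.\<close>
    define X Y Z where "X = x \<bullet> x" "Y = y \<bullet> y" "Z = x \<bullet> y"
    have p: "(norm (x + y))^2 = X + 2 * Z + Y" "(norm (x - y))^2 = X - 2 * Z + Y" "(norm x)^2 = X" "(norm y)^2 = Y"
      "(norm (y - mehler_contraction t *\<^sub>R x))^2 = Y - 2 * mehler_contraction t * Z + (mehler_contraction t)^2 * X"
      unfolding X_Y_Z_def power2_norm_eq_inner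
      by (simp_all add: inner_add_left inner_add_right inner_diff_left
          inner_diff_right inner_commute power2_eq_square algebra_simps)
    have t': "t \<noteq> 0" "1 + t \<noteq> 0" using t by auto
    have m: "mehler_rate l t * mehler_contraction t = l * (1 - t^2) / (4 * t)" "mehler_rate l t * (mehler_contraction t)^2 = l * (1 - t)^2 / (4 * t)"
    proof -
      have "l * q^2 / (4 * t) * (p / q) = l * (q * p) / (4 * t)"
        "l * q^2 / (4 * t) * (p / q)^2 = l * p^2 / (4 * t)" if "q \<noteq> 0" for p q
        using that t' by (simp_all add: power2_eq_square)
      from this[OF t'(2), of "1 - t"] show "mehler_rate l t * mehler_contraction t = l * (1 - t^2) / (4 * t)"
        "mehler_rate l t * (mehler_contraction t)^2 = l * (1 - t)^2 / (4 * t)"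
        by (simp_all add: mehler_rate_def mehler_contraction_def power2_eq_square algebra_simps)
    qed
    have "- mehler_rate l t * (Y - 2 * mehler_contraction t * Z + (mehler_contraction t)^2 * X)
        = - mehler_rate l t * Y + 2 * (mehler_rate l t * mehler_contraction t) * Z - (mehler_rate l t * (mehler_contraction t)^2) * X"
      by (simp add: algebra_simps)
    then have e: "- mehler_rate l t * (Y - 2 * mehler_contraction t * Z + (mehler_contraction t)^2 * X)
        = - (l * (1 + t)^2 / (4 * t)) * Y + 2 * (l * (1 - t^2) / (4 * t)) * Z - l * (1 - t)^2 / (4 * t) * X"
      unfolding m by (simp add: mehler_rate_def)
    show ?thesis unfolding p e using t' by (simp add: power2_eq_square field_simps)
  qed
  then show ?thesis
    unfolding mehler_kernel_def mehler_def by (simp only: exp_add exp_diff mult.assoc)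
qed

abbreviation "mehler_form l t f h \<equiv> LBINT z. mehler_kernel2 l t z * (f (fst z) \<bullet> h (snd z))"

text \<open>A Schur test with weight \<open>G\<close>. The kernel \<open>k x y\<close> = K(x, y)
  G(y) / G(x) is a probability density in y, and by symmetry of K the function \<open>k y x\<close>
  is one in x. The inequality between arithmetic and geometric mean splits the integrand between
  these two densities, so the constant is exactly 1.\<close>

lemma mehler_kernel_form_bound:
  fixes f h :: "'a::euclidean_space \<Rightarrow> 'b::euclidean_space"
  assumes l: "0 < l" and t: "0 < t"
    and f[measurable]: "f \<in> borel_measurable borel" "L2 f"
    and h[measurable]: "h \<in> borel_measurable borel" "L2 h"
  shows "integrable lborel (\<lambda>z. mehler_kernel2 l t z * (f (fst z) \<bullet> h (snd z)))" (is ?I)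
    and "\<bar>mehler_form l t f h\<bar>
       \<le> ((L2_sq f) + (L2_sq h)) / 2" (is ?B)
proof -
  define w where "w = sqrt (mehler_rate l t) ^ DIM('a) / gauss_const TYPE('a)"
  define k where "k x y = w * exp (- mehler_rate l t * (norm (y - mehler_contraction t *\<^sub>R x))^2)" for x y :: 'a
  define G where "G x = exp (- l * (norm x)^2 / 2)" for x :: 'a
  note s = mehler_rate_pos[OF l t]
  have w: "0 < w" using s gauss_const_pos[where 'a='a] by (simp add: w_def)
  have k0: "0 \<le> k x y" for x y using w by (simp add: k_def)
  have G: "0 < G x" for x by (simp add: G_def)
  have K: "mehler_kernel l t x y = k x y * (G x / G y)" for x y :: 'a
    unfolding k_def G_def w_def by (rule mehler_kernel_eq[OF l t])
  have [measurable]: "(\<lambda>z. k (fst z) (snd z)) \<in> borel_measurable borel" "G \<in> borel_measurable borel"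
    "(\<lambda>z. k (snd z) (fst z)) \<in> borel_measurable borel" unfolding k_def G_def[abs_def] by measurable
  have k1: "integrable lborel (\<lambda>y. k x y)" "(LBINT y. k x y) = 1" for x
    using integral_gauss_shift[OF s, of "mehler_contraction t *\<^sub>R x"] s gauss_const_pos[where 'a='a]
    by (auto simp: k_def w_def)
  have J: "integrable lborel (\<lambda>z. k (fst z) (snd z) * (norm (v (fst z)))^2)"
    "(LBINT z. k (fst z) (snd z) * (norm (v (fst z)))^2) = (L2_sq v)"
    if [measurable]: "v \<in> borel_measurable borel" and v: "L2 v" for v :: "'a \<Rightarrow> 'b"
  proof -
    have i: "integrable (lborel \<Otimes>\<^sub>M lborel) (\<lambda>(x, y). k x y * (norm (v x))^2)"
    proof (rule lborel_pair.Fubini_integrable)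
      show "(\<lambda>(x, y). k x y * (norm (v x))^2) \<in> borel_measurable (lborel \<Otimes>\<^sub>M lborel)"
        by (simp add: lborel_prod case_prod_beta')
      show "integrable lborel (\<lambda>x. \<integral>y. norm (case (x, y) of (x, y) \<Rightarrow> k x y * (norm (v x))^2) \<partial>lborel)"
        using v by (simp add: abs_mult k0 k1)
      show "AE x in lborel. integrable lborel (\<lambda>y. case (x, y) of (x, y) \<Rightarrow> k x y * (norm (v x))^2)"
        by (simp add: k1)
    qed
    then show "integrable lborel (\<lambda>z. k (fst z) (snd z) * (norm (v (fst z)))^2)"
      by (simp add: lborel_prod case_prod_beta')
    show "(LBINT z. k (fst z) (snd z) * (norm (v (fst z)))^2) = (L2_sq v)"
      using lborel_pair.integral_fst[OF i] by (simp add: lborel_prod case_prod_beta' k1)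
  qed
  note Jf = J[OF f] and Jh = J[OF h]
  have Jh': "integrable lborel (\<lambda>z. k (snd z) (fst z) * (norm (h (snd z)))^2)"
    "(LBINT z. k (snd z) (fst z) * (norm (h (snd z)))^2) = (L2_sq h)"
    using lborel_pair.integrable_product_swap[of "\<lambda>z. k (fst z) (snd z) * (norm (h (fst z)))^2"] Jh
      lborel_integral_swap[of "\<lambda>z. k (fst z) (snd z) * (norm (h (fst z)))^2"]
    by (simp_all add: lborel_prod case_prod_beta')
  have bd: "\<bar>mehler_kernel l t x y * (f x \<bullet> h y)\<bar> \<le> (k x y * (norm (f x))^2 + k y x * (norm (h y))^2) / 2" for x y
  proof -
    \<comment> \<open>With this ratio, K r = \<open>k x y\<close> and K / r = \<open>k y x\<close>,
      so the weighted mean inequality produces precisely the two densities.\<close>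
    define r where "r = G y / G x"
    have r: "0 < r" using G by (simp add: r_def)
    have K1: "k x y = mehler_kernel l t x y * r" using G[of x] G[of y] by (simp add: K r_def)
    have K2: "k y x = mehler_kernel l t x y / r"
      unfolding mehler_kernel_commute[of l t x y] using G[of x] G[of y] by (simp add: K r_def)
    have K0: "0 \<le> mehler_kernel l t x y" using K k0 G by (simp add: less_imp_le)
    have "\<bar>f x \<bullet> h y\<bar> \<le> norm (f x) * norm (h y)" by (rule Cauchy_Schwarz_ineq2)
    also have "\<dots> \<le> ((norm (f x))^2 * r + (norm (h y))^2 / r) / 2"
    proof -
      have "0 \<le> (norm (f x) * sqrt r - norm (h y) / sqrt r)^2" by simp
      also have "\<dots> = (norm (f x))^2 * r + (norm (h y))^2 / r - 2 * (norm (f x) * norm (h y))"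
        using r by (simp add: power2_diff power_mult_distrib power_divide)
      finally show ?thesis by simp
    qed
    finally have "mehler_kernel l t x y * \<bar>f x \<bullet> h y\<bar> \<le> mehler_kernel l t x y * (((norm (f x))^2 * r + (norm (h y))^2 / r) / 2)"
      by (rule mult_left_mono) (rule K0)
    then show ?thesis unfolding K1 K2 using K0 by (simp add: abs_mult field_simps)
  qed
  have S: "integrable lborel (\<lambda>z. (k (fst z) (snd z) * (norm (f (fst z)))^2 + k (snd z) (fst z) * (norm (h (snd z)))^2) / 2)"
    using Jf(1) Jh'(1) by simp
  show I: ?I by (rule lint_bound[OF S]) (use order_trans[OF bd abs_ge_self] in auto)
  have "\<bar>mehler_form l t f h\<bar>
      \<le> (LBINT z. (k (fst z) (snd z) * (norm (f (fst z)))^2 + k (snd z) (fst z) * (norm (h (snd z)))^2) / 2)"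
    using Bochner_Integration.integral_norm_bound_integral[OF I S] bd by simp
  also have "\<dots> = ((L2_sq f) + (L2_sq h)) / 2" using Jf Jh' by simp
  finally show ?B .
qed

section \<open>Convergence of the Mehler forms as t tends to 0\<close>

text \<open>The substitution y -> r x + y / sqrt s turns the kernel into a fixed Gaussian. As t -> 0
  the contraction r tends to 1 and the rate s to infinity, so the second argument tends to x, and
  continuity with compact support provides limit and domination.\<close>

lemma mehler_kernel_form_continuous_tendsto:
  fixes w :: "'a::euclidean_space \<Rightarrow> 'b::euclidean_space"
  assumes l: "0 < l" and t: "\<And>n. 0 < t n" "t \<longlonglongrightarrow> 0"
    and w: "continuous_on UNIV w" and R: "\<And>x. norm x > R \<Longrightarrow> w x = 0"
  shows "(\<lambda>n. mehler_form l (t n) w w)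
    \<longlonglongrightarrow> (L2_sq w)"
proof -
  define C where "C = gauss_const TYPE('a)"
  have C: "0 < C" unfolding C_def by (rule gauss_const_pos)
  define G where "G x = exp (- l * (norm x)^2 / 2)" for x :: 'a
  \<comment> \<open>The factor G(x) / G(y) of the kernel is distributed over the two copies of
    \<open>w\<close>; the growing 1 / G is harmless since \<open>w\<close> vanishes outside a
    ball.\<close>
  define v where "v x = (1 / G x) *\<^sub>R w x" for x
  have Gc: "continuous_on UNIV G" unfolding G_def[abs_def] by (intro continuous_intros) simp
  have G0: "0 < G x" for x by (simp add: G_def)
  have vc: "continuous_on UNIV v"
    unfolding v_def[abs_def] by (intro continuous_intros Gc w) (simp add: G_def)
  have [measurable]: "w \<in> borel_measurable borel" "v \<in> borel_measurable borel" "G \<in> borel_measurable borel"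
    using w vc Gc by (auto intro: borel_measurable_continuous_onI)
  have bounded: "\<exists>M\<ge>0. \<forall>x. norm (f x) \<le> M" if f: "continuous_on UNIV f" and f0: "\<And>x. norm x > R \<Longrightarrow> f x = 0" for f :: "'a \<Rightarrow> 'b"
  proof -
    have "compact (f ` cball 0 R)"
      using f by (intro compact_continuous_image) (auto intro: continuous_on_subset)
    then obtain M where M: "0 < M" "\<And>x. x \<in> cball 0 R \<Longrightarrow> norm (f x) \<le> M"
      using compact_imp_bounded[of "f ` cball 0 R"] by (auto simp: bounded_pos)
    have "norm (f x) \<le> M" for x using M f0[of x] by (cases "norm x \<le> R") auto
    with M(1) show ?thesis by (auto intro!: exI[of _ M])
  qed
  obtain M where M: "0 \<le> M" "\<And>x. norm (v x) \<le> M" using bounded[OF vc] R by (auto simp: v_def)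
  obtain M' where M': "0 \<le> M'" "\<And>x. norm (G x *\<^sub>R w x) \<le> M'"
    using bounded[of "\<lambda>x. G x *\<^sub>R w x"] w Gc R by (auto intro!: continuous_intros)
  define s where "s n = mehler_rate l (t n)" for n
  define r where "r n = mehler_contraction (t n)" for n
  have s: "0 < s n" for n unfolding s_def using l t by (intro mehler_rate_pos)
  define F where "F n x y = exp (- (norm y)\<^sup>2) * ((G x *\<^sub>R w x) \<bullet> v (r n *\<^sub>R x + (1 / sqrt (s n)) *\<^sub>R y))" for n and x y :: 'a
  define B where "B z = (M' * M) * (indicator (cball 0 R) (fst z) * exp (- (norm (snd z))\<^sup>2))" for z :: "'a \<times> 'a"
  have Bi: "integrable lborel B"
  proof -
    have [measurable]: "(\<lambda>z::'a \<times> 'a. indicat_real (cball 0 R) (fst z)) \<in> borel_measurable borel"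
      by (rule measurable_compose[OF borel_measurable_fst_snd(1) borel_measurable_indicator]) simp
    have "integrable (lborel \<Otimes>\<^sub>M lborel) (\<lambda>(x::'a, y::'a). indicat_real (cball 0 R) x * exp (- (norm y)\<^sup>2))"
    proof (rule lborel_pair.Fubini_integrable)
      have i: "integrable lborel (\<lambda>x::'a. indicat_real (cball 0 R) x)"
        using emeasure_bounded_finite[OF bounded_cball, of "0::'a" R]
        by (intro integrable_real_indicator) auto
      have g: "integrable lborel (\<lambda>x::'a. exp (- (norm x)\<^sup>2))"
        using integrable_exp_minus_norm_sq[of 1] by simp
      show "integrable lborel (\<lambda>x::'a. \<integral>y. norm (case (x, y) of (x, y::'a) \<Rightarrow> indicat_real (cball 0 R) x * exp (- (norm y)\<^sup>2)) \<partial>lborel)"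
        using i by (simp add: abs_mult)
      show "AE x::'a in lborel. integrable lborel (\<lambda>y. case (x, y) of (x, y::'a) \<Rightarrow> indicat_real (cball 0 R) x * exp (- (norm y)\<^sup>2))"
        using g by simp
    qed (simp add: lborel_prod case_prod_beta')
    then show ?thesis
      unfolding B_def[abs_def] by (intro integrable_mult_right) (simp add: lborel_prod case_prod_beta')
  qed
  have FB: "\<bar>F n (fst z) (snd z)\<bar> \<le> B z" for n z
  proof (cases "norm (fst z) \<le> R")
    case True
    let ?y = "r n *\<^sub>R fst z + (1 / sqrt (s n)) *\<^sub>R snd z"
    have "\<bar>(G (fst z) *\<^sub>R w (fst z)) \<bullet> v ?y\<bar> \<le> norm (G (fst z) *\<^sub>R w (fst z)) * norm (v ?y)"
      by (rule Cauchy_Schwarz_ineq2)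
    also have "\<dots> \<le> M' * M" by (intro mult_mono M M') auto
    finally show ?thesis using True by (simp add: F_def B_def abs_mult mult.commute)
  next
    case False
    then show ?thesis using R[of "fst z"] M M' by (simp add: F_def B_def)
  qed
  have [measurable]: "(\<lambda>z. F n (fst z) (snd z)) \<in> borel_measurable borel" for n
    unfolding F_def by measurable
  have Fi: "integrable lborel (\<lambda>z. F n (fst z) (snd z))" for n
    by (rule lint_bound[OF Bi]) (use order_trans[OF FB abs_ge_self] in auto)
  have wL2: "L2 w"
  proof -
    have "integrable lborel (\<lambda>x. indicator (cball 0 R) x *\<^sub>R (norm (w x))^2)"
      by (rule borel_integrable_compact) (auto intro!: continuous_intros continuous_on_subset[OF w])
    moreover have "indicator (cball 0 R) x *\<^sub>R (norm (w x))^2 = (norm (w x))^2" for x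
      using R[of x] by (auto simp: indicator_def)
    ultimately show ?thesis by (simp only:)
  qed
  have eq: "mehler_form l (t n) w w
      = (1 / C) * (LBINT z. F n (fst z) (snd z))" for n
  proof -
    have i: "integrable (lborel \<Otimes>\<^sub>M lborel) (\<lambda>(x, y). mehler_kernel l (t n) x y * (w x \<bullet> w y))"
      using mehler_kernel_form_bound(1)[OF l t(1) _ wL2 _ wL2, of n] by (simp add: lborel_prod case_prod_beta')
    have iF: "integrable (lborel \<Otimes>\<^sub>M lborel) (\<lambda>(x, y). F n x y)"
      using Fi[of n] by (simp add: lborel_prod case_prod_beta')
    have inner: "(LBINT y. mehler_kernel l (t n) x y * (w x \<bullet> w y)) = (1 / C) * (LBINT y. F n x y)" for x
    proof -
      have K: "mehler_kernel l (t n) x y * (w x \<bullet> w y)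
         = sqrt (s n) ^ DIM('a) / C * (exp (- s n * (norm (y - r n *\<^sub>R x))^2) * ((G x *\<^sub>R w x) \<bullet> v y))" for y
        unfolding mehler_kernel_eq[OF l t(1)] s_def r_def C_def G_def v_def by simp
      have "(LBINT y. exp (- s n * (norm (y - r n *\<^sub>R x))^2) * ((G x *\<^sub>R w x) \<bullet> v y))
         = \<bar>1 / sqrt (s n)\<bar> ^ DIM('a) * (LBINT y. F n x y)"
        using s[of n] by (subst lborel_integral_affine[of "1 / sqrt (s n)" _ "r n *\<^sub>R x"])
           (auto simp: F_def[abs_def] power_divide)
      then show ?thesis unfolding K using s[of n] by (simp add: power_one_over)
    qed
    have "mehler_form l (t n) w w
        = (LBINT x. (LBINT y. mehler_kernel l (t n) x y * (w x \<bullet> w y)))"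
      using lborel_pair.integral_fst[OF i] by (simp add: lborel_prod case_prod_beta')
    also have "\<dots> = (1 / C) * (LBINT z. F n (fst z) (snd z))"
      unfolding inner using lborel_pair.integral_fst[OF iF] by (simp add: lborel_prod case_prod_beta')
    finally show ?thesis .
  qed
  have r1: "r \<longlonglongrightarrow> 1"
    unfolding r_def[abs_def] mehler_contraction_def using t(2) by (auto intro!: tendsto_eq_intros)
  have s0: "(\<lambda>n. 1 / sqrt (s n)) \<longlonglongrightarrow> 0"
  proof -
    have "1 / sqrt (s n) = sqrt (4 * t n / (l * (1 + t n)^2))" for n
      by (simp add: s_def mehler_rate_def real_sqrt_divide)
    moreover have "(\<lambda>n. sqrt (4 * t n / (l * (1 + t n)^2))) \<longlonglongrightarrow> sqrt (4 * 0 / (l * (1 + 0)^2))"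
      using t(2) l by (intro tendsto_intros) auto
    ultimately show ?thesis by simp
  qed
  have "(\<lambda>n. \<integral>z. F n (fst z) (snd z) \<partial>lborel) \<longlonglongrightarrow> (LBINT z. exp (- (norm (snd z :: 'a))\<^sup>2) * (norm (w (fst z)))^2)"
  proof (rule integral_dominated_convergence[OF _ _ Bi])
    show "AE z in lborel. (\<lambda>n. F n (fst z) (snd z)) \<longlonglongrightarrow> exp (- (norm (snd z))\<^sup>2) * (norm (w (fst z)))^2"
    proof (rule AE_I2)
      fix z :: "'a \<times> 'a"
      have "(\<lambda>n. r n *\<^sub>R fst z + (1 / sqrt (s n)) *\<^sub>R snd z) \<longlonglongrightarrow> 1 *\<^sub>R fst z + 0 *\<^sub>R snd z"
        by (intro tendsto_intros r1 s0)
      moreover have "isCont v (1 *\<^sub>R fst z + 0 *\<^sub>R snd z)"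
        using vc by (simp add: continuous_on_eq_continuous_at)
      ultimately have "(\<lambda>n. v (r n *\<^sub>R fst z + (1 / sqrt (s n)) *\<^sub>R snd z)) \<longlonglongrightarrow> v (1 *\<^sub>R fst z + 0 *\<^sub>R snd z)"
        using isCont_tendsto_compose by blast
      then have "(\<lambda>n. F n (fst z) (snd z)) \<longlonglongrightarrow> exp (- (norm (snd z))\<^sup>2) * ((G (fst z) *\<^sub>R w (fst z)) \<bullet> v (1 *\<^sub>R fst z + 0 *\<^sub>R snd z))"
        unfolding F_def by (intro tendsto_intros)
      then show "(\<lambda>n. F n (fst z) (snd z)) \<longlonglongrightarrow> exp (- (norm (snd z))\<^sup>2) * (norm (w (fst z)))^2"
        using G0[of "fst z"] by (simp add: v_def power2_norm_eq_inner)
    qed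
  qed (use FB in auto)
  moreover have "(LBINT z. exp (- (norm (snd z :: 'a))\<^sup>2) * (norm (w (fst z)))^2) = C * (L2_sq w)"
  proof -
    have "integrable (lborel \<Otimes>\<^sub>M lborel) (\<lambda>(x, y::'a). exp (- (norm y)\<^sup>2) * (norm (w x))^2)"
      by (rule lborel_pair.Fubini_integrable)
         (use wL2 integrable_exp_minus_norm_sq[of 1, where 'a='a] in \<open>auto simp: abs_mult\<close>)
    from lborel_pair.integral_fst[OF this] show ?thesis
      by (simp add: lborel_prod case_prod_beta' C_def gauss_const_def)
  qed
  ultimately have "(\<lambda>n. (1 / C) * (LBINT z. F n (fst z) (snd z))) \<longlonglongrightarrow> (1 / C) * (C * (L2_sq w))"
    by (intro tendsto_mult_left) simp
  then show ?thesis unfolding eq using C by simp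
qed

lemma norm_add_sq_le:
  "(norm (a + b))^2 \<le> 2 * (norm a)^2 + 2 * (norm (b::'a::real_inner))^2"
proof -
  have "(norm (a + b))^2 \<le> (norm (a + b))^2 + (norm (a - b))^2" by simp
  also have "\<dots> = 2 * ((norm a)^2 + (norm b)^2)" by (rule norm_sum_diff_sq)
  finally show ?thesis by (simp only: distrib_left)
qed

lemma norm_diff_sq_le:
  "(norm (a - b))^2 \<le> 2 * (norm a)^2 + 2 * (norm (b::'a::real_inner))^2"
  using norm_add_sq_le[of a "- b"] by simp

lemma L2_approx_continuous:
  fixes f :: "'a::euclidean_space \<Rightarrow> 'b::euclidean_space"
  assumes f[measurable]: "f \<in> borel_measurable borel" and f2: "L2 f"
    and e: "0 < e"
  obtains w R where "continuous_on UNIV w" "\<And>x. norm x > R \<Longrightarrow> w x = 0"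
    "L2 w" "(LBINT x. (norm (f x - w x))^2) < e"
proof -
  \<comment> \<open>\<open>T k\<close> shortens vectors to norm at most k and
    \<open>\<rho> k\<close> is a continuous cutoff in space. Continuity of \<open>T\<close> is used
    at \<open>Suc k\<close>, where the denominator stays positive.\<close>
  define T where "T k v = (real k / max (real k) (norm v)) *\<^sub>R v" for k and v :: 'b
  define \<rho> where "\<rho> k x = max 0 (min 1 (real k + 1 - norm x))" for k and x :: 'a
  have Tc: "continuous_on S (T (Suc k))" for S k
    unfolding T_def[abs_def] by (intro continuous_intros) auto
  have \<rho>c: "continuous_on S (\<rho> k)" for S k unfolding \<rho>_def[abs_def] by (intro continuous_intros)
  have \<rho>01: "0 \<le> \<rho> k x" "\<rho> k x \<le> 1" for k x by (auto simp: \<rho>_def)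
  have Tn: "norm (T k v) \<le> real k" for k v by (auto simp: T_def max_def field_simps)
  have [measurable]: "T (Suc k) \<in> borel_measurable borel" "\<rho> k \<in> borel_measurable borel" for k
    using Tc \<rho>c by (auto intro: borel_measurable_continuous_onI)
  have "(\<lambda>k. \<integral>x. (norm (f x - \<rho> k x *\<^sub>R T (Suc k) (f x)))^2 \<partial>lborel) \<longlonglongrightarrow> (\<integral>x. 0 \<partial>(lborel :: 'a measure))"
  proof (rule integral_dominated_convergence[OF _ _ f2])
    show "AE x in lborel. (\<lambda>k. (norm (f x - \<rho> k x *\<^sub>R T (Suc k) (f x)))^2) \<longlonglongrightarrow> 0"
    proof (rule AE_I2)
      fix x
      obtain n where n: "norm x \<le> real n" "norm (f x) \<le> real n"
        using real_arch_simple[of "max (norm x) (norm (f x))"] by auto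
      have "f x - \<rho> k x *\<^sub>R T (Suc k) (f x) = 0" if "k \<ge> n" for k
        using n that by (simp add: \<rho>_def T_def max_def)
      then have "\<forall>\<^sub>F k in sequentially. 0 = (norm (f x - \<rho> k x *\<^sub>R T (Suc k) (f x)))^2"
        by (intro eventually_sequentiallyI[of n]) simp
      then show "(\<lambda>k. (norm (f x - \<rho> k x *\<^sub>R T (Suc k) (f x)))^2) \<longlonglongrightarrow> 0"
        by (rule Lim_transform_eventually[OF tendsto_const])
    qed
    show "AE x in lborel. norm ((norm (f x - \<rho> k x *\<^sub>R T (Suc k) (f x)))^2) \<le> (norm (f x))^2" for k
    proof (rule AE_I2)
      fix x
      define c where "c = \<rho> k x * (real (Suc k) / max (real (Suc k)) (norm (f x)))"
      have q: "0 \<le> real (Suc k) / max (real (Suc k)) (norm (f x))"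
        "real (Suc k) / max (real (Suc k)) (norm (f x)) \<le> 1" by (auto simp: divide_le_eq_1)
      have c: "0 \<le> c" "c \<le> 1"
        unfolding c_def using mult_nonneg_nonneg[OF \<rho>01(1) q(1)] mult_le_one[OF \<rho>01(2) q] .
      have "f x - \<rho> k x *\<^sub>R T (Suc k) (f x) = (1 - c) *\<^sub>R f x"
        by (simp add: T_def c_def algebra_simps)
      then have "norm (f x - \<rho> k x *\<^sub>R T (Suc k) (f x)) \<le> norm (f x)"
        using c by (simp add: mult_left_le_one_le)
      then show "norm ((norm (f x - \<rho> k x *\<^sub>R T (Suc k) (f x)))^2) \<le> (norm (f x))^2"
        by (simp add: power_mono)
    qed
  qed auto
  then have "\<forall>\<^sub>F k in sequentially. (LBINT x. (norm (f x - \<rho> k x *\<^sub>R T (Suc k) (f x)))^2) < e / 4"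
    using e by (intro order_tendstoD) auto
  then obtain k where k: "(LBINT x. (norm (f x - \<rho> k x *\<^sub>R T (Suc k) (f x)))^2) < e / 4"
    by (auto simp: eventually_sequentially)
  define F where "F x = \<rho> k x *\<^sub>R T (Suc k) (f x)" for x
  have [measurable]: "F \<in> borel_measurable borel" unfolding F_def[abs_def] by measurable
  \<comment> \<open>This yields continuous functions converging to \<open>f\<close> off a null set,
    but without any bound. Applying the same truncation and cutoff to them keeps continuity and
    makes the convergence dominated by \<open>D\<close>.\<close>
  have "f measurable_on UNIV"
    by (intro lebesgue_measurable_imp_measurable_on) (auto intro: measurable_completion)
  then obtain N g where N: "negligible N" and g: "\<And>n. continuous_on UNIV (g n)"
    and lim: "\<And>x. x \<notin> N \<Longrightarrow> (\<lambda>n. g n x) \<longlonglongrightarrow> f x" by (auto simp: measurable_on_def)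
  define W where "W n x = \<rho> k x *\<^sub>R T (Suc k) (g n x)" for n x
  have Wc: "continuous_on UNIV (W n)" for n unfolding W_def[abs_def]
    by (intro continuous_intros \<rho>c continuous_on_compose2[OF Tc g]) auto
  then have [measurable]: "W n \<in> borel_measurable borel" for n
    by (rule borel_measurable_continuous_onI)
  have W0: "W n x = 0" if "norm x > real k + 1" for n x using that by (simp add: W_def \<rho>_def)
  have nb: "norm (\<rho> k x *\<^sub>R T (Suc k) v) \<le> real (Suc k)" for x v
  proof -
    have "norm (\<rho> k x *\<^sub>R T (Suc k) v) \<le> 1 * norm (T (Suc k) v)"
      unfolding norm_scaleR using \<rho>01[of k x] by (intro mult_right_mono) auto
    then show ?thesis using Tn[of "Suc k" v] by simp
  qed
  define D where "D x = (2 * real (Suc k))^2 * indicator (cball 0 (real k + 1)) x" for x :: 'a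
  have Di: "integrable lborel D" unfolding D_def[abs_def]
    using emeasure_bounded_finite[OF bounded_cball, of "0::'a" "real k + 1"]
    by (intro integrable_mult_right integrable_real_indicator) auto
  have WD: "(norm (W n x - F x))^2 \<le> D x" "(norm (W n x))^2 \<le> D x" "(norm (F x))^2 \<le> D x" for n x
  proof -
    have *: "(norm v)^2 \<le> D x" if "norm v \<le> 2 * real (Suc k)" "norm x > real k + 1 \<Longrightarrow> v = 0" for v :: 'b
      using that power_mono[OF that(1), of 2] by (auto simp: D_def indicator_def not_le)
    have b: "norm (W n x) \<le> real (Suc k)" "norm (F x) \<le> real (Suc k)"
      unfolding W_def F_def by (rule nb)+
    have z: "F x = 0" if "norm x > real k + 1" using that by (simp add: F_def \<rho>_def)
    show "(norm (W n x - F x))^2 \<le> D x"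
      using b norm_triangle_ineq4[of "W n x" "F x"] W0 z by (intro *) auto
    show "(norm (W n x))^2 \<le> D x" "(norm (F x))^2 \<le> D x" using b W0 z by (intro *; force)+
  qed
  have "(\<lambda>n. \<integral>x. (norm (W n x - F x))^2 \<partial>lborel) \<longlonglongrightarrow> (\<integral>x. 0 \<partial>(lborel :: 'a measure))"
  proof (rule integral_dominated_convergence[OF _ _ Di])
    have "AE x in lebesgue. x \<notin> N" using N by (simp add: negligible_iff_null_sets AE_not_in)
    then have "AE x in lborel. x \<notin> N" by (simp add: AE_completion_iff)
    then show "AE x in lborel. (\<lambda>n. (norm (W n x - F x))^2) \<longlonglongrightarrow> 0"
    proof eventually_elim
      case (elim x)
      have "isCont (T (Suc k)) (f x)"
        using Tc[of UNIV k] by (simp add: continuous_on_eq_continuous_at)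
      then have "(\<lambda>n. T (Suc k) (g n x)) \<longlonglongrightarrow> T (Suc k) (f x)"
        using isCont_tendsto_compose lim[OF elim] by blast
      then have "(\<lambda>n. (norm (W n x - F x))^2) \<longlonglongrightarrow> (norm (F x - F x))^2"
        unfolding W_def F_def by (intro tendsto_intros)
      then show ?case by simp
    qed
  qed (use WD in auto)
  then have "\<forall>\<^sub>F n in sequentially. (LBINT x. (norm (W n x - F x))^2) < e / 4"
    using e by (intro order_tendstoD) auto
  then obtain n where n: "(LBINT x. (norm (W n x - F x))^2) < e / 4"
    by (auto simp: eventually_sequentially)
  have Wi: "L2 (\<lambda>x. W n x)" and WFi: "L2 (\<lambda>x. W n x - F x)"
    and Fi: "L2 (\<lambda>x. F x)"
    by (rule lint_bound[OF Di], simp, use order_trans[OF WD(2) abs_ge_self] order_trans[OF WD(1) abs_ge_self] order_trans[OF WD(3) abs_ge_self] in simp)+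
  note sq = norm_add_sq_le[where 'a='b]
  have fFi: "L2 (\<lambda>x. f x - F x)"
    by (rule lint_bound[of _ "\<lambda>x. 2 * (norm (f x))^2 + 2 * (norm (F x))^2"])
       (use f2 Fi sq[of "f _" "- F _"] in auto)
  have "(LBINT x. (norm (f x - W n x))^2) \<le> (LBINT x. 2 * (norm (f x - F x))^2 + 2 * (norm (W n x - F x))^2)"
  proof (rule integral_mono)
    show "(norm (f x - W n x))^2 \<le> 2 * (norm (f x - F x))^2 + 2 * (norm (W n x - F x))^2" for x
      using sq[of "f x - F x" "F x - W n x"] by (simp add: norm_minus_commute)
    show "L2 (\<lambda>x. f x - W n x)"
      by (rule lint_bound[of _ "\<lambda>x. 2 * (norm (f x))^2 + 2 * (norm (W n x))^2"])
         (use f2 Wi sq[of "f _" "- W n _"] in auto)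
  qed (use fFi WFi in auto)
  also have "\<dots> < e" using k n fFi WFi by (simp add: F_def)
  finally show ?thesis using that[of "W n" "real k + 1"] Wc W0 Wi by blast
qed

lemma norm_mult_le_sum_squares: "norm a * norm b \<le> (norm a)^2 + (norm b)^2"
  using sum_squares_bound[of "norm a" "norm b"] mult_nonneg_nonneg[OF norm_ge_zero[of a] norm_ge_zero[of b]]
  by linarith

text \<open>Density, with the parallelogram law for w + d = f and w - d, where d = f - w. The bound
  of the form by the squared norm is an upper bound for f directly, and applied to w - d it becomes
  a lower bound for f.\<close>

lemma mehler_kernel_form_self_tendsto:
  fixes f :: "'a::euclidean_space \<Rightarrow> 'b::euclidean_space"
  assumes l: "0 < l" and t: "\<And>n. 0 < t n" "t \<longlonglongrightarrow> 0"
    and f[measurable]: "f \<in> borel_measurable borel" and f2: "L2 f"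
  shows "(\<lambda>n. mehler_form l (t n) f f)
    \<longlonglongrightarrow> (L2_sq f)"
proof (rule LIMSEQ_I)
  fix e :: real assume e: "0 < e"
  define B where "B n v = mehler_form l (t n) v v" for n and v :: "'a \<Rightarrow> 'b"
  define I where "I v = (L2_sq v)" for v :: "'a \<Rightarrow> 'b"
  obtain w R where w: "continuous_on UNIV w" "\<And>x. norm x > R \<Longrightarrow> w x = 0"
    "L2 w" "I (\<lambda>x. f x - w x) < e / 8"
    using L2_approx_continuous[OF f f2, of "e / 8"] e unfolding I_def by auto
  have [measurable]: "w \<in> borel_measurable borel"
    using w(1) by (rule borel_measurable_continuous_onI)
  note sq = norm_add_sq_le[where 'a='b]
  have d2: "L2 (\<lambda>x. f x - w x)"
    by (rule lint_bound[of _ "\<lambda>x. 2 * (norm (f x))^2 + 2 * (norm (w x))^2"])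
       (use f2 w(3) sq[of "f _" "- w _"] in auto)
  have m2: "L2 (\<lambda>x. w x - (f x - w x))"
    by (rule lint_bound[of _ "\<lambda>x. 2 * (norm (w x))^2 + 2 * (norm (f x - w x))^2"])
       (use d2 w(3) norm_diff_sq_le[of "w _" "f _ - w _"] in \<open>simp_all del: diff_diff_eq2\<close>)
  have le: "\<bar>B n v\<bar> \<le> I v" if [measurable]: "v \<in> borel_measurable borel" and "L2 v" for n v
    using mehler_kernel_form_bound(2)[OF l t(1) that that, of n] by (simp add: B_def I_def)
  have int: "integrable lborel (\<lambda>z. mehler_kernel2 l (t n) z * (v (fst z) \<bullet> v (snd z)))"
    if [measurable]: "v \<in> borel_measurable borel" and "L2 v" for n and v :: "'a \<Rightarrow> 'b"
    using mehler_kernel_form_bound(1)[OF l t(1) that that, of n] .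
  let ?d = "\<lambda>x. f x - w x" and ?m = "\<lambda>x. w x - (f x - w x)"
  have parB: "B n f + B n ?m = 2 * B n w + 2 * B n ?d" for n
  proof -
    have "B n f + B n ?m = (LBINT z. mehler_kernel2 l (t n) z * (f (fst z) \<bullet> f (snd z))
        + mehler_kernel2 l (t n) z * (?m (fst z) \<bullet> ?m (snd z)))"
      unfolding B_def using f2 m2 by (intro Bochner_Integration.integral_add[symmetric] int) auto
    also have "\<dots> = (LBINT z. 2 * (mehler_kernel2 l (t n) z * (w (fst z) \<bullet> w (snd z)))
        + 2 * (mehler_kernel2 l (t n) z * (?d (fst z) \<bullet> ?d (snd z))))" by (intro lint_cong refl)
         (simp add: inner_diff_left inner_diff_right algebra_simps)
    also have "\<dots> = 2 * B n w + 2 * B n ?d" unfolding B_def using w(3) d2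
      by (subst Bochner_Integration.integral_add) (auto intro!: int integrable_mult_right)
    finally show ?thesis .
  qed
  have parI: "I f + I ?m = 2 * I w + 2 * I ?d"
  proof -
    have "I f + I ?m = (LBINT x. (norm (f x))^2 + (norm (?m x))^2)"
      unfolding I_def using f2 m2 by simp
    also have "\<dots> = (LBINT x. 2 * (norm (w x))^2 + 2 * (norm (?d x))^2)" by (intro lint_cong refl)
         (simp add: power2_norm_eq_inner inner_diff_left inner_diff_right inner_commute algebra_simps)
    also have "\<dots> = 2 * I w + 2 * I ?d" unfolding I_def using w(3) d2 by simp
    finally show ?thesis .
  qed
  have "(\<lambda>n. B n w) \<longlonglongrightarrow> I w"
    unfolding B_def I_def by (rule mehler_kernel_form_continuous_tendsto[OF l t w(1,2)])
  then obtain n0 where n0: "\<And>n. n \<ge> n0 \<Longrightarrow> \<bar>B n w - I w\<bar> < e / 8"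
    using LIMSEQ_D[of "\<lambda>n. B n w" "I w" "e / 8"] e by auto
  have "norm (B n f - I f) < e" if n: "n \<ge> n0" for n
  proof -
    \<comment> \<open>B f \<le> I f is immediate. Conversely, subtracting the two parallelogram laws
      and using B \<le> I for w - d gives B f - I f \<ge> 2 (B w - I w) - 4 I d, which exceeds - 3 e
      / 4.\<close>
    have "\<bar>B n f\<bar> \<le> I f" "\<bar>B n ?m\<bar> \<le> I ?m" "\<bar>B n ?d\<bar> \<le> I ?d" using f2 m2 d2 by (auto intro!: le)
    then show ?thesis using parB[of n] parI n0[OF n] w(4) unfolding real_norm_def by linarith
  qed
  then show "\<exists>n0. \<forall>n\<ge>n0. norm (mehler_form l (t n) f f
      - (L2_sq f)) < e" unfolding B_def I_def by blast
qed

lemma mehler_kernel_form_tendsto: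
  fixes f h :: "'a::euclidean_space \<Rightarrow> 'b::euclidean_space"
  assumes l: "0 < l" and t: "\<And>n. 0 < t n" "t \<longlonglongrightarrow> 0"
    and f[measurable]: "f \<in> borel_measurable borel" and f2: "L2 f"
    and h[measurable]: "h \<in> borel_measurable borel" and h2: "L2 h"
  shows "(\<lambda>n. mehler_form l (t n) f h)
    \<longlonglongrightarrow> (LBINT x. f x \<bullet> h x)"
proof -
  define B where "B n v u = mehler_form l (t n) v u" for n and v u :: "'a \<Rightarrow> 'b"
  note sq = norm_add_sq_le[where 'a='b]
  have p2: "L2 (\<lambda>x. f x + h x)"
    by (rule lint_bound[of _ "\<lambda>x. 2 * (norm (f x))^2 + 2 * (norm (h x))^2"])
       (use f2 h2 sq[of "f _" "h _"] in auto)
  have int: "integrable lborel (\<lambda>z. mehler_kernel2 l (t n) z * (v (fst z) \<bullet> u (snd z)))"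
    if "v \<in> borel_measurable borel" "L2 v"
      "u \<in> borel_measurable borel" "L2 u" for n and v u :: "'a \<Rightarrow> 'b"
    using mehler_kernel_form_bound(1)[OF l t(1) that, of n] .
  have sym: "B n h f = B n f h" for n
    using lborel_integral_swap[of "\<lambda>z. mehler_kernel2 l (t n) z * (f (fst z) \<bullet> h (snd z))"]
    by (simp add: B_def mehler_kernel_commute[of l "t n" "snd _"] inner_commute)
  have pol: "B n f h = (B n (\<lambda>x. f x + h x) (\<lambda>x. f x + h x) - B n f f - B n h h) / 2" for n
  proof -
    have "B n (\<lambda>x. f x + h x) (\<lambda>x. f x + h x) = (LBINT z. (mehler_kernel2 l (t n) z * (f (fst z) \<bullet> f (snd z))
        + mehler_kernel2 l (t n) z * (h (fst z) \<bullet> h (snd z)))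
        + (mehler_kernel2 l (t n) z * (f (fst z) \<bullet> h (snd z))
        + mehler_kernel2 l (t n) z * (h (fst z) \<bullet> f (snd z))))"
      unfolding B_def by (intro lint_cong refl)
         (simp add: inner_add_left inner_add_right algebra_simps)
    also have "\<dots> = (B n f f + B n h h) + (B n f h + B n h f)"
      unfolding B_def using int f h f2 h2 by simp
    finally show ?thesis unfolding sym by simp
  qed
  have i: "integrable lborel (\<lambda>x. f x \<bullet> h x)"
    by (rule lint_bound[of _ "\<lambda>x. (norm (f x))^2 + (norm (h x))^2"])
       (use f2 h2 in \<open>auto intro!: order_trans[OF Cauchy_Schwarz_ineq2] simp: norm_mult_le_sum_squares\<close>)
  have "(LBINT x. (norm (f x + h x))^2) = (LBINT x. (norm (f x))^2 + (norm (h x))^2 + 2 * (f x \<bullet> h x))"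
    by (intro lint_cong refl)
       (simp add: power2_norm_eq_inner inner_add_left inner_add_right inner_commute)
  then have lim: "(LBINT x. f x \<bullet> h x) = ((LBINT x. (norm (f x + h x))^2)
      - (L2_sq f) - (L2_sq h)) / 2" using f2 h2 i by simp
  have "(\<lambda>n. B n f h) \<longlonglongrightarrow> (LBINT x. f x \<bullet> h x)" unfolding pol lim unfolding B_def
    by (intro tendsto_intros mehler_kernel_form_self_tendsto[OF l t]) (use f2 h2 p2 in auto)
  then show ?thesis by (simp add: B_def)
qed

section \<open>The spectral gap of the harmonic oscillator\<close>

lemma has_real_derivative_integral:
  fixes f f' :: "real \<Rightarrow> 'a \<Rightarrow> real"
  assumes e: "0 < e"
    and int: "\<And>t. \<bar>t - t0\<bar> < e \<Longrightarrow> integrable M (f t)"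
    and der: "\<And>t x. \<bar>t - t0\<bar> < e \<Longrightarrow> ((\<lambda>t. f t x) has_real_derivative f' t x) (at t)"
    and bd: "\<And>t x. \<bar>t - t0\<bar> < e \<Longrightarrow> \<bar>f' t x\<bar> \<le> G x"
    and G: "integrable M G" and meas: "f' t0 \<in> borel_measurable M"
  shows "((\<lambda>t. \<integral>x. f t x \<partial>M) has_real_derivative (\<integral>x. f' t0 x \<partial>M)) (at t0)"
  unfolding DERIV_def tendsto_at_iff_sequentially
proof (intro allI impI)
  fix X :: "nat \<Rightarrow> real" assume X0: "\<forall>i. X i \<in> UNIV - {0}" and X: "X \<longlonglongrightarrow> 0"
  let ?q = "\<lambda>n x. (f (t0 + X n) x - f t0 x) / X n"
  obtain N where N: "\<And>n. n \<ge> N \<Longrightarrow> \<bar>X n\<bar> < e" using LIMSEQ_D[OF X e] by auto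
  have t0: "\<bar>t0 - t0\<bar> < e" using e by simp
  \<comment> \<open>The shift by \<open>N\<close> discards the finitely many increments that leave
    the neighbourhood where integrability and the bound are known.\<close>
  have "(\<lambda>n. \<integral>x. ?q (n + N) x \<partial>M) \<longlonglongrightarrow> (\<integral>x. f' t0 x \<partial>M)"
  proof (rule integral_dominated_convergence[OF meas _ G])
    show "?q (n + N) \<in> borel_measurable M" for n
      using int[OF t0] int[of "t0 + X (n + N)"] N[of "n + N"]
      by (auto intro!: borel_measurable_divide borel_measurable_diff)
    show "AE x in M. (\<lambda>n. ?q (n + N) x) \<longlonglongrightarrow> f' t0 x"
    proof (rule AE_I2)
      fix x
      have "((\<lambda>h. (f (t0 + h) x - f t0 x) / h) \<circ> X) \<longlonglongrightarrow> f' t0 x"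
        using der[OF t0, of x] X0 X unfolding DERIV_def tendsto_at_iff_sequentially by blast
      then show "(\<lambda>n. ?q (n + N) x) \<longlonglongrightarrow> f' t0 x"
        by (intro LIMSEQ_ignore_initial_segment) (simp add: comp_def)
    qed
    show "AE x in M. norm (?q (n + N) x) \<le> G x" for n
    proof (rule AE_I2)
      fix x
      let ?S = "{t0 - e<..<t0 + e}"
      have S: "s \<in> ?S \<longleftrightarrow> \<bar>s - t0\<bar> < e" for s by (simp add: abs_less_iff) linarith
      have d: "((\<lambda>t. f t x) has_real_derivative f' s x) (at s within ?S)" if "s \<in> ?S" for s
        by (rule has_field_derivative_at_within[OF der]) (use that S in blast)
      have b: "norm (f' s x) \<le> G x" if "s \<in> ?S" for s using bd[of s x] that unfolding S by simp
      have m: "t0 + X (n + N) \<in> ?S" "t0 \<in> ?S" unfolding S using N[of "n + N"] e by simp_all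
      have "norm (f (t0 + X (n + N)) x - f t0 x) \<le> G x * norm (t0 + X (n + N) - t0)"
        using field_differentiable_bound[where S="?S" and f="\<lambda>t. f t x" and f'="\<lambda>t. f' t x" and B="G x",
            OF convex_real_interval(8) d b m] by simp
      then show "norm (?q (n + N) x) \<le> G x" using X0 by (simp add: pos_divide_le_eq)
    qed
  qed
  moreover have "(\<integral>x. ?q (n + N) x \<partial>M) = ((\<integral>x. f (t0 + X (n + N)) x \<partial>M) - (\<integral>x. f t0 x \<partial>M)) / X (n + N)" for n
    using int[OF t0] int[of "t0 + X (n + N)"] N[of "n + N"] by simp
  ultimately have "(\<lambda>n. ((\<integral>x. f (t0 + X (n + N)) x \<partial>M) - (\<integral>x. f t0 x \<partial>M)) / X (n + N)) \<longlonglongrightarrow> (\<integral>x. f' t0 x \<partial>M)"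
    by (simp only:)
  then show "((\<lambda>h. ((\<integral>x. f (t0 + h) x \<partial>M) - (\<integral>x. f t0 x \<partial>M)) / h) \<circ> X) \<longlonglongrightarrow> (\<integral>x. f' t0 x \<partial>M)"
    unfolding comp_def by (rule LIMSEQ_offset)
qed

text \<open>The logarithmic derivative of the rate is 2 / (1 + t) - 1 / t = (t - 1) / (t (1 + t)),
  and the power of the square root multiplies it by N / 2.\<close>

lemma sqrt_mehler_rate_power_has_derivative:
  assumes l: "0 < l" and t: "0 < t" and N: "0 < N"
  shows "((\<lambda>t. sqrt (mehler_rate l t) ^ N) has_real_derivative
    real N * (t - 1) / (2 * t * (1 + t)) * sqrt (mehler_rate l t) ^ N) (at t)"
proof -
  have m: "0 < mehler_rate l t" by (rule mehler_rate_pos[OF l t])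
  have d: "(mehler_rate l has_real_derivative mehler_rate l t * ((t - 1) / (t * (1 + t)))) (at t)"
  proof -
    have "((\<lambda>t. l * (1 + t)^2 / (4 * t)) has_real_derivative
      ((l * (2 * (1 + t))) * (4 * t) - l * (1 + t)^2 * 4) / ((4 * t) * (4 * t))) (at t)"
      using t by (auto intro!: derivative_eq_intros)
    moreover have "((l * (2 * (1 + t))) * (4 * t) - l * (1 + t)^2 * 4) / ((4 * t) * (4 * t)) = mehler_rate l t * ((t - 1) / (t * (1 + t)))"
    proof -
      have "((l * (2 * q)) * (4 * t) - l * q^2 * 4) / ((4 * t) * (4 * t)) = l * q^2 / (4 * t) * ((2 * t - q) / (t * q))" if "q \<noteq> 0" for q
        using that t by (simp add: power2_eq_square field_simps)
      from this[of "1 + t"] show ?thesis using t by (simp add: mehler_rate_def)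
    qed
    ultimately show ?thesis unfolding mehler_rate_def[abs_def] by simp
  qed
  have "((\<lambda>t. sqrt (mehler_rate l t)) has_real_derivative (inverse (sqrt (mehler_rate l t)) / 2) * (mehler_rate l t * ((t - 1) / (t * (1 + t))))) (at t)"
    by (rule DERIV_chain2[OF DERIV_real_sqrt[OF m] d])
  moreover have "(inverse (sqrt (mehler_rate l t)) / 2) * (mehler_rate l t * ((t - 1) / (t * (1 + t)))) = sqrt (mehler_rate l t) * ((t - 1) / (2 * t * (1 + t)))"
  proof -
    have "inverse (sqrt (mehler_rate l t)) * mehler_rate l t = sqrt (mehler_rate l t)"
      using m by (simp add: field_simps)
    then have "inverse (sqrt (mehler_rate l t)) * mehler_rate l t * ((t - 1) / (t * (1 + t)) / 2) = sqrt (mehler_rate l t) * ((t - 1) / (t * (1 + t)) / 2)"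
      by simp
    then show ?thesis by (simp add: mult_ac)
  qed
  ultimately have "((\<lambda>t. sqrt (mehler_rate l t)) has_real_derivative sqrt (mehler_rate l t) * ((t - 1) / (2 * t * (1 + t)))) (at t)"
    by simp
  from DERIV_power[OF this, of N]
  have "((\<lambda>t. sqrt (mehler_rate l t) ^ N) has_real_derivative
      real N * (sqrt (mehler_rate l t) * ((t - 1) / (2 * t * (1 + t))) * sqrt (mehler_rate l t) ^ (N - Suc 0))) (at t)"
    by simp
  moreover have "sqrt (mehler_rate l t) ^ N = sqrt (mehler_rate l t) * sqrt (mehler_rate l t) ^ (N - Suc 0)"
    using N by (cases N) auto
  ultimately show ?thesis by (simp add: mult_ac)
qed

context weighted_sobolev
begin

text \<open>The three forms in the gradient and in x u, as well as the derivative of \<phi>, are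
  linear combinations of the moments of 1, |x + y|^2 and |x - y|^2. Identities between them thereby
  become comparisons of three coefficients.\<close>

definition moment :: "real \<Rightarrow> real \<Rightarrow> ('a \<times> 'a \<Rightarrow> real) \<Rightarrow> real" where
  "moment l t q = (LBINT z. q z * (mehler_kernel2 l t z * u2 z))"

lemma moment_integrable:
  assumes l: "0 < l" and t: "0 < t"
  shows "integrable lborel (\<lambda>z. mehler_kernel2 l t z * u2 z)"
    "integrable lborel (\<lambda>z. sum_sq z * (mehler_kernel2 l t z * u2 z))"
    "integrable lborel (\<lambda>z. diff_sq z * (mehler_kernel2 l t z * u2 z))"
proof -
  have d: "gaussian_decay (\<lambda>z::'a \<times> 'a. mehler_kernel2 l t z)"
    unfolding mehler_kernel_def using l t by (intro gaussian_decay_cmult gaussian_decay_mehler) auto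
  show "integrable lborel (\<lambda>z. mehler_kernel2 l t z * u2 z)"
    using u_L2 d by (intro gaussian_decay_pair_integrable) auto
  have "integrable lborel (\<lambda>z. (sum_sq z * mehler_kernel2 l t z) * u2 z)"
    "integrable lborel (\<lambda>z. (diff_sq z * mehler_kernel2 l t z) * u2 z)"
    using u_L2 by (intro gaussian_decay_pair_integrable gaussian_decay_mult_sum_norm d; simp)+
  then show "integrable lborel (\<lambda>z. sum_sq z * (mehler_kernel2 l t z * u2 z))"
    "integrable lborel (\<lambda>z. diff_sq z * (mehler_kernel2 l t z * u2 z))"
    by (simp_all add: mult.assoc)
qed

lemma moment_linear:
  assumes l: "0 < l" and t: "0 < t"
  shows "moment l t (\<lambda>z. c0 + c1 * sum_sq z + c2 * diff_sq z)
    = c0 * moment l t (\<lambda>z. 1) + c1 * moment l t sum_sq + c2 * moment l t diff_sq"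
  unfolding moment_def using moment_integrable[OF l t] by (simp add: distrib_right mult.assoc)

lemma mehler_form_gradient:
  assumes l: "0 < l" and t: "0 < t"
  shows "mehler_form l t g g = - (real DIM('a) / 2) * (l * t - l / t) * moment l t (\<lambda>z. 1)
    + (l * t)^2 / 4 * moment l t sum_sq - (l / t)^2 / 4 * moment l t diff_sq"
proof -
  define W where "W = sqrt (mehler_rate l t) ^ DIM('a) / gauss_const TYPE('a)"
  have "mehler_form l t g g = W * (LBINT z. mehler2 (l * t) (l / t) z * (g (fst z) \<bullet> g (snd z)))"
    unfolding mehler_kernel_def W_def[symmetric] by (simp add: mult.assoc)
  also have "\<dots> = moment l t (\<lambda>z. - (real DIM('a) / 2) * (l * t - l / t) + (l * t)^2 / 4 * sum_sq z + (- ((l / t)^2 / 4)) * diff_sq z)"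
    unfolding mehler_gradient_form[OF mult_pos_pos[OF l t] divide_pos_pos[OF l t]] moment_def mehler_kernel_def W_def[symmetric]
      integral_mult_right_zero[symmetric] by (intro lint_cong refl) (simp add: field_simps)
  also have "\<dots> = - (real DIM('a) / 2) * (l * t - l / t) * moment l t (\<lambda>z. 1)
    + (l * t)^2 / 4 * moment l t sum_sq + (- ((l / t)^2 / 4)) * moment l t diff_sq"
    by (rule moment_linear[OF l t])
  finally show ?thesis by simp
qed

lemma mehler_form_mixed:
  assumes l: "0 < l" and t: "0 < t"
  shows "mehler_form l t g (\<lambda>x. u x *\<^sub>R x) = l * t / 4 * moment l t sum_sq - l / t / 4 * moment l t diff_sq"
proof -
  define W where "W = sqrt (mehler_rate l t) ^ DIM('a) / gauss_const TYPE('a)"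
  have "mehler_form l t g (\<lambda>x. u x *\<^sub>R x) = W * (LBINT z. mehler2 (l * t) (l / t) z * (g (fst z) \<bullet> (u (snd z) *\<^sub>R snd z)))"
    unfolding mehler_kernel_def W_def[symmetric] by (simp add: mult.assoc)
  also have "\<dots> = moment l t (\<lambda>z. 0 + l * t / 4 * sum_sq z + (- (l / t / 4)) * diff_sq z)"
    unfolding mehler_mixed_form[OF mult_pos_pos[OF l t] divide_pos_pos[OF l t]] moment_def mehler_kernel_def W_def[symmetric]
      integral_mult_right_zero[symmetric] by (intro lint_cong refl) (simp add: field_simps)
  also have "\<dots> = 0 * moment l t (\<lambda>z. 1) + l * t / 4 * moment l t sum_sq + (- (l / t / 4)) * moment l t diff_sq"
    by (rule moment_linear[OF l t])
  finally show ?thesis by simp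
qed

lemma mehler_form_position:
  assumes l: "0 < l" and t: "0 < t"
  shows "mehler_form l t (\<lambda>x. u x *\<^sub>R x) (\<lambda>x. u x *\<^sub>R x) = (moment l t sum_sq - moment l t diff_sq) / 4"
proof -
  have "mehler_form l t (\<lambda>x. u x *\<^sub>R x) (\<lambda>x. u x *\<^sub>R x) = moment l t (\<lambda>z. 0 + 1 / 4 * sum_sq z + (- (1 / 4)) * diff_sq z)"
    unfolding moment_def by (intro lint_cong refl)
       (simp add: power2_norm_eq_inner inner_add_left inner_add_right inner_diff_left inner_diff_right inner_commute field_simps)
  also have "\<dots> = 0 * moment l t (\<lambda>z. 1) + 1 / 4 * moment l t sum_sq + (- (1 / 4)) * moment l t diff_sq"
    by (rule moment_linear[OF l t])
  finally show ?thesis by simp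
qed

lemma moment_has_derivative:
  assumes l: "0 < l" and t: "0 < t"
  shows "((\<lambda>t. moment l t (\<lambda>z. 1)) has_real_derivative
    real DIM('a) * (t - 1) / (2 * t * (1 + t)) * moment l t (\<lambda>z. 1)
      - l / 4 * moment l t sum_sq + l / (4 * t^2) * moment l t diff_sq) (at t)"
proof -
  define W where "W t = sqrt (mehler_rate l t) ^ DIM('a) / gauss_const TYPE('a)" for t
  define J where "J t = (LBINT z. mehler2 (l * t) (l / t) z * u2 z)" for t
  define f' where "f' t z = - (l * sum_sq z - l / t^2 * diff_sq z) / 4 * mehler2 (l * t) (l / t) z * u2 z" for t z
  \<comment> \<open>For |s - t| < t / 2 both kernel parameters l s and l / s are at least
    \<open>m\<close>, so a single Gaussian dominates the kernels of all these s.\<close>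
  define m where "m = min (l * t / 2) (l / (2 * t))"
  have m: "0 < m" using l t by (simp add: m_def)
  have M: "moment l s (\<lambda>z. 1) = W s * J s" for s
    unfolding moment_def mehler_kernel_def W_def J_def by (simp add: mult.assoc)
  have W': "(W has_real_derivative real DIM('a) * (t - 1) / (2 * t * (1 + t)) * W t) (at t)"
    using DERIV_cdivide[OF sqrt_mehler_rate_power_has_derivative[OF l t, of "DIM('a)"], of "gauss_const TYPE('a)"]
    unfolding W_def[abs_def] by simp
  have near: "0 < s" "m \<le> l * s" "m \<le> l / s" "1 / s^2 \<le> 4 / t^2" if "\<bar>s - t\<bar> < t / 2" for s
  proof -
    have s: "t / 2 < s" "s < 2 * t" using that by linarith+
    show "0 < s" using s t by simp
    have "l * (t / 2) \<le> l * s" "l / (2 * t) \<le> l / s"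
      using s t l by (auto intro!: mult_left_mono divide_left_mono)
    then show "m \<le> l * s" "m \<le> l / s" by (auto simp: m_def)
    have "(t / 2)^2 \<le> s^2" using s t by (intro power_mono) auto
    then show "1 / s^2 \<le> 4 / t^2" using s t by (simp add: field_simps power2_eq_square)
  qed
  \<comment> \<open>Here 4 / t^2 bounds 1 / s^2 for s > t / 2, the 2 comes from the parallelogram
    identity, and half the minimal parameter is the rate in |z|^2.\<close>
  define G where "G z = (l / 4 * (1 + 4 / t^2) * 2) * (((norm z)^2 * exp (- (m / 2) * (norm z)^2)) * (\<bar>u (fst z)\<bar> * \<bar>u (snd z)\<bar>))" for z :: "'a \<times> 'a"
  have n: "(norm z)^2 = (norm (fst z))^2 + (norm (snd z))^2" for z :: "'a \<times> 'a"
    by (simp add: norm_prod_def)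
  have "(J has_real_derivative (LBINT z. f' t z)) (at t)" unfolding J_def[abs_def]
  proof (rule has_real_derivative_integral[where e="t / 2" and G=G])
    show "integrable lborel (\<lambda>z. mehler2 (l * s) (l / s) z * u2 z)" if "\<bar>s - t\<bar> < t / 2" for s
      using near[OF that] l u_L2 by (intro gaussian_decay_pair_integrable gaussian_decay_mehler) auto
    show "((\<lambda>s. mehler2 (l * s) (l / s) z * u2 z) has_real_derivative f' s z) (at s)"
      if "\<bar>s - t\<bar> < t / 2" for s z
    proof -
      have "((\<lambda>s. - (l * s * sum_sq z + l / s * diff_sq z) / 4) has_real_derivative - (l * sum_sq z - l / s^2 * diff_sq z) / 4) (at s)"
        using near(1)[OF that] by (auto intro!: derivative_eq_intros simp: power2_eq_square field_simps)
      from DERIV_cmult_right[OF DERIV_chain2[OF DERIV_exp this], of "u (fst z) * u (snd z)"]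
      show ?thesis unfolding mehler_def f'_def by (simp add: mult_ac)
    qed
    show "\<bar>f' s z\<bar> \<le> G z" if "\<bar>s - t\<bar> < t / 2" for s z
    proof -
      let ?E = "exp (- (m / 2) * (norm z)^2)"
      have E: "mehler2 (l * s) (l / s) z \<le> ?E"
        using mehler_le[OF near(2,3)[OF that], of "fst z" "snd z"] by (simp add: norm_prod_def)
      have "\<bar>- (l * sum_sq z - l / s^2 * diff_sq z) / 4\<bar> \<le> (l * sum_sq z + l / s^2 * diff_sq z) / 4"
      proof -
        have "0 \<le> l * sum_sq z" "0 \<le> l / s^2 * diff_sq z" using l by auto
        then show ?thesis by (simp add: abs_le_iff)
      qed
      also have "\<dots> = l / 4 * (1 * sum_sq z + 1 / s^2 * diff_sq z)" by (simp add: field_simps)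
      also have "\<dots> \<le> l / 4 * ((1 + 4 / t^2) * sum_sq z + (1 + 4 / t^2) * diff_sq z)"
        using near(4)[OF that] l by (intro mult_left_mono add_mono mult_right_mono) auto
      also have "\<dots> = (l / 4 * (1 + 4 / t^2)) * ((norm z)^2 * 2)"
        unfolding distrib_left[symmetric] norm_sum_diff_sq n by (simp only: mult_ac)
      finally have c: "\<bar>- (l * sum_sq z - l / s^2 * diff_sq z) / 4\<bar> \<le> (l / 4 * (1 + 4 / t^2)) * ((norm z)^2 * 2)" .
      have "\<bar>f' s z\<bar> = \<bar>- (l * sum_sq z - l / s^2 * diff_sq z) / 4\<bar> * mehler2 (l * s) (l / s) z * (\<bar>u (fst z)\<bar> * \<bar>u (snd z)\<bar>)"
        unfolding f'_def abs_mult using mehler_pos[of "l * s" "l / s" "fst z" "snd z"] by simp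
      also have "\<dots> \<le> (l / 4 * (1 + 4 / t^2)) * ((norm z)^2 * 2) * ?E * (\<bar>u (fst z)\<bar> * \<bar>u (snd z)\<bar>)"
        using l mehler_pos[of "l * s" "l / s" "fst z" "snd z"]
        by (intro mult_right_mono mult_mono c E) auto
      finally show ?thesis by (simp only: G_def mult_ac)
    qed
    show "integrable lborel G"
    proof -
      have "gaussian_decay (\<lambda>z::'a \<times> 'a. (norm z)^2 * exp (- (m / 2) * (norm z)^2))"
        using m by (intro gaussian_decay_mult_norm_sq gaussian_decay_exp) simp
      then have "integrable lborel (\<lambda>z. ((norm z)^2 * exp (- (m / 2) * (norm z)^2)) * (\<bar>u (fst z)\<bar> * \<bar>u (snd z)\<bar>))"
        using u_L2 by (intro gaussian_decay_pair_integrable) auto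
      then show ?thesis unfolding G_def[abs_def] by (rule integrable_mult_right)
    qed
    show "f' t \<in> borel_measurable lborel" unfolding f'_def[abs_def] by measurable
  qed (use t in simp)
  from DERIV_mult[OF W' this]
  have D: "((\<lambda>t. moment l t (\<lambda>z. 1)) has_real_derivative
      real DIM('a) * (t - 1) / (2 * t * (1 + t)) * W t * J t + (LBINT z. f' t z) * W t) (at t)"
    unfolding M .
  have "(LBINT z. f' t z) * W t = moment l t (\<lambda>z. 0 + (- (l / 4)) * sum_sq z + l / (4 * t^2) * diff_sq z)"
    unfolding moment_def integral_mult_left_zero[symmetric] f'_def mehler_kernel_def W_def
    by (intro lint_cong refl) (simp add: field_simps)
  also have "\<dots> = 0 * moment l t (\<lambda>z. 1) + (- (l / 4)) * moment l t sum_sq + l / (4 * t^2) * moment l t diff_sq"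
    by (rule moment_linear[OF l t])
  finally have "(LBINT z. f' t z) * W t
      = - (l / 4) * moment l t sum_sq + l / (4 * t^2) * moment l t diff_sq" by simp
  then show ?thesis by (intro DERIV_cong[OF D]) (simp add: M)
qed

lemma g_inner_xu_integrable: "integrable lborel (\<lambda>x. g x \<bullet> (u x *\<^sub>R x))"
  by (rule lint_bound[of _ "\<lambda>x. (norm (g x))^2 + (norm (u x *\<^sub>R x))^2"])
     (use g_L2 xu_L2 order_trans[OF Cauchy_Schwarz_ineq2 norm_mult_le_sum_squares, of "g _" "u _ *\<^sub>R _"] in \<open>auto simp del: norm_scaleR\<close>)

text \<open>The squared norm of \<open>?D\<close> is X + 2 l V + l^2 Y with a cross term V. The
  limit t -> 0 is therefore used twice: for \<phi>, which tends to Z, and for the mixed form, which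
  tends to V.\<close>

lemma spectral_gap:
  assumes l: "0 < l"
  shows "real DIM('a) * l * (LBINT x. (u x)^2)
    + 2 * l * ((LBINT x. (u x)^2)
        - (LBINT x. u x * exp (- l / 2 * (norm x)^2))^2 * (sqrt l ^ DIM('a) / gauss_const TYPE('a)))
    \<le> (L2_sq g) + l^2 * (LBINT x. (norm (u x *\<^sub>R x))^2)"
proof -
  let ?N = "real DIM('a)"
  define \<phi> where "\<phi> t = moment l t (\<lambda>z. 1)" for t
  define \<phi>' where "\<phi>' t = ?N * (t - 1) / (2 * t * (1 + t)) * moment l t (\<lambda>z. 1)
      - l / 4 * moment l t sum_sq + l / (4 * t^2) * moment l t diff_sq" for t
  have d\<phi>: "(\<phi> has_real_derivative \<phi>' t) (at t)" if "0 < t" for t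
    unfolding \<phi>_def[abs_def] \<phi>'_def by (rule moment_has_derivative[OF l that])
  define Z where "Z = (LBINT x. (u x)^2)"
  define X where "X = (L2_sq g)"
  define Y where "Y = (LBINT x. (norm (u x *\<^sub>R x))^2)"
  define V where "V = (LBINT x. g x \<bullet> (u x *\<^sub>R x))"
  let ?h = "\<lambda>x. u x *\<^sub>R x"
  let ?D = "\<lambda>x. g x + l *\<^sub>R ?h x"
  define M where "M = (L2_sq ?D)"
  have h[measurable]: "?h \<in> borel_measurable borel" by measurable
  have Dm[measurable]: "?D \<in> borel_measurable borel" by measurable
  have Dsq: "(norm (?D x))^2 = (norm (g x))^2 + (2 * l) * (g x \<bullet> ?h x) + l^2 * (norm (?h x))^2" for x
    unfolding power2_norm_eq_inner by (simp add: inner_add_left inner_add_right inner_commute power2_eq_square algebra_simps)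
  have D2: "L2 (\<lambda>x. ?D x)" unfolding Dsq using g_L2 xu_L2 g_inner_xu_integrable
    by (intro Bochner_Integration.integrable_add integrable_mult_right)
  have M: "M = X + 2 * l * V + l^2 * Y"
    unfolding M_def Dsq X_def Y_def V_def using g_L2 xu_L2 g_inner_xu_integrable
    by (simp del: inner_scaleR_right norm_scaleR)
  have eD: "mehler_form l t ?D ?D = mehler_form l t g g + 2 * l * mehler_form l t g ?h + l^2 * mehler_form l t ?h ?h" if t: "0 < t" for t
  proof -
    note int = mehler_kernel_form_bound(1)[OF l t]
    have sym: "mehler_form l t ?h g = mehler_form l t g ?h"
      using lborel_integral_swap[of "\<lambda>z. mehler_kernel2 l t z * (g (fst z) \<bullet> ?h (snd z))"]
      by (simp add: mehler_kernel_commute[of l t "snd _"] inner_commute)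
    have "mehler_form l t ?D ?D = (LBINT z. mehler_kernel2 l t z * (g (fst z) \<bullet> g (snd z))
        + l * (mehler_kernel2 l t z * (g (fst z) \<bullet> ?h (snd z)))
        + l * (mehler_kernel2 l t z * (?h (fst z) \<bullet> g (snd z)))
        + l^2 * (mehler_kernel2 l t z * (?h (fst z) \<bullet> ?h (snd z))))" by (intro lint_cong refl)
         (simp add: inner_add_left inner_add_right power2_eq_square algebra_simps)
    also have "\<dots> = mehler_form l t g g + l * mehler_form l t g ?h + l * mehler_form l t ?h g + l^2 * mehler_form l t ?h ?h"
            using int[OF g_measurable g_L2 g_measurable g_L2] int[OF g_measurable g_L2 h xu_L2]
        int[OF h xu_L2 g_measurable g_L2] int[OF h xu_L2 h xu_L2]
      by (simp del: inner_scaleR_right inner_scaleR_left)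
    finally show ?thesis unfolding sym by simp
  qed
  \<comment> \<open>Coefficients of the three moments are compared. Those of |x + y|^2 are t^2 + 2 t
    + 1 and those of |x - y|^2 are - (1 / t^2 + 2 / t + 1), each times l^2 / 4: the weight l in D is
    what makes them the perfect squares that also occur on the left.\<close>
  have \<phi>'_eq: "- (l * (1 + t)^2 * \<phi>' t) = mehler_form l t ?D ?D" if t: "0 < t" for t
  proof -
    have "(1 + t)^2 * ((t - 1) / (2 * t * (1 + t))) = (t^2 - 1) / (2 * t)"
    proof -
      have "q^2 * (p / (2 * t * q)) = p * q / (2 * t)" if "q \<noteq> 0" for p q
        using that t by (simp add: power2_eq_square)
      from this[of "1 + t" "t - 1"] t have "(1 + t)^2 * ((t - 1) / (2 * t * (1 + t))) = (t - 1) * (1 + t) / (2 * t)"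
        by simp
      also have "(t - 1) * (1 + t) = t^2 - 1" by (simp add: power2_eq_square algebra_simps)
      finally show ?thesis .
    qed
    moreover have "- (l * q * (?N * k * A - l / 4 * P + l / (4 * t^2) * Q))
        = - (l * ?N * (q * k) * A) + l^2 * q / 4 * P - l^2 * q / (4 * t^2) * Q" for q k A P Q
      using t by (simp add: field_simps power2_eq_square)
    from this[of "(1 + t)^2" "(t - 1) / (2 * t * (1 + t))"]
    have "- (l * (1 + t)^2 * (?N * (t - 1) / (2 * t * (1 + t)) * A - l / 4 * P + l / (4 * t^2) * Q))
        = - (l * ?N * ((1 + t)^2 * ((t - 1) / (2 * t * (1 + t)))) * A) + l^2 * (1 + t)^2 / 4 * P - l^2 * (1 + t)^2 / (4 * t^2) * Q" for A P Q
      by (simp only: times_divide_eq_right)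
    ultimately have e: "- (l * (1 + t)^2 * (?N * (t - 1) / (2 * t * (1 + t)) * A - l / 4 * P + l / (4 * t^2) * Q))
        = - (l * ?N * ((t^2 - 1) / (2 * t)) * A) + l^2 * (1 + t)^2 / 4 * P - l^2 * (1 + t)^2 / (4 * t^2) * Q" for A P Q
      by (simp only:)
    show ?thesis
      unfolding eD[OF t] mehler_form_gradient[OF l t] mehler_form_mixed[OF l t] mehler_form_position[OF l t] \<phi>'_def e
      using t by (simp add: field_simps power2_eq_square)
  qed
  \<comment> \<open>Eliminating the quadratic moments in favour of \<phi> and its derivative gives
    an expression whose limit at 0 is known, since t \<phi>'(t) tends to 0.\<close>
  have mixed: "mehler_form l t g ?h = - t * \<phi>' t - ?N / 2 * mehler_contraction t * \<phi> t" if t: "0 < t" for t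
  proof -
    have "t * (?N * (t - 1) / (2 * t * (1 + t)) * A) = - (?N / 2 * mehler_contraction t * A)" for A
    proof -
      have "t * (?N * (t - 1) / (2 * t * q) * A) = - (?N / 2 * ((1 - t) / q) * A)" if "q \<noteq> 0" for q
        using that t by (simp add: field_simps)
      from this[of "1 + t"] show ?thesis using t by (simp add: mehler_contraction_def)
    qed
    then have "t * \<phi>' t = - (?N / 2 * mehler_contraction t * \<phi> t) - t * (l / 4 * moment l t sum_sq) + t * (l / (4 * t^2) * moment l t diff_sq)"
      unfolding \<phi>'_def \<phi>_def by (simp only: distrib_left right_diff_distrib)
    then have "- t * \<phi>' t = ?N / 2 * mehler_contraction t * \<phi> t + t * (l / 4 * moment l t sum_sq) - t * (l / (4 * t^2) * moment l t diff_sq)"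
      by simp
    then show ?thesis
      unfolding mehler_form_mixed[OF l t] using t by (simp add: power2_eq_square field_simps)
  qed
  have bound: "\<bar>mehler_form l t ?D ?D\<bar> \<le> M" if t: "0 < t" for t
    using mehler_kernel_form_bound(2)[OF l t Dm D2 Dm D2] unfolding M_def by simp
  have M0: "0 \<le> M" by (simp add: M_def)
  have \<phi>'_bound: "\<bar>\<phi>' t\<bar> \<le> M / l / (1 + t)^2" if t: "0 < t" for t
  proof -
    have "l * (1 + t)^2 * \<bar>\<phi>' t\<bar> = \<bar>mehler_form l t ?D ?D\<bar>"
      unfolding \<phi>'_eq[OF t, symmetric] using l by (simp add: abs_mult)
    then show ?thesis using bound[OF t] l t by (simp add: field_simps)
  qed
  \<comment> \<open>The bound on the derivative has - (M / l) / (1 + t) as antiderivative;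
    monotonicity of the sum of that antiderivative and \<phi> replaces integration of
    \<phi>'.\<close>
  have le1: "\<phi> t \<le> \<phi> 1 + M / l * (1 / (1 + t) - 1 / 2)" if t: "0 < t" "t \<le> 1" for t
  proof -
    have "\<phi> t - M / l * (1 / (1 + t)) \<le> \<phi> 1 - M / l * (1 / (1 + 1))"
    proof (rule DERIV_nonneg_imp_nondecreasing[OF t(2)])
      fix s assume s: "t \<le> s" "s \<le> 1"
      then have s0: "0 < s" using t by simp
      have "((\<lambda>s. \<phi> s - M / l * (1 / (1 + s))) has_real_derivative \<phi>' s + M / l / (1 + s)^2) (at s)"
        using s0 l by (auto intro!: derivative_eq_intros d\<phi> simp: power2_eq_square)
      moreover have "0 \<le> \<phi>' s + M / l / (1 + s)^2" using \<phi>'_bound[OF s0] by linarith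
      ultimately show "\<exists>y. ((\<lambda>s. \<phi> s - M / l * (1 / (1 + s))) has_real_derivative y) (at s) \<and> 0 \<le> y"
        by blast
    qed
    then show ?thesis by (simp add: right_diff_distrib)
  qed
  define t where "t n = inverse (real (Suc n))" for n
  have t: "0 < t n" "t n \<le> 1" for n by (auto simp: t_def field_simps)
  have t0: "t \<longlonglongrightarrow> 0" unfolding t_def[abs_def] by (rule LIMSEQ_inverse_real_of_nat)
  have \<phi>lim: "(\<lambda>n. \<phi> (t n)) \<longlonglongrightarrow> Z"
    using mehler_kernel_form_tendsto[OF l t(1) t0 u_measurable _ u_measurable] u_L2
    by (simp add: \<phi>_def moment_def Z_def power2_eq_square)
  \<comment> \<open>At t = 0 the bracket equals 1 / 2, so the loss is M / (2 l).\<close>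
  have "Z \<le> \<phi> 1 + M / l * (1 / (1 + 0) - 1 / 2)"
  proof (rule LIMSEQ_le[OF \<phi>lim])
    show "(\<lambda>n. \<phi> 1 + M / l * (1 / (1 + t n) - 1 / 2)) \<longlonglongrightarrow> \<phi> 1 + M / l * (1 / (1 + 0) - 1 / 2)"
      by (intro tendsto_intros t0) simp
    show "\<exists>N. \<forall>n\<ge>N. \<phi> (t n) \<le> \<phi> 1 + M / l * (1 / (1 + t n) - 1 / 2)" using le1 t by blast
  qed
  then have main: "2 * l * Z \<le> 2 * l * \<phi> 1 + M" using l by (simp add: field_simps)
  \<comment> \<open>This is the integral of u x . grad u. The mixed form tends both to V, by the
    approximate identity, and to - N Z / 2, by its expression through \<phi>.\<close>
  have V: "V = - ?N / 2 * Z"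
  proof (rule LIMSEQ_unique)
    show "(\<lambda>n. mehler_form l (t n) g ?h) \<longlonglongrightarrow> V" unfolding V_def
      by (rule mehler_kernel_form_tendsto[OF l t(1) t0 g_measurable g_L2 h xu_L2])
    have "(\<lambda>n. t n * \<phi>' (t n)) \<longlonglongrightarrow> 0"
    proof (rule Lim_null_comparison)
      have "\<bar>t n * \<phi>' (t n)\<bar> \<le> t n * (M / l / 1)" for n
      proof -
        have "M / l / (1 + t n)^2 \<le> M / l / 1"
          using M0 l t[of n] by (intro divide_left_mono) (auto intro!: one_le_power simp: zero_less_mult_iff)
        then have "\<bar>\<phi>' (t n)\<bar> \<le> M / l / 1" using \<phi>'_bound[OF t(1), of n] by linarith
        from mult_left_mono[OF this less_imp_le[OF t(1)[of n]]] show ?thesis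
          by (simp only: abs_mult abs_of_pos[OF t(1)])
      qed
      then show "\<forall>\<^sub>F n in sequentially. norm (t n * \<phi>' (t n)) \<le> t n * (M / l / 1)"
        by (intro always_eventually) simp
      show "(\<lambda>n. t n * (M / l / 1)) \<longlonglongrightarrow> 0" by (rule tendsto_mult_left_zero[OF t0])
    qed
    moreover have "(\<lambda>n. mehler_contraction (t n)) \<longlonglongrightarrow> (1 - 0) / (1 + 0)"
      unfolding mehler_contraction_def by (intro tendsto_intros t0) simp
    ultimately have "(\<lambda>n. - (t n * \<phi>' (t n)) - ?N / 2 * mehler_contraction (t n) * \<phi> (t n)) \<longlonglongrightarrow> - 0 - ?N / 2 * ((1 - 0) / (1 + 0)) * Z"
      by (intro tendsto_intros \<phi>lim)
    then show "(\<lambda>n. mehler_form l (t n) g ?h) \<longlonglongrightarrow> - ?N / 2 * Z" unfolding mixed[OF t(1)] by simp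
  qed
  \<comment> \<open>At t = 1 both kernel parameters equal l, the exponent loses its x . y term, and
    the kernel becomes a product of the two Gaussians: the projection onto
    \<open>?G\<close>.\<close>
  have \<phi>1: "\<phi> 1 = (LBINT x. u x * exp (- l / 2 * (norm x)^2))^2 * (sqrt l ^ DIM('a) / gauss_const TYPE('a))"
  proof -
    define w where "w = sqrt l ^ DIM('a) / gauss_const TYPE('a)"
    let ?G = "\<lambda>x::'a. exp (- l / 2 * (norm x)^2)"
    have "mehler_rate l 1 = l" by (simp add: mehler_rate_def)
    moreover have "mehler (l * 1) (l / 1) x y = ?G x * ?G y" for x y :: 'a
    proof -
      have "- (l * (norm (x + y))^2 + l * (norm (x - y))^2) / 4 = - l / 2 * (norm x)^2 + - l / 2 * (norm y)^2"
        unfolding distrib_left[symmetric] norm_sum_diff_sq by (simp add: field_simps)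
      then show ?thesis unfolding mehler_def by (simp only: exp_add mult_1_right div_by_1)
    qed
    ultimately have K: "mehler_kernel l 1 x y = w * (?G x * ?G y)" for x y :: 'a
      unfolding mehler_kernel_def w_def by simp
    define I where "I = (LBINT x. u x * ?G x)"
    have inner: "(LBINT y. mehler_kernel l 1 x y * (u x * u y)) = (w * I) * (u x * ?G x)" for x
    proof -
      have "(LBINT y. mehler_kernel l 1 x y * (u x * u y)) = (LBINT y. (w * (u x * ?G x)) * (u y * ?G y))"
        unfolding K by (intro lint_cong refl) (simp add: mult_ac)
      also have "\<dots> = (w * (u x * ?G x)) * I" by (simp only: I_def integral_mult_right_zero)
      finally show ?thesis by (simp add: mult_ac)
    qed
    have i: "integrable (lborel \<Otimes>\<^sub>M lborel) (\<lambda>(x, y). mehler_kernel l 1 x y * (u x * u y))"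
      using moment_integrable(1)[OF l, of 1] by (simp add: lborel_prod case_prod_beta')
    have "\<phi> 1 = (LBINT x. (LBINT y. mehler_kernel l 1 x y * (u x * u y)))"
      unfolding \<phi>_def moment_def using lborel_pair.integral_fst[OF i] by (simp add: lborel_prod case_prod_beta')
    also have "\<dots> = (LBINT x. (w * I) * (u x * ?G x))" unfolding inner ..
    also have "\<dots> = (w * I) * I" by (simp only: I_def integral_mult_right_zero)
    finally show ?thesis by (simp add: w_def I_def power2_eq_square)
  qed
  show ?thesis
    using main unfolding M V \<phi>1[symmetric] Z_def[symmetric] X_def[symmetric] Y_def[symmetric]
    by (simp add: algebra_simps)
qed

end

section \<open>The stability inequalities and their extremal functions\<close>

lemma completion_ex_borel_measurable_euclidean:
  fixes f :: "'a \<Rightarrow> 'b::euclidean_space"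
  assumes "f \<in> borel_measurable (completion M)"
  obtains f' where "f' \<in> borel_measurable M" "AE x in M. f x = f' x"
proof -
  have "\<exists>h\<in>borel_measurable M. AE x in M. f x \<bullet> i = h x" for i
    by (rule completion_ex_borel_measurable_real) (use assms in measurable)
  then obtain h where h: "\<And>i. h i \<in> borel_measurable M" "\<And>i. AE x in M. f x \<bullet> i = h i x" by metis
  have "AE x in M. \<forall>i\<in>Basis. f x \<bullet> i = h i x"
    using h(2) by (simp add: AE_ball_countable countable_finite)
  then have "AE x in M. f x = (\<Sum>i\<in>Basis. h i x *\<^sub>R i)"
  proof eventually_elim
    case (elim x)
    then show ?case by (subst euclidean_representation[symmetric]) simp
  qed
  moreover have "(\<lambda>x. \<Sum>i\<in>Basis. h i x *\<^sub>R i) \<in> borel_measurable M" using h(1) by measurable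
  ultimately show ?thesis using that by blast
qed

lemma lebesgue_integral_borel_version:
  fixes f f' :: "'a::euclidean_space \<Rightarrow> real"
  assumes f: "f \<in> borel_measurable lebesgue" and f': "f' \<in> borel_measurable borel"
    and ae: "AE x in lebesgue. f x = f' x"
  shows "(LINT x|lebesgue. f x) = (LBINT x. f' x)"
    "integrable lebesgue f \<longleftrightarrow> integrable lborel f'"
proof -
  have m: "f' \<in> borel_measurable lborel" "f' \<in> borel_measurable lebesgue"
    using f' by (auto intro: measurable_completion)
  show "(LINT x|lebesgue. f x) = (LBINT x. f' x)"
    using integral_cong_AE[OF f m(2) ae] integral_completion[OF m(1)] by simp
  show "integrable lebesgue f \<longleftrightarrow> integrable lborel f'"
    using integrable_cong_AE[OF f m(2) ae] integrable_completion[OF m(1)] by simp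
qed

lemma locally_integrable_measurable:
  fixes f :: "'a::euclidean_space \<Rightarrow> 'b::euclidean_space"
  assumes "locally_integrable f"
  shows "f \<in> borel_measurable lebesgue"
proof (rule borel_measurable_LIMSEQ_metric)
  show "(\<lambda>x. indicator (cball 0 (real n)) x *\<^sub>R f x) \<in> borel_measurable lebesgue" for n
    using assms by (intro borel_measurable_integrable) (simp add: locally_integrable_def set_integrable_def)
  fix x :: 'a
  obtain n where n: "norm x \<le> real n" using real_arch_simple by blast
  have "\<forall>\<^sub>F k in sequentially. f x = indicator (cball 0 (real k)) x *\<^sub>R f x"
    using n by (intro eventually_sequentiallyI[of n]) (auto simp: indicator_def)
  then show "(\<lambda>k. indicator (cball 0 (real k)) x *\<^sub>R f x) \<longlonglongrightarrow> f x"
    by (rule Lim_transform_eventually[OF tendsto_const])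
qed

lemma weak_gradient_AE:
  assumes "is_weak_gradient u g"
  shows "AE x in lebesgue. weak_gradient u x = g x" and "weak_gradient u \<in> borel_measurable lebesgue"
proof -
  have w: "is_weak_gradient u (weak_gradient u)"
    unfolding weak_gradient_def using someI[of "is_weak_gradient u" g] assms by simp
  show "AE x in lebesgue. weak_gradient u x = g x" using weak_gradient_unique[OF w assms] .
  show "weak_gradient u \<in> borel_measurable lebesgue"
    using w by (simp add: is_weak_gradient_def locally_integrable_measurable)
qed

text \<open>Changing \<open>u\<close> and a weak gradient on null sets alters none of the integrals
  in \<open>delta2\<close>. Uniqueness of weak gradients identifies the one chosen by
  \<open>SOME\<close> with \<open>g'\<close> almost everywhere.\<close>

lemma W12_weighted_borel_version:
  fixes u :: "'a::euclidean_space \<Rightarrow> real"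
  assumes "u \<in> W12_weighted"
  obtains u' g' where "weighted_sobolev u' g'" "AE x in lebesgue. u x = u' x"
    "(LINT x|lebesgue. (norm (weak_gradient u x))^2) = (L2_sq g')"
    "(LINT x|lebesgue. (norm x)^2 * (u x)^2) = (LBINT x. (norm (u' x *\<^sub>R x))^2)"
    "(LINT x|lebesgue. (u x)^2) = (LBINT x. (u' x)^2)"
proof -
  from assms obtain g where u: "square_integrable u" and g: "is_weak_gradient u g" "square_integrable g"
    and xu: "square_integrable (\<lambda>x. u x *\<^sub>R x)" by (auto simp: W12_weighted_def W12_def)
  have um[measurable]: "u \<in> borel_measurable lebesgue" and gm[measurable]: "g \<in> borel_measurable lebesgue"
    and xum: "(\<lambda>x. u x *\<^sub>R x) \<in> borel_measurable lebesgue"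
    using u g xu by (auto simp: square_integrable_def)
  obtain u' where u'[measurable]: "u' \<in> borel_measurable borel" and uu': "AE x in lborel. u x = u' x"
    using completion_ex_borel_measurable_euclidean[OF um] by auto
  obtain g' where g'[measurable]: "g' \<in> borel_measurable borel" and gg': "AE x in lborel. g x = g' x"
    using completion_ex_borel_measurable_euclidean[OF gm] by auto
  note ae = uu'[THEN AE_completion] gg'[THEN AE_completion]
  have aesq: "AE x in lebesgue. (u x)^2 = (u' x)^2" "AE x in lebesgue. (norm (g x))^2 = (norm (g' x))^2"
    using ae by (auto elim: AE_mp)
  have Z: "(LINT x|lebesgue. (u x)^2) = (LBINT x. (u' x)^2)" "square_int u'"
    using lebesgue_integral_borel_version[OF _ _ aesq(1)] u by (auto simp: square_integrable_def)
  have X: "(LINT x|lebesgue. (norm (weak_gradient u x))^2) = (L2_sq g')"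
  proof (rule lebesgue_integral_borel_version)
    show "(\<lambda>x. (norm (weak_gradient u x))^2) \<in> borel_measurable lebesgue"
      using weak_gradient_AE(2)[OF g(1)] by measurable
    show "AE x in lebesgue. (norm (weak_gradient u x))^2 = (norm (g' x))^2"
      using weak_gradient_AE(1)[OF g(1)] ae(2) by eventually_elim simp
  qed measurable
  have X2: "L2 g'" using lebesgue_integral_borel_version(2)[OF _ _ aesq(2)] g(2)
    by (auto simp: square_integrable_def)
  have aex: "AE x in lebesgue. (norm (u x *\<^sub>R x))^2 = (norm (u' x *\<^sub>R x))^2"
    using ae(1) by eventually_elim simp
  have xum2: "(\<lambda>x. (norm (u x *\<^sub>R x))^2) \<in> borel_measurable lebesgue" using xum by measurable
  have Y2: "L2 (\<lambda>x. u' x *\<^sub>R x)"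
    using lebesgue_integral_borel_version(2)[OF xum2 _ aex] xu by (auto simp: square_integrable_def)
  have Y: "(LINT x|lebesgue. (norm x)^2 * (u x)^2) = (LBINT x. (norm (u' x *\<^sub>R x))^2)"
  proof -
    have "(norm x)^2 * (u x)^2 = (norm (u x *\<^sub>R x))^2" for x
      by (simp add: power_mult_distrib mult.commute)
    then show ?thesis using lebesgue_integral_borel_version(1)[OF xum2 _ aex] by simp
  qed
  have "weighted_sobolev u' g'"
  proof unfold_locales
    fix F :: "'a \<Rightarrow> real" and i :: 'a
    assume i: "i \<in> Basis" and F: "smooth F" "gaussian_decay F"
      and dF: "gaussian_decay (\<lambda>x. partial i F x)"
    let ?D = "\<lambda>x. partial i F x"
    have Fm[measurable]: "F \<in> borel_measurable borel" "?D \<in> borel_measurable borel"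
      using F(1) smooth_derivative[OF F(1) i] by (auto intro: smooth_borel_measurable)
    have FL: "F \<in> borel_measurable lebesgue" "?D \<in> borel_measurable lebesgue"
      using Fm by (auto intro: measurable_completion)
    note gi = component_L2[OF g' X2 i]
    have 1: "(LINT x|lebesgue. u x * F x) = (LBINT x. u' x * F x)"
        "integrable lebesgue (\<lambda>x. u x * F x) \<longleftrightarrow> integrable lborel (\<lambda>x. u' x * F x)"
      by (rule lebesgue_integral_borel_version; use FL ae(1) in auto)+
    have 2: "(LINT x|lebesgue. u x * ?D x) = (LBINT x. u' x * ?D x)"
        "integrable lebesgue (\<lambda>x. u x * ?D x) \<longleftrightarrow> integrable lborel (\<lambda>x. u' x * ?D x)"
      by (rule lebesgue_integral_borel_version; use FL ae(1) in auto)+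
    have 3: "(LINT x|lebesgue. (g x \<bullet> i) * F x) = (LBINT x. (g' x \<bullet> i) * F x)"
        "integrable lebesgue (\<lambda>x. (g x \<bullet> i) * F x) \<longleftrightarrow> integrable lborel (\<lambda>x. (g' x \<bullet> i) * F x)"
      by (rule lebesgue_integral_borel_version; use FL ae(2) in auto)+
    have "integrable lborel (\<lambda>x. u' x * F x)" "integrable lborel (\<lambda>x. u' x * ?D x)"
        "integrable lborel (\<lambda>x. (g' x \<bullet> i) * F x)"
      using F(2) dF Z(2) gi by (auto intro!: gaussian_decay_mult_L2_integrable)
    then show "(LBINT x. u' x * ?D x) = - (LBINT x. (g' x \<bullet> i) * F x)"
      using weak_gradient_smooth[OF g(1) F(1) i] 1 2 3 by simp
  qed (use Z(2) X2 Y2 in auto)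
  then show ?thesis using that ae(1) X Y Z(1) by blast
qed

section \<open>Distances to Gaussians and the two inequalities\<close>

lemma integral_exp_minus_norm_sq:
  "s > 0 \<Longrightarrow> (LBINT x. exp (- s * (norm (x::'a::euclidean_space))^2)) = gauss_const TYPE('a) / sqrt s ^ DIM('a)"
  using integral_gauss_shift(1)[of s "0::'a"] by simp

abbreviation "gauss_dist u c \<alpha> \<equiv> L2norm (\<lambda>x. u x - gaussian c \<alpha> x)"

lemma L2norm_diff_gaussian:
  fixes u :: "'a::euclidean_space \<Rightarrow> real"
  assumes u: "square_integrable u" and \<alpha>: "0 < \<alpha>"
  shows "(gauss_dist u c \<alpha>)^2 = (LINT x|lebesgue. (u x)^2)
    - 2 * c * (LINT x|lebesgue. u x * exp (- \<alpha> * (norm x)^2)) + c^2 * (gauss_const TYPE('a) / sqrt (2 * \<alpha>) ^ DIM('a))"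
    and "(L2norm (gaussian c \<alpha> :: 'a \<Rightarrow> real))^2 = c^2 * (gauss_const TYPE('a) / sqrt (2 * \<alpha>) ^ DIM('a))"
proof -
  let ?G = "\<lambda>x::'a. exp (- \<alpha> * (norm x)^2)"
  have um: "u \<in> borel_measurable lebesgue" and u2: "integrable lebesgue (\<lambda>x. (u x)^2)"
    using u by (auto simp: square_integrable_def)
  have Gm: "?G \<in> borel_measurable lebesgue" by (rule measurable_completion) measurable
  have GG: "(?G x)^2 = exp (- (2 * \<alpha>) * (norm x)^2)" for x
    by (simp add: power2_eq_square flip: exp_add)
  have G2: "integrable lebesgue (\<lambda>x. (?G x)^2)" "(LINT x|lebesgue. (?G x)^2) = gauss_const TYPE('a) / sqrt (2 * \<alpha>) ^ DIM('a)"
  proof -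
    have m: "(\<lambda>x::'a. exp (- (2 * \<alpha>) * (norm x)^2)) \<in> borel_measurable lborel" by measurable
    show "integrable lebesgue (\<lambda>x. (?G x)^2)"
      unfolding GG integrable_completion[OF m] using \<alpha> by (intro integrable_exp_minus_norm_sq) simp
    show "(LINT x|lebesgue. (?G x)^2) = gauss_const TYPE('a) / sqrt (2 * \<alpha>) ^ DIM('a)"
      unfolding GG integral_completion[OF m] using \<alpha> by (intro integral_exp_minus_norm_sq) simp
  qed
  have uG: "integrable lebesgue (\<lambda>x. u x * ?G x)" by (rule integrable_mult_L2[OF um Gm u2 G2(1)])
  have "(gauss_dist u c \<alpha>)^2 = (LINT x|lebesgue. (u x - c * ?G x)^2)"
    by (simp add: L2norm_def gaussian_def)
  also have "\<dots> = (LINT x|lebesgue. (u x)^2 - 2 * c * (u x * ?G x) + c^2 * (?G x)^2)"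
    by (intro lint_cong refl) (simp add: power2_eq_square algebra_simps)
  also have "\<dots> = (LINT x|lebesgue. (u x)^2) - 2 * c * (LINT x|lebesgue. u x * ?G x) + c^2 * (LINT x|lebesgue. (?G x)^2)"
    using u2 uG G2(1) by simp
  finally show "(gauss_dist u c \<alpha>)^2 = (LINT x|lebesgue. (u x)^2)
    - 2 * c * (LINT x|lebesgue. u x * exp (- \<alpha> * (norm x)^2)) + c^2 * (gauss_const TYPE('a) / sqrt (2 * \<alpha>) ^ DIM('a))"
    unfolding G2(2) .
  have "(L2norm (gaussian c \<alpha> :: 'a \<Rightarrow> real))^2 = (LINT x|lebesgue. c^2 * (?G x)^2)"
    by (simp add: L2norm_def gaussian_def power_mult_distrib)
  then show "(L2norm (gaussian c \<alpha> :: 'a \<Rightarrow> real))^2 = c^2 * (gauss_const TYPE('a) / sqrt (2 * \<alpha>) ^ DIM('a))"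
    using G2(2) by simp
qed

lemma L2norm_nonneg: "0 \<le> L2norm f" by (simp add: L2norm_def)

text \<open>\<open>R\<close> is the squared distance from \<open>u\<close> to the line of one
  Gaussian. For \<open>d1\<close> the projection onto that line is a competitor. For
  \<open>d2\<close> the competitor has the norm of \<open>u\<close>, and on a line this costs at
  most a factor 2 in the square.\<close>

lemma distances_le:
  fixes u :: "'a::euclidean_space \<Rightarrow> real"
  assumes u: "square_integrable u" and \<alpha>: "0 < \<alpha>"
  defines "R \<equiv> (LINT x|lebesgue. (u x)^2) - (LINT x|lebesgue. u x * exp (- \<alpha> * (norm x)^2))^2
      / (gauss_const TYPE('a) / sqrt (2 * \<alpha>) ^ DIM('a))"
  shows "(d1 u)^2 \<le> R" "(d2 u)^2 / 2 \<le> R"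
proof -
  define J where "J = gauss_const TYPE('a) / sqrt (2 * \<alpha>) ^ DIM('a)"
  define I where "I = (LINT x|lebesgue. u x * exp (- \<alpha> * (norm x)^2))"
  define Z where "Z = (LINT x|lebesgue. (u x)^2)"
  have J: "0 < J" using \<alpha> gauss_const_pos[where 'a='a] by (simp add: J_def)
  have Z: "0 \<le> Z" by (simp add: Z_def)
  have R: "R = Z - I^2 / J" by (simp add: R_def Z_def I_def J_def)
  note L = L2norm_diff_gaussian[OF u \<alpha>, folded Z_def I_def J_def]
  \<comment> \<open>c = I / J minimizes the quadratic Z - 2 c I + c^2 J.\<close>
  have LR: "(gauss_dist u (I / J) \<alpha>)^2 = R"
    unfolding L R using J by (simp add: power2_eq_square field_simps)
  have "d1 u \<le> gauss_dist u (I / J) \<alpha>"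
    unfolding d1_def using \<alpha> by (intro cInf_lower bdd_belowI[of _ 0]) (auto intro: L2norm_nonneg)
  moreover have "0 \<le> d1 u"
    unfolding d1_def using \<alpha> by (intro cInf_greatest) (auto intro: L2norm_nonneg)
  ultimately show "(d1 u)^2 \<le> R" unfolding LR[symmetric] by (intro power_mono)
  \<comment> \<open>The norm constraint fixes c up to sign; the sign of I is the one that makes the
    inner product with \<open>u\<close> nonnegative.\<close>
  define \<sigma> :: real where "\<sigma> = (if 0 \<le> I then 1 else - 1)"
  define c where "c = \<sigma> * sqrt (Z / J)"
  have c2: "c^2 * J = Z" using J Z by (simp add: c_def \<sigma>_def power_mult_distrib)
  have norm_u: "(L2norm u)^2 = Z" by (simp add: L2norm_def Z_def)
  have adm: "L2norm u = L2norm (gaussian c \<alpha> :: 'a \<Rightarrow> real)"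
    using norm_u L(2)[of c] c2 L2norm_nonneg by (metis power2_eq_imp_eq)
  have "d2 u \<le> gauss_dist u c \<alpha>"
    unfolding d2_def using \<alpha> adm by (intro cInf_lower bdd_belowI[of _ 0]) (auto intro: L2norm_nonneg)
  moreover have "0 \<le> d2 u"
    unfolding d2_def using \<alpha> adm by (intro cInf_greatest) (auto intro: L2norm_nonneg)
  ultimately have "(d2 u)^2 \<le> (gauss_dist u c \<alpha>)^2" by (intro power_mono)
  also have "\<dots> = 2 * Z - 2 * (sqrt Z * (\<bar>I\<bar> / sqrt J))"
    unfolding L c2 by (auto simp: c_def \<sigma>_def real_sqrt_divide)
  also have "\<dots> \<le> 2 * R"
  proof -
    define A where "A = \<bar>I\<bar> / sqrt J"
    have A: "0 \<le> A" "A^2 = I^2 / J" using J by (auto simp: A_def power_divide)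
    \<comment> \<open>Cauchy-Schwarz, read off from the fact that R is a square. It gives A^2 \<le>
      A sqrt Z, hence 2 Z - 2 A sqrt Z \<le> 2 (Z - A^2).\<close>
    have "A^2 \<le> Z"
      using LR zero_le_power2[of "gauss_dist u (I / J) \<alpha>"] unfolding R A(2) by linarith
    then have "A \<le> sqrt Z" by (rule real_le_rsqrt)
    then have "A * A \<le> sqrt Z * A" using A by (intro mult_right_mono)
    then show ?thesis unfolding R A(2)[symmetric] by (simp add: A_def power2_eq_square)
  qed
  finally show "(d2 u)^2 / 2 \<le> R" by simp
qed

lemma discriminant_bound:
  fixes X Y S :: real
  assumes "\<And>l. 0 < l \<Longrightarrow> l * S \<le> X + l^2 * Y" and "0 \<le> X" "0 \<le> Y" "0 \<le> S"
  shows "S^2 \<le> 4 * X * Y"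
proof (cases "S = 0 \<or> Y = 0")
  case True
  have "S = 0" if "Y = 0"
  proof (rule ccontr)
    assume "S \<noteq> 0"
    then have "0 < S" using assms by simp
    \<comment> \<open>For Y = 0 and S > 0 the left side is unbounded in l; this l gives X + 1 \<le>
      X.\<close>
    then show False using assms(1)[of "(X + 1) / S"] that assms(2) by (simp add: divide_pos_pos)
  qed
  then show ?thesis using True assms by auto
next
  case False
  then have "0 < S" "0 < Y" using assms by auto
  \<comment> \<open>The minimizer of X - l S + l^2 Y.\<close>
  then show ?thesis using assms(1)[of "S / (2 * Y)"] by (simp add: power2_eq_square field_simps)
qed

text \<open>Here \<open>d\<close> is any lower bound for the squared distances to all Gaussian
  lines. The discriminant gives (N Z + 2 d)^2 \<le> 4 X Y, and a quarter of the left side minus N^2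
  Z^2 / 4 is N Z d + d^2. Taking d as the square of \<open>d1\<close>, or as half the square of
  \<open>d2\<close>, produces the two pairs of constants.\<close>

lemma delta2_ge:
  fixes u :: "'a::euclidean_space \<Rightarrow> real"
  assumes u: "u \<in> W12_weighted"
    and d: "0 \<le> d" "\<And>\<alpha>. 0 < \<alpha> \<Longrightarrow> d \<le> (LINT x|lebesgue. (u x)^2)
      - (LINT x|lebesgue. u x * exp (- \<alpha> * (norm x)^2))^2 / (gauss_const TYPE('a) / sqrt (2 * \<alpha>) ^ DIM('a))"
  shows "delta2 u \<ge> real DIM('a) * (LINT x|lebesgue. (u x)^2) * d + d^2"
proof -
  obtain u' g' where ws: "weighted_sobolev u' g'" and ae: "AE x in lebesgue. u x = u' x"
    and X: "(LINT x|lebesgue. (norm (weak_gradient u x))^2) = (L2_sq g')"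
    and Y: "(LINT x|lebesgue. (norm x)^2 * (u x)^2) = (LBINT x. (norm (u' x *\<^sub>R x))^2)"
    and Z: "(LINT x|lebesgue. (u x)^2) = (LBINT x. (u' x)^2)"
    using W12_weighted_borel_version[OF u] .
  interpret weighted_sobolev u' g' by (rule ws)
  define Z' where "Z' = (LBINT x. (u' x)^2)"
  define X' where "X' = (L2_sq g')"
  define Y' where "Y' = (LBINT x. (norm (u' x *\<^sub>R x))^2)"
  have um: "u \<in> borel_measurable lebesgue"
    using u by (auto simp: W12_weighted_def W12_def square_integrable_def)
  have "l * (real DIM('a) * Z' + 2 * d) \<le> X' + l^2 * Y'" if l: "0 < l" for l
  proof -
    let ?G = "\<lambda>x::'a. exp (- (l / 2) * (norm x)^2)"
    have GL: "?G \<in> borel_measurable lebesgue" by (rule measurable_completion) measurable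
    have I: "(LINT x|lebesgue. u x * ?G x) = (LBINT x. u' x * ?G x)"
      by (rule lebesgue_integral_borel_version) (use um GL ae in auto)
    have "d \<le> Z' - (LBINT x. u' x * ?G x)^2 * (sqrt l ^ DIM('a) / gauss_const TYPE('a))"
      \<comment> \<open>With \<alpha> = l / 2 the squared Gaussian has exponent l, which matches the
        normalization in \<open>spectral_gap\<close>.\<close>
      using d(2)[of "l / 2"] l unfolding I Z Z'_def[symmetric] by simp
    then have "2 * l * d \<le> 2 * l * (Z' - (LBINT x. u' x * ?G x)^2 * (sqrt l ^ DIM('a) / gauss_const TYPE('a)))"
      using l by (intro mult_left_mono) auto
    then show ?thesis
      using spectral_gap[OF l] unfolding X'_def[symmetric] Y'_def[symmetric] Z'_def[symmetric]
      by (simp add: algebra_simps)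
  qed
  then have "(real DIM('a) * Z' + 2 * d)^2 \<le> 4 * X' * Y'"
    using d(1) by (intro discriminant_bound) (auto simp: X'_def Y'_def Z'_def)
  then show ?thesis
    unfolding delta2_def X Y Z X'_def[symmetric] Y'_def[symmetric] Z'_def[symmetric]
    by (simp add: power2_eq_square algebra_simps)
qed

lemma stability_ineq_d1: "stability_ineq (d1 :: ('a::euclidean_space \<Rightarrow> real) \<Rightarrow> real) (real DIM('a)) 1"
  unfolding stability_ineq_def
proof
  fix u :: "'a \<Rightarrow> real" assume u: "u \<in> W12_weighted"
  then have "square_integrable u" by (simp add: W12_weighted_def W12_def)
  from delta2_ge[OF u zero_le_power2 distances_le(1)[OF this]]
  show "delta2 u \<ge> stability_rhs d1 (real DIM('a)) 1 u" by (simp add: stability_rhs_def)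
qed

lemma stability_ineq_d2: "stability_ineq (d2 :: ('a::euclidean_space \<Rightarrow> real) \<Rightarrow> real) (real DIM('a) / 2) (1 / 4)"
  unfolding stability_ineq_def
proof
  fix u :: "'a \<Rightarrow> real" assume u: "u \<in> W12_weighted"
  then have "square_integrable u" by (simp add: W12_weighted_def W12_def)
  from delta2_ge[OF u _ distances_le(2)[OF this]]
  show "delta2 u \<ge> stability_rhs d2 (real DIM('a) / 2) (1 / 4) u"
    by (simp add: stability_rhs_def power_divide)
qed

section \<open>Gaussian moments and the extremal function\<close>

text \<open>Integration by parts against the constant 1, whose weak gradient is 0. The constant is
  not square integrable, but \<open>weak_gradient_smooth\<close> asks only for integrable
  products.\<close>

lemma integral_derivative_gaussian_decay:
  fixes F :: "'a::euclidean_space \<Rightarrow> real"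
  assumes i: "i \<in> Basis" and F: "smooth F" "gaussian_decay F"
    and D: "\<And>x. (F has_derivative D x) (at x)" and dec: "gaussian_decay (\<lambda>x. D x i)"
  shows "(LBINT x. D x i) = 0"
proof -
  have e: "partial i F x = D x i" for x using frechet_derivative_at[OF D] by metis
  have Fm: "F \<in> borel_measurable lborel" and Dm: "(\<lambda>x. D x i) \<in> borel_measurable lborel"
    using smooth_borel_measurable[OF F(1)] smooth_borel_measurable[OF smooth_derivative[OF F(1) i]]
    by (simp_all add: e)
  have g: "grad (\<lambda>x::'a. 1::real) x = 0" for x by (simp add: grad_def frechet_derivative_const)
  have "(LINT x|lebesgue. 1 * partial i F x) = - (LINT x|lebesgue. (grad (\<lambda>x. 1) x \<bullet> i) * F x)"
    by (rule weak_gradient_smooth[OF smooth_is_weak_gradient[OF smooth_const] F(1) i])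
       (use gaussian_decay_integrable[OF F(2)] gaussian_decay_integrable[OF dec] Fm Dm in
         \<open>simp_all add: e g integrable_completion\<close>)
  then show ?thesis using Dm by (simp add: e g integral_completion)
qed

lemma exp_norm_sq_has_derivative:
  "((\<lambda>x. exp (- s * (norm x)^2)) has_derivative (\<lambda>v. - (2 * s) * (x \<bullet> v) * exp (- s * (norm x)^2))) (at x)"
  for x :: "'a::euclidean_space"
proof -
  have "((\<lambda>x. - s * (x \<bullet> x)) has_derivative (\<lambda>v. - (2 * s) * (x \<bullet> v))) (at x)"
    by (auto intro!: derivative_eq_intros simp: inner_commute)
  from has_derivative_exp[OF this] show ?thesis by (simp only: power2_norm_eq_inner)
qed

lemma smooth_exp_norm_sq: "smooth (\<lambda>x. exp (- s * (norm x)^2))" by (intro smooth_intros)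

context
  fixes e :: "'a::euclidean_space"
  assumes e: "e \<in> Basis"
begin

abbreviation (input) "gauss \<equiv> \<lambda>x::'a. exp (- (norm x)\<^sup>2)"

lemma gaussian_decay_gauss: "gaussian_decay gauss" using gaussian_decay_exp[of 1] by simp

lemma gauss_has_derivative: "(gauss has_derivative (\<lambda>v. - 2 * (x \<bullet> v) * gauss x)) (at x)"
  using exp_norm_sq_has_derivative[of 1 x] by simp

text \<open>The integrand is a multiple of a partial derivative of the Gaussian. This makes
  \<open>extremal\<close> orthogonal to every centered Gaussian.\<close>

lemma integral_odd_moment:
  assumes s: "0 < s"
  shows "(LBINT x. (x \<bullet> e) * exp (- s * (norm x)^2)) = 0"
proof -
  have "(LBINT x. - (2 * s) * (x \<bullet> e) * exp (- s * (norm x)^2)) = 0"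
  proof (rule integral_derivative_gaussian_decay[OF e smooth_exp_norm_sq gaussian_decay_exp[OF s] exp_norm_sq_has_derivative])
    show "gaussian_decay (\<lambda>x. - (2 * s) * (x \<bullet> e) * exp (- s * (norm x)^2))"
      unfolding mult.assoc using s by (intro gaussian_decay_cmult gaussian_decay_mult_inner gaussian_decay_exp)
  qed
  then have "- (2 * s) * (LBINT x. (x \<bullet> e) * exp (- s * (norm x)^2)) = 0"
    by (simp only: mult.assoc integral_mult_right_zero)
  then show ?thesis using s by simp
qed

lemma gauss_moments_integrable:
  "integrable lborel gauss"
  "integrable lborel (\<lambda>x. (x \<bullet> e)^2 * gauss x)"
  "integrable lborel (\<lambda>x. (norm x)^2 * ((x \<bullet> e)^2 * gauss x))"
proof -
  note d = gaussian_decay_gauss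
  show "integrable lborel gauss" by (intro gaussian_decay_integrable d) measurable
  have "integrable lborel (\<lambda>x. (x \<bullet> e) * ((x \<bullet> e) * gauss x))"
    "integrable lborel (\<lambda>x. (norm x)^2 * ((x \<bullet> e) * ((x \<bullet> e) * gauss x)))"
    by (intro gaussian_decay_integrable gaussian_decay_mult_norm_sq gaussian_decay_mult_inner d; measurable)+
  then show "integrable lborel (\<lambda>x. (x \<bullet> e)^2 * gauss x)"
    "integrable lborel (\<lambda>x. (norm x)^2 * ((x \<bullet> e)^2 * gauss x))"
    by (simp_all add: power2_eq_square mult.assoc)
qed

text \<open>The derivative of \<open>(x \<bullet> e) * gauss x\<close> in direction e has integral
  0.\<close>

lemma gauss_second_moment:
  "(LBINT x. gauss x) = 2 * (LBINT x. (x \<bullet> e)^2 * gauss x)"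
proof -
  note d = gaussian_decay_gauss
  have "(LBINT x. (x \<bullet> e) * (- 2 * (x \<bullet> e) * gauss x) + (e \<bullet> e) * gauss x) = 0"
  proof (rule integral_derivative_gaussian_decay[OF e,
        where D="\<lambda>x v. (x \<bullet> e) * (- 2 * (x \<bullet> v) * gauss x) + (v \<bullet> e) * gauss x"])
    show "((\<lambda>x. (x \<bullet> e) * gauss x) has_derivative (\<lambda>v. (x \<bullet> e) * (- 2 * (x \<bullet> v) * gauss x) + (v \<bullet> e) * gauss x)) (at x)" for x
      by (rule has_derivative_mult[OF _ gauss_has_derivative]) (auto intro!: derivative_eq_intros)
    show "smooth (\<lambda>x. (x \<bullet> e) * gauss x)" by (intro smooth_intros)
    show "gaussian_decay (\<lambda>x. (x \<bullet> e) * gauss x)" by (intro gaussian_decay_mult_inner d)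
    show "gaussian_decay (\<lambda>x. (x \<bullet> e) * (- 2 * (x \<bullet> e) * gauss x) + (e \<bullet> e) * gauss x)"
      unfolding mult.assoc by (intro gaussian_decay_add gaussian_decay_mult_inner gaussian_decay_cmult d)
  qed
  also have "(\<lambda>x. (x \<bullet> e) * (- 2 * (x \<bullet> e) * gauss x) + (e \<bullet> e) * gauss x) = (\<lambda>x. gauss x - 2 * ((x \<bullet> e)^2 * gauss x))"
    using e by (intro ext) (simp add: power2_eq_square)
  finally show ?thesis using gauss_moments_integrable by simp
qed

text \<open>The divergence of the field x (x . e)^2 exp (- |x|^2) has integral 0: N comes from the
  divergence of x, 2 from the homogeneity of (x . e)^2, and - 2 |x|^2 from the Gaussian.\<close>

lemma gauss_fourth_moment:
  "2 * (LBINT x. (norm x)^2 * ((x \<bullet> e)^2 * gauss x))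
    = (real DIM('a) + 2) * (LBINT x. (x \<bullet> e)^2 * gauss x)"
proof -
  note d = gaussian_decay_gauss
  define D where "D i x v = (x \<bullet> i) * ((x \<bullet> e) * ((x \<bullet> e) * (- 2 * (x \<bullet> v) * gauss x) + (v \<bullet> e) * gauss x) + (v \<bullet> e) * ((x \<bullet> e) * gauss x))
      + (v \<bullet> i) * ((x \<bullet> e) * ((x \<bullet> e) * gauss x))" for i x v
  have dec: "gaussian_decay (\<lambda>x. D i x i)" for i
    unfolding D_def mult.assoc by (intro gaussian_decay_add gaussian_decay_mult_inner gaussian_decay_cmult d)
  have Dm: "(\<lambda>x. D i x i) \<in> borel_measurable borel" for i unfolding D_def by measurable
  have z: "(LBINT x. D i x i) = 0" if i: "i \<in> Basis" for i
  proof (rule integral_derivative_gaussian_decay[where D="D i", OF i _ _ _ dec])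
    show "((\<lambda>x. (x \<bullet> i) * ((x \<bullet> e) * ((x \<bullet> e) * gauss x))) has_derivative D i x) (at x)" for x
      unfolding D_def[abs_def]
      by (rule has_derivative_mult[OF _ has_derivative_mult[OF _ has_derivative_mult[OF _ gauss_has_derivative]]])
         (auto intro!: derivative_eq_intros)
    show "smooth (\<lambda>x. (x \<bullet> i) * ((x \<bullet> e) * ((x \<bullet> e) * gauss x)))" by (intro smooth_intros)
    show "gaussian_decay (\<lambda>x. (x \<bullet> i) * ((x \<bullet> e) * ((x \<bullet> e) * gauss x)))"
      by (intro gaussian_decay_mult_inner d)
  qed
  have "0 = (\<Sum>i\<in>Basis. \<integral>x. D i x i \<partial>lborel)" using z by simp
  also have "\<dots> = (LBINT x. (\<Sum>i\<in>Basis. D i x i))" using gaussian_decay_integrable[OF dec Dm] by simp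
  also have "(\<lambda>x. \<Sum>i\<in>Basis. D i x i) = (\<lambda>x. (real DIM('a) + 2) * ((x \<bullet> e)^2 * gauss x) - 2 * ((norm x)^2 * ((x \<bullet> e)^2 * gauss x)))"
  proof
    fix x
    have D: "D i x i = (x \<bullet> e)^2 * gauss x * (- 2 * ((x \<bullet> i) * (x \<bullet> i)) + 1) + 2 * (x \<bullet> e) * gauss x * ((x \<bullet> i) * (e \<bullet> i))" if "i \<in> Basis" for i
      using that by (simp add: D_def power2_eq_square inner_commute algebra_simps)
    have "(\<Sum>i\<in>Basis. D i x i) = (x \<bullet> e)^2 * gauss x * (- 2 * (x \<bullet> x) + real DIM('a)) + 2 * (x \<bullet> e) * gauss x * (x \<bullet> e)"
    proof -
      have "(\<Sum>i\<in>(Basis::'a set). \<beta> * (- 2 * p i + 1) + \<gamma> * q i)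
          = \<beta> * (- 2 * (\<Sum>i\<in>Basis. p i) + real DIM('a)) + \<gamma> * (\<Sum>i\<in>Basis. q i)"
        for \<beta> \<gamma> :: real and p q :: "'a \<Rightarrow> real"
        by (simp only: sum.distrib sum_constant sum_distrib_left[symmetric] mult_1_right)
      then show ?thesis
        using euclidean_inner[of x x, symmetric] euclidean_inner[of x e, symmetric] D
        by (simp only: cong: sum.cong)
    qed
    then show "(\<Sum>i\<in>Basis. D i x i) = (real DIM('a) + 2) * ((x \<bullet> e)^2 * gauss x) - 2 * ((norm x)^2 * ((x \<bullet> e)^2 * gauss x))"
      by (simp add: power2_eq_square power2_norm_eq_inner algebra_simps flip: power2_norm_eq_inner)
  qed
  finally show ?thesis using gauss_moments_integrable by simp
qed

definition extremal :: "'a \<Rightarrow> real" where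
  "extremal x = (x \<bullet> e) * exp (- (1 / 2) * (norm x)^2)"

abbreviation "mass \<equiv> \<integral>x. (x \<bullet> e)^2 * gauss x \<partial>lborel"

lemma mass_pos: "0 < mass"
  using gauss_second_moment gauss_const_pos[where 'a='a] by (simp add: gauss_const_def)

lemma exp_half_sq: "(exp (- (1 / 2) * (norm x)^2))^2 = gauss x"
  by (simp add: power2_eq_square flip: exp_add)

lemma extremal_sq: "(extremal x)^2 = (x \<bullet> e)^2 * gauss x"
  by (simp only: extremal_def power_mult_distrib exp_half_sq)

lemma smooth_extremal: "smooth extremal" unfolding extremal_def[abs_def] by (intro smooth_intros)

lemma extremal_measurable: "extremal \<in> borel_measurable borel"
  by (rule smooth_borel_measurable[OF smooth_extremal])

lemma grad_extremal: "grad extremal x = exp (- (1 / 2) * (norm x)^2) *\<^sub>R (e - (x \<bullet> e) *\<^sub>R x)"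
proof (rule euclidean_eqI)
  fix i :: 'a assume i: "i \<in> Basis"
  have "(extremal has_derivative (\<lambda>v. (x \<bullet> e) * (- (2 * (1 / 2)) * (x \<bullet> v) * exp (- (1 / 2) * (norm x)^2)) + (v \<bullet> e) * exp (- (1 / 2) * (norm x)^2))) (at x)"
    unfolding extremal_def[abs_def]
    by (rule has_derivative_mult[OF _ exp_norm_sq_has_derivative]) (auto intro!: derivative_eq_intros)
  from frechet_derivative_at[OF this, symmetric]
  have "partial i extremal x = exp (- (1 / 2) * (norm x)^2) * (e \<bullet> i - (x \<bullet> e) * (x \<bullet> i))"
    by (simp add: inner_commute algebra_simps)
  then show "grad extremal x \<bullet> i = (exp (- (1 / 2) * (norm x)^2) *\<^sub>R (e - (x \<bullet> e) *\<^sub>R x)) \<bullet> i"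
    unfolding grad_def using i by (simp add: inner_sum_left_Basis inner_diff_left)
qed

lemma grad_extremal_sq:
  "(norm (grad extremal x))^2 = gauss x - 2 * ((x \<bullet> e)^2 * gauss x) + (norm x)^2 * ((x \<bullet> e)^2 * gauss x)"
proof -
  have "(norm (e - (x \<bullet> e) *\<^sub>R x))^2 = 1 - 2 * (x \<bullet> e)^2 + (norm x)^2 * (x \<bullet> e)^2"
    using e unfolding power2_norm_eq_inner
    by (simp add: inner_diff_left inner_diff_right inner_commute power2_eq_square algebra_simps)
  then have "(norm (grad extremal x))^2 = gauss x * (1 - 2 * (x \<bullet> e)^2 + (norm x)^2 * (x \<bullet> e)^2)"
    unfolding grad_extremal norm_scaleR power_mult_distrib power2_abs exp_half_sq by simp
  then show ?thesis by (simp add: algebra_simps)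
qed

lemma grad_extremal_measurable: "grad extremal \<in> borel_measurable borel"
  unfolding grad_extremal[abs_def] by measurable

lemma extremal_in_W12_weighted: "extremal \<in> W12_weighted"
proof -
  have sq: "square_integrable f" if "f \<in> borel_measurable borel" "L2 f"
    for f :: "'a \<Rightarrow> 'b::euclidean_space" using that unfolding square_integrable_def
    by (subst integrable_completion) (auto intro: measurable_completion)
  have "square_integrable extremal"
    using gauss_moments_integrable by (intro sq extremal_measurable) (simp add: extremal_sq)
  moreover have "square_integrable (grad extremal)"
    using gauss_moments_integrable by (intro sq grad_extremal_measurable) (simp add: grad_extremal_sq)
  moreover have "square_integrable (\<lambda>x. extremal x *\<^sub>R x)"
    using extremal_measurable gauss_moments_integrable
    by (intro sq) (simp_all add: power_mult_distrib extremal_sq mult.commute mult.left_commute)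
  ultimately show ?thesis
    unfolding W12_weighted_def W12_def using smooth_is_weak_gradient[OF smooth_extremal] by blast
qed

lemma integral_extremal_sq: "(LINT x|lebesgue. (extremal x)^2) = mass"
  unfolding extremal_sq by (rule integral_completion) measurable

text \<open>Both factors of the product equal (N + 2) / 2 times \<open>mass\<close>, and ((N + 2)^2
  - N^2) / 4 = N + 1.\<close>

lemma delta2_extremal: "delta2 extremal = (real DIM('a) + 1) * mass^2"
proof -
  define B where "B = (LBINT x. (norm x)^2 * ((x \<bullet> e)^2 * gauss x))"
  have B: "B = (real DIM('a) + 2) / 2 * mass" using gauss_fourth_moment by (simp add: B_def)
  have w: "is_weak_gradient extremal (grad extremal)"
    by (rule smooth_is_weak_gradient[OF smooth_extremal])
  have "(LINT x|lebesgue. (norm (weak_gradient extremal x))^2) = (LBINT x. (norm (grad extremal x))^2)"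
  proof (rule lebesgue_integral_borel_version)
    show "(\<lambda>x. (norm (weak_gradient extremal x))^2) \<in> borel_measurable lebesgue"
      using weak_gradient_AE(2)[OF w] by measurable
    show "(\<lambda>x. (norm (grad extremal x))^2) \<in> borel_measurable borel"
      using grad_extremal_measurable by measurable
    show "AE x in lebesgue. (norm (weak_gradient extremal x))^2 = (norm (grad extremal x))^2"
      using weak_gradient_AE(1)[OF w] by eventually_elim simp
  qed
  also have "\<dots> = B"
    unfolding grad_extremal_sq B_def using gauss_moments_integrable gauss_second_moment by simp
  finally have X: "(LINT x|lebesgue. (norm (weak_gradient extremal x))^2) = B" .
  have Y: "(LINT x|lebesgue. (norm x)^2 * (extremal x)^2) = B"
    unfolding extremal_sq B_def by (rule integral_completion) measurable
  show ?thesis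
    unfolding delta2_def X Y integral_extremal_sq B by (simp add: power2_eq_square field_simps)
qed

text \<open>Pythagoras: the inner product with a Gaussian is an odd moment and vanishes.\<close>

lemma L2norm_extremal_diff_gaussian:
  assumes \<alpha>: "0 < \<alpha>"
  shows "(gauss_dist extremal c \<alpha>)^2 = mass + (L2norm (gaussian c \<alpha> :: 'a \<Rightarrow> real))^2"
proof -
  have sq: "square_integrable extremal"
    using extremal_in_W12_weighted by (simp add: W12_weighted_def W12_def)
  have "extremal x * exp (- \<alpha> * (norm x)^2) = (x \<bullet> e) * exp (- (1 / 2 + \<alpha>) * (norm x)^2)" for x
    unfolding extremal_def by (simp add: algebra_simps flip: exp_add)
  then have "(LINT x|lebesgue. extremal x * exp (- \<alpha> * (norm x)^2)) = (LBINT x. (x \<bullet> e) * exp (- (1 / 2 + \<alpha>) * (norm x)^2))"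
    by (simp only:) (rule integral_completion, measurable)
  also have "\<dots> = 0" using \<alpha> by (intro integral_odd_moment) simp
  finally show ?thesis unfolding L2norm_diff_gaussian[OF sq \<alpha>] integral_extremal_sq by simp
qed

lemma L2norm_extremal: "L2norm extremal = sqrt mass"
  using integral_extremal_sq by (simp add: L2norm_def)

lemma d1_extremal: "d1 extremal = sqrt mass" unfolding d1_def
proof (rule cInf_eq_minimum)
  \<comment> \<open>The amplitude c = 0 is allowed, so the zero function is a competitor, and by
    orthogonality the best one.\<close>
  have "(\<lambda>x. extremal x - gaussian 0 1 x) = extremal" by (simp add: gaussian_def)
  then have "sqrt mass = gauss_dist extremal 0 1" by (simp only: L2norm_extremal)
  then show "sqrt mass \<in> {gauss_dist extremal c \<alpha> |c \<alpha>. 0 < \<alpha>}" using zero_less_one by blast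
  fix y assume "y \<in> {gauss_dist extremal c \<alpha> |c \<alpha>. 0 < \<alpha>}"
  then obtain c \<alpha> where y: "y = gauss_dist extremal c \<alpha>" "0 < \<alpha>" by blast
  show "sqrt mass \<le> y" unfolding y(1) using L2norm_extremal_diff_gaussian[OF y(2), of c]
    by (intro real_le_lsqrt) (auto simp: L2norm_nonneg)
qed

text \<open>By orthogonality all Gaussians of the right norm are equally far away; it remains to
  exhibit one of them.\<close>

lemma d2_extremal: "d2 extremal = sqrt (2 * mass)"
proof -
  have *: "gauss_dist extremal c \<alpha> = sqrt (2 * mass)"
    if "0 < \<alpha>" "L2norm extremal = L2norm (gaussian c \<alpha> :: 'a \<Rightarrow> real)" for c \<alpha>
  proof -
    have "(gauss_dist extremal c \<alpha>)^2 = 2 * mass"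
      using L2norm_extremal_diff_gaussian[OF that(1), of c] mass_pos
      unfolding that(2)[symmetric] L2norm_extremal by simp
    then show ?thesis by (metis L2norm_nonneg real_sqrt_unique)
  qed
  \<comment> \<open>The amplitude that gives the Gaussian with \<alpha> = 1 the norm of
    \<open>extremal\<close>.\<close>
  define c where "c = sqrt (mass / (gauss_const TYPE('a) / sqrt (2 * 1) ^ DIM('a)))"
  have "(L2norm (gaussian c 1 :: 'a \<Rightarrow> real))^2 = mass"
  proof -
    have sq: "square_integrable extremal"
      using extremal_in_W12_weighted by (simp add: W12_weighted_def W12_def)
    have "0 < gauss_const TYPE('a) / sqrt (2 * 1) ^ DIM('a)"
      using gauss_const_pos[where 'a='a] by simp
    then have "c^2 = mass / (gauss_const TYPE('a) / sqrt (2 * 1) ^ DIM('a))"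
      unfolding c_def using mass_pos by (intro real_sqrt_pow2 divide_nonneg_pos) auto
    then show ?thesis
      unfolding L2norm_diff_gaussian(2)[OF sq zero_less_one] using gauss_const_pos[where 'a='a] by simp
  qed
  then have adm: "L2norm extremal = L2norm (gaussian c 1 :: 'a \<Rightarrow> real)"
    unfolding L2norm_extremal by (metis L2norm_nonneg real_sqrt_unique)
  show ?thesis unfolding d2_def
  proof (rule cInf_eq_minimum)
    show "sqrt (2 * mass) \<in> {gauss_dist extremal c \<alpha> |c \<alpha>.
        0 < \<alpha> \<and> L2norm extremal = L2norm (gaussian c \<alpha> :: 'a \<Rightarrow> real)}"
      using *[OF zero_less_one adm, symmetric] adm zero_less_one by blast
    fix y assume "y \<in> {gauss_dist extremal c \<alpha> |c \<alpha>.
        0 < \<alpha> \<and> L2norm extremal = L2norm (gaussian c \<alpha> :: 'a \<Rightarrow> real)}"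
    then obtain c \<alpha> where "y = gauss_dist extremal c \<alpha>" "0 < \<alpha>"
      "L2norm extremal = L2norm (gaussian c \<alpha> :: 'a \<Rightarrow> real)" by blast
    then show "sqrt (2 * mass) \<le> y" using * by simp
  qed
qed

text \<open>In units of the squared \<open>mass\<close> the right-hand sides are N + 1 for the
  squared distance 1, and (N / 2) 2 + (1 / 4) 4 for the squared distance 2.\<close>

lemma extremal_equality:
  "delta2 extremal = stability_rhs d1 (real DIM('a)) 1 extremal"
  "delta2 extremal = stability_rhs d2 (real DIM('a) / 2) (1 / 4) extremal"
proof -
  have "(sqrt mass)^2 = mass" "(sqrt (2 * mass))^2 = 2 * mass" using mass_pos by auto
  moreover have "x ^ 4 = (x^2)^2" for x :: real by simp
  ultimately show "delta2 extremal = stability_rhs d1 (real DIM('a)) 1 extremal"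
    "delta2 extremal = stability_rhs d2 (real DIM('a) / 2) (1 / 4) extremal"
    unfolding stability_rhs_def delta2_extremal integral_extremal_sq d1_extremal d2_extremal
    by (simp_all only:) (simp_all add: power2_eq_square algebra_simps)
qed

end

text \<open>At a function where equality holds with positive mass and distance, enlarging either
  constant strictly raises the right-hand side, so a single extremal function refutes both
  improvements.\<close>

lemma sharp_attained_if_equality:
  assumes u: "u \<in> W12_weighted" and eq: "delta2 u = stability_rhs d a b u"
    and pos: "0 < (LINT x|lebesgue. (u x)^2)" "0 < d u" "0 < delta2 u"
  shows "sharp_constants d a b" "attained_nontrivially d a b"
proof -
  have "delta2 u < stability_rhs d a' b u" if "a' > a" for a'
    unfolding eq stability_rhs_def using that pos by (simp add: mult_strict_right_mono)
  moreover have "delta2 u < stability_rhs d a b' u" if "b' > b" for b'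
    unfolding eq stability_rhs_def using that pos by (simp add: mult_strict_right_mono)
  ultimately show "sharp_constants d a b"
    unfolding sharp_constants_def stability_ineq_def using u by (meson not_le)
  show "attained_nontrivially d a b" unfolding attained_nontrivially_def using u eq pos(3) by auto
qed

theorem theorem1p3:
  shows "(\<forall>u::'a::euclidean_space \<Rightarrow> real. u \<in> W12_weighted \<longrightarrow>
            delta2 u \<ge> real DIM('a) * (\<integral>x. (u x)\<^sup>2 \<partial>lebesgue) * (d1 u)\<^sup>2 + (d1 u) ^ 4)
       \<and> (\<forall>u::'a \<Rightarrow> real. u \<in> W12_weighted \<longrightarrow>
            delta2 u \<ge> real DIM('a) / 2 * (\<integral>x. (u x)\<^sup>2 \<partial>lebesgue) * (d2 u)\<^sup>2
                       + 1 / 4 * (d2 u) ^ 4)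
       \<and> sharp_constants (d1 :: ('a \<Rightarrow> real) \<Rightarrow> real) (real DIM('a)) 1
       \<and> sharp_constants (d2 :: ('a \<Rightarrow> real) \<Rightarrow> real) (real DIM('a) / 2) (1 / 4)
       \<and> attained_nontrivially (d1 :: ('a \<Rightarrow> real) \<Rightarrow> real) (real DIM('a)) 1
       \<and> attained_nontrivially (d2 :: ('a \<Rightarrow> real) \<Rightarrow> real) (real DIM('a) / 2) (1 / 4)"
proof -
  obtain e :: 'a where e: "e \<in> Basis"
    using nonempty_Basis by blast
  note pos = mass_pos[OF e]
  have p: "0 < (LINT x|lebesgue. (extremal e x)\<^sup>2)" "0 < d1 (extremal e)" "0 < d2 (extremal e)" "0 < delta2 (extremal e)"
    using pos by (simp_all add: integral_extremal_sq[OF e] d1_extremal[OF e] d2_extremal[OF e] delta2_extremal[OF e])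
  show ?thesis
    using stability_ineq_d1[where 'a='a] stability_ineq_d2[where 'a='a]
      sharp_attained_if_equality[OF extremal_in_W12_weighted[OF e] extremal_equality(1)[OF e] p(1,2,4)]
      sharp_attained_if_equality[OF extremal_in_W12_weighted[OF e] extremal_equality(2)[OF e] p(1,3,4)]
    unfolding stability_ineq_def stability_rhs_def by simp
qed

end
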